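(* Let $(\mathcal{A},Q_{\mathcal{A}})$ be an object of $\widetilde{\mathrm{Df}}_n$. Then $\mathcal{A}\in\mathrm{Df}_n$ (i.e. $\mathcal{A}$ admits a projective generator) if and only if $\mathcal{A}\simeq\mathcal{A}_l$ for some $l\in\mathbb{N}$ (i.e. the Loewy length of objects of $\mathcal{A}$ is uniformly bounded).
   Context: $\Bbbk$ is an algebraically closed field. A $\Bbbk$-linear abelian category is of finite length if all its $\operatorname{Hom}$ and $\operatorname{Ext}^1$ spaces are finite dimensional, it has finitely many isomorphism classes of simple objects, and every object has a finite filtration with semi-simple graded factors (semi-simple = finite direct sum of simple objects). Objects of $\widetilde{\mathrm{Df}}_n$ are pairs $(\mathcal{A},Q_{\mathcal{A}})$ with $\mathcal{A}$ a $\Bbbk$-linear abelian category of finite length and $Q_{\mathcal{A}}\colon\operatorname{mod-}\Bbbk^{\oplus n}\to\mathcal{A}$ a fully faithful ($\Bbbk$-linear) functor whose essential image is the subcategory of semi-simple objects; here $\operatorname{mod-}\Bbbk^{\oplus n}$ is the category of finite dimensional right modules. $\mathrm{Df}_n\subset\widetilde{\mathrm{Df}}_n$ is the full subcategory of those $(\mathcal{A},Q_{\mathcal{A}})$ for which $\mathcal{A}$ has a projective generator. The functor $Q_{\mathcal{A}}$ has a left adjoint $Q_{\mathcal{A}}^*$, and $Q_{\mathcal{A}}Q_{\mathcal{A}}^*(A)$ is the maximal semi-simple quotient of $A$. The radical $\mathcal{R}A$ of $A\in\mathcal{A}$ is the kernel of the adjunction unit $A\to Q_{\mathcal{A}}Q_{\mathcal{A}}^*A$.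 $\mathcal{A}_l\subset\mathcal{A}$ is the full subcategory of objects $A$ with $\mathcal{R}^{l+1}A=0$; $\mathcal{A}\simeq\mathcal{A}_l$ means that the inclusion $\mathcal{A}_l\subset\mathcal{A}$ is an equivalence. The Loewy length of $A$ is the minimal $l$ for which there is a filtration $0=F_{l+1}\subset F_l\subset\cdots\subset F_0=A$ with semi-simple graded factors $F_i/F_{i+1}$; $\mathcal{A}_l$ is the subcategory of objects of Loewy length at most $l$. *)

theory Defs
  imports "HOL-Algebra.Algebra" "HOL-Algebra.Algebraic_Closure_Type"
begin

section \<open>Linear categories\<close>

text \<open>
  The Hom-spaces are modules in the sense of HOL-Algebra over the field given by the type
  \<open>'k\<close>; the multiplicative fields of these module records carry no meaning.
  A morphism belongs to at most one Hom-space (axiom \<open>Hom_disjoint\<close>), so that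
  composition needs no object indices. \<open>g \<bullet> f\<close> is \<open>g\<close> after \<open>f\<close>.
\<close>

record ('o, 'm, 'k) lcat =
  Ob :: "'o set"
  Hom :: "'o \<Rightarrow> 'o \<Rightarrow> ('k, 'm) module"
  ident :: "'o \<Rightarrow> 'm"
  comp :: "'m \<Rightarrow> 'm \<Rightarrow> 'm"  (infixl \<open>\<bullet>\<index>\<close> 70)

abbreviation mor :: "('o, 'm, 'k) lcat \<Rightarrow> 'o \<Rightarrow> 'o \<Rightarrow> 'm set" where
  "mor C A B \<equiv> carrier (Hom C A B)"

abbreviation zero_mor :: "('o, 'm, 'k) lcat \<Rightarrow> 'o \<Rightarrow> 'o \<Rightarrow> 'm" where
  "zero_mor C A B \<equiv> \<zero>\<^bsub>Hom C A B\<^esub>"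

locale linear_category =
  fixes C :: "('o, 'm, 'k::field) lcat" (structure)
  assumes Hom_module:
      "\<lbrakk>A \<in> Ob C; B \<in> Ob C\<rbrakk> \<Longrightarrow> module (ring_of_type_algebra :: 'k ring) (Hom C A B)"
    and Hom_disjoint:
      "\<lbrakk>A \<in> Ob C; B \<in> Ob C; A' \<in> Ob C; B' \<in> Ob C; f \<in> mor C A B; f \<in> mor C A' B'\<rbrakk>
        \<Longrightarrow> A = A' \<and> B = B'"
    and ident_closed: "A \<in> Ob C \<Longrightarrow> ident C A \<in> mor C A A"
    and comp_closed:
      "\<lbrakk>A \<in> Ob C; B \<in> Ob C; D \<in> Ob C; f \<in> mor C A B; g \<in> mor C B D\<rbrakk>
        \<Longrightarrow> g \<bullet> f \<in> mor C A D"
    and comp_assoc: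
      "\<lbrakk>A \<in> Ob C; B \<in> Ob C; D \<in> Ob C; E \<in> Ob C;
        f \<in> mor C A B; g \<in> mor C B D; h \<in> mor C D E\<rbrakk>
        \<Longrightarrow> (h \<bullet> g) \<bullet> f = h \<bullet> (g \<bullet> f)"
    and comp_ident_right: "\<lbrakk>A \<in> Ob C; B \<in> Ob C; f \<in> mor C A B\<rbrakk> \<Longrightarrow> f \<bullet> ident C A = f"
    and comp_ident_left: "\<lbrakk>A \<in> Ob C; B \<in> Ob C; f \<in> mor C A B\<rbrakk> \<Longrightarrow> ident C B \<bullet> f = f"
    and comp_add_left:
      "\<lbrakk>A \<in> Ob C; B \<in> Ob C; D \<in> Ob C; f \<in> mor C A B; g \<in> mor C B D; g' \<in> mor C B D\<rbrakk>
        \<Longrightarrow> (g \<oplus>\<^bsub>Hom C B D\<^esub> g') \<bullet> f = (g \<bullet> f) \<oplus>\<^bsub>Hom C A D\<^esub> (g' \<bullet> f)"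
    and comp_add_right:
      "\<lbrakk>A \<in> Ob C; B \<in> Ob C; D \<in> Ob C; f \<in> mor C A B; f' \<in> mor C A B; g \<in> mor C B D\<rbrakk>
        \<Longrightarrow> g \<bullet> (f \<oplus>\<^bsub>Hom C A B\<^esub> f') = (g \<bullet> f) \<oplus>\<^bsub>Hom C A D\<^esub> (g \<bullet> f')"
    and comp_smult_left:
      "\<lbrakk>A \<in> Ob C; B \<in> Ob C; D \<in> Ob C; f \<in> mor C A B; g \<in> mor C B D\<rbrakk>
        \<Longrightarrow> (a \<odot>\<^bsub>Hom C B D\<^esub> g) \<bullet> f = a \<odot>\<^bsub>Hom C A D\<^esub> (g \<bullet> f)"
    and comp_smult_right:
      "\<lbrakk>A \<in> Ob C; B \<in> Ob C; D \<in> Ob C; f \<in> mor C A B; g \<in> mor C B D\<rbrakk>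
        \<Longrightarrow> g \<bullet> (a \<odot>\<^bsub>Hom C A B\<^esub> f) = a \<odot>\<^bsub>Hom C A D\<^esub> (g \<bullet> f)"

definition full_subcategory :: "('o, 'm, 'k) lcat \<Rightarrow> 'o set \<Rightarrow> ('o, 'm, 'k) lcat" where
  "full_subcategory C S = C\<lparr>Ob := Ob C \<inter> S\<rparr>"

definition isomorphism :: "('o, 'm, 'k) lcat \<Rightarrow> 'o \<Rightarrow> 'o \<Rightarrow> 'm \<Rightarrow> bool" where
  "isomorphism C A B f \<longleftrightarrow> f \<in> mor C A B \<and>
     (\<exists>g \<in> mor C B A. g \<bullet>\<^bsub>C\<^esub> f = ident C A \<and> f \<bullet>\<^bsub>C\<^esub> g = ident C B)"

definition isomorphic :: "('o, 'm, 'k) lcat \<Rightarrow> 'o \<Rightarrow> 'o \<Rightarrow> bool" where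
  "isomorphic C A B \<longleftrightarrow> A \<in> Ob C \<and> B \<in> Ob C \<and> (\<exists>f. isomorphism C A B f)"

definition monic :: "('o, 'm, 'k) lcat \<Rightarrow> 'o \<Rightarrow> 'o \<Rightarrow> 'm \<Rightarrow> bool" where
  "monic C A B f \<longleftrightarrow> f \<in> mor C A B \<and>
     (\<forall>T \<in> Ob C. \<forall>g \<in> mor C T A. \<forall>h \<in> mor C T A. f \<bullet>\<^bsub>C\<^esub> g = f \<bullet>\<^bsub>C\<^esub> h \<longrightarrow> g = h)"

definition epic :: "('o, 'm, 'k) lcat \<Rightarrow> 'o \<Rightarrow> 'o \<Rightarrow> 'm \<Rightarrow> bool" where
  "epic C A B f \<longleftrightarrow> f \<in> mor C A B \<and>
     (\<forall>T \<in> Ob C. \<forall>g \<in> mor C B T. \<forall>h \<in> mor C B T. g \<bullet>\<^bsub>C\<^esub> f = h \<bullet>\<^bsub>C\<^esub> f \<longrightarrow> g = h)"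

definition zero_object :: "('o, 'm, 'k) lcat \<Rightarrow> 'o \<Rightarrow> bool" where
  "zero_object C Z \<longleftrightarrow> Z \<in> Ob C \<and>
     (\<forall>T \<in> Ob C. (\<exists>!f. f \<in> mor C Z T) \<and> (\<exists>!f. f \<in> mor C T Z))"

definition is_kernel :: "('o, 'm, 'k) lcat \<Rightarrow> 'o \<Rightarrow> 'o \<Rightarrow> 'm \<Rightarrow> 'o \<Rightarrow> 'm \<Rightarrow> bool" where
  "is_kernel C A B f K k \<longleftrightarrow> f \<in> mor C A B \<and> K \<in> Ob C \<and> k \<in> mor C K A \<and>
     f \<bullet>\<^bsub>C\<^esub> k = zero_mor C K B \<and>
     (\<forall>T \<in> Ob C. \<forall>h \<in> mor C T A. f \<bullet>\<^bsub>C\<^esub> h = zero_mor C T B \<longrightarrow>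
        (\<exists>!u. u \<in> mor C T K \<and> k \<bullet>\<^bsub>C\<^esub> u = h))"

definition is_cokernel :: "('o, 'm, 'k) lcat \<Rightarrow> 'o \<Rightarrow> 'o \<Rightarrow> 'm \<Rightarrow> 'o \<Rightarrow> 'm \<Rightarrow> bool" where
  "is_cokernel C A B f Q q \<longleftrightarrow> f \<in> mor C A B \<and> Q \<in> Ob C \<and> q \<in> mor C B Q \<and>
     q \<bullet>\<^bsub>C\<^esub> f = zero_mor C A Q \<and>
     (\<forall>T \<in> Ob C. \<forall>h \<in> mor C B T. h \<bullet>\<^bsub>C\<^esub> f = zero_mor C A T \<longrightarrow>
        (\<exists>!u. u \<in> mor C Q T \<and> u \<bullet>\<^bsub>C\<^esub> q = h))"

text \<open>\<open>S\<close> is the direct sum (biproduct) of \<open>T 0, \<dots>, T (m - 1)\<close>; for \<open>m = 0\<close> this means that \<open>S\<close> is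
  a zero object.\<close>

definition is_direct_sum ::
    "('o, 'm, 'k) lcat \<Rightarrow> nat \<Rightarrow> (nat \<Rightarrow> 'o) \<Rightarrow> 'o \<Rightarrow> (nat \<Rightarrow> 'm) \<Rightarrow> (nat \<Rightarrow> 'm) \<Rightarrow> bool" where
  "is_direct_sum C m T S \<iota> \<pi> \<longleftrightarrow> S \<in> Ob C \<and>
     (\<forall>j<m. T j \<in> Ob C \<and> \<iota> j \<in> mor C (T j) S \<and> \<pi> j \<in> mor C S (T j)) \<and>
     (\<forall>i<m. \<forall>j<m. \<pi> i \<bullet>\<^bsub>C\<^esub> \<iota> j = (if i = j then ident C (T i) else zero_mor C (T j) (T i))) \<and>
     (\<Oplus>\<^bsub>Hom C S S\<^esub>j\<in>{..<m}. \<iota> j \<bullet>\<^bsub>C\<^esub> \<pi> j) = ident C S"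

locale abelian_category = linear_category +
  assumes direct_sums:
      "(\<And>j. j < m \<Longrightarrow> T j \<in> Ob C) \<Longrightarrow> \<exists>S \<iota> \<pi>. is_direct_sum C m T S \<iota> \<pi>"
    and kernels: "\<lbrakk>A \<in> Ob C; B \<in> Ob C; f \<in> mor C A B\<rbrakk> \<Longrightarrow> \<exists>K k. is_kernel C A B f K k"
    and cokernels: "\<lbrakk>A \<in> Ob C; B \<in> Ob C; f \<in> mor C A B\<rbrakk> \<Longrightarrow> \<exists>Q q. is_cokernel C A B f Q q"
    and monic_normal:
      "\<lbrakk>A \<in> Ob C; B \<in> Ob C; monic C A B f\<rbrakk> \<Longrightarrow> \<exists>D \<in> Ob C. \<exists>g. is_kernel C B D g A f"
    and epic_normal:
      "\<lbrakk>A \<in> Ob C; B \<in> Ob C; epic C A B f\<rbrakk> \<Longrightarrow> \<exists>D \<in> Ob C. \<exists>g. is_cokernel C D A g B f"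


section \<open>Finite dimensionality and Ext\<close>

inductive_set lin_span :: "('k, 'v) module \<Rightarrow> 'v set \<Rightarrow> 'v set"
  for M :: "('k, 'v) module" and S :: "'v set" where
  base: "x \<in> S \<Longrightarrow> x \<in> lin_span M S"
| zero: "\<zero>\<^bsub>M\<^esub> \<in> lin_span M S"
| add: "\<lbrakk>x \<in> lin_span M S; y \<in> lin_span M S\<rbrakk> \<Longrightarrow> x \<oplus>\<^bsub>M\<^esub> y \<in> lin_span M S"
| smult: "x \<in> lin_span M S \<Longrightarrow> a \<odot>\<^bsub>M\<^esub> x \<in> lin_span M S"

definition finite_dimensional :: "('k, 'v) module \<Rightarrow> bool" where
  "finite_dimensional M \<longleftrightarrow> (\<exists>S. finite S \<and> S \<subseteq> carrier M \<and> carrier M \<subseteq> lin_span M S)"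

text \<open>\<open>0 \<rightarrow> B \<rightarrow> E \<rightarrow> A \<rightarrow> 0\<close> with maps \<open>i\<close> and \<open>p\<close>.\<close>

definition short_exact :: "('o, 'm, 'k) lcat \<Rightarrow> 'o \<Rightarrow> 'o \<Rightarrow> 'o \<Rightarrow> 'm \<Rightarrow> 'm \<Rightarrow> bool" where
  "short_exact C B E A i p \<longleftrightarrow> A \<in> Ob C \<and> B \<in> Ob C \<and> E \<in> Ob C \<and>
     is_kernel C E A p B i \<and> is_cokernel C B E i A p"

text \<open>
  \<open>Ext\<^sup>1(A, B)\<close> is the space of Yoneda extensions of \<open>A\<close> by \<open>B\<close>: equivalence classes of short
  exact sequences \<open>0 \<rightarrow> B \<rightarrow> E \<rightarrow> A \<rightarrow> 0\<close>, written as triples \<open>(E, i, p)\<close>.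
\<close>

definition extensions :: "('o, 'm, 'k) lcat \<Rightarrow> 'o \<Rightarrow> 'o \<Rightarrow> ('o \<times> 'm \<times> 'm) set" where
  "extensions C A B = {(E, i, p). short_exact C B E A i p}"

definition ext_equiv :: "('o, 'm, 'k) lcat \<Rightarrow> 'o \<Rightarrow> 'o \<Rightarrow> (('o \<times> 'm \<times> 'm) \<times> ('o \<times> 'm \<times> 'm)) set" where
  "ext_equiv C A B =
     {((E, i, p), (E', i', p')). (E, i, p) \<in> extensions C A B \<and> (E', i', p') \<in> extensions C A B \<and>
        (\<exists>h. isomorphism C E E' h \<and> h \<bullet>\<^bsub>C\<^esub> i = i' \<and> p' \<bullet>\<^bsub>C\<^esub> h = p)}"

definition is_pullback ::
    "('o, 'm, 'k) lcat \<Rightarrow> 'o \<Rightarrow> 'o \<Rightarrow> 'o \<Rightarrow> 'm \<Rightarrow> 'm \<Rightarrow> 'o \<Rightarrow> 'm \<Rightarrow> 'm \<Rightarrow> bool" where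
  "is_pullback C T Y Z f g P q r \<longleftrightarrow> f \<in> mor C T Z \<and> g \<in> mor C Y Z \<and>
     P \<in> Ob C \<and> q \<in> mor C P T \<and> r \<in> mor C P Y \<and> f \<bullet>\<^bsub>C\<^esub> q = g \<bullet>\<^bsub>C\<^esub> r \<and>
     (\<forall>W \<in> Ob C. \<forall>s \<in> mor C W T. \<forall>t \<in> mor C W Y. f \<bullet>\<^bsub>C\<^esub> s = g \<bullet>\<^bsub>C\<^esub> t \<longrightarrow>
        (\<exists>!u. u \<in> mor C W P \<and> q \<bullet>\<^bsub>C\<^esub> u = s \<and> r \<bullet>\<^bsub>C\<^esub> u = t))"

text \<open>
  The Baer sum of \<open>(E1, i1, p1)\<close> and \<open>(E2, i2, p2)\<close>: the quotient of the fibre product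
  \<open>P = E1 \<times>\<^sub>A E2\<close> by the skew diagonal copy \<open>{(b, - b)}\<close> of \<open>B\<close>. The maps \<open>j1\<close>, \<open>j2\<close> are
  \<open>b \<mapsto> (b, 0)\<close> and \<open>b \<mapsto> (0, b)\<close>, and \<open>e\<close> is the quotient map.
\<close>

definition is_Baer_sum ::
    "('o, 'm, 'k) lcat \<Rightarrow> 'o \<Rightarrow> 'o \<Rightarrow> 'o \<times> 'm \<times> 'm \<Rightarrow> 'o \<times> 'm \<times> 'm \<Rightarrow> 'o \<times> 'm \<times> 'm \<Rightarrow> bool" where
  "is_Baer_sum C A B = (\<lambda>(E1, i1, p1) (E2, i2, p2) (E, i, p).
     \<exists>P q1 q2 j1 j2 e.
       is_pullback C E1 E2 A p1 p2 P q1 q2 \<and>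
       j1 \<in> mor C B P \<and> q1 \<bullet>\<^bsub>C\<^esub> j1 = i1 \<and> q2 \<bullet>\<^bsub>C\<^esub> j1 = zero_mor C B E2 \<and>
       j2 \<in> mor C B P \<and> q1 \<bullet>\<^bsub>C\<^esub> j2 = zero_mor C B E1 \<and> q2 \<bullet>\<^bsub>C\<^esub> j2 = i2 \<and>
       is_cokernel C B P (j1 \<ominus>\<^bsub>Hom C B P\<^esub> j2) E e \<and>
       i = e \<bullet>\<^bsub>C\<^esub> j1 \<and> p \<bullet>\<^bsub>C\<^esub> e = p1 \<bullet>\<^bsub>C\<^esub> q1)"

text \<open>
  The scalar multiple of an extension by \<open>a\<close> is its pushout along \<open>a \<cdot> id\<close> on \<open>B\<close>, that is, the
  extension (unique up to equivalence) receiving a morphism of extensions that is \<open>a \<cdot> id\<close> on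
  \<open>B\<close> and the identity on \<open>A\<close>. The zero class consists of the split extensions. The operations are
  given directly on equivalence classes, as the set of all possible results.
\<close>

definition is_ext_smult ::
    "('o, 'm, 'k) lcat \<Rightarrow> 'o \<Rightarrow> 'o \<Rightarrow> 'k \<Rightarrow> 'o \<times> 'm \<times> 'm \<Rightarrow> 'o \<times> 'm \<times> 'm \<Rightarrow> bool" where
  "is_ext_smult C A B a = (\<lambda>(E, i, p) (E', i', p').
     \<exists>h \<in> mor C E E'. h \<bullet>\<^bsub>C\<^esub> i = i' \<bullet>\<^bsub>C\<^esub> (a \<odot>\<^bsub>Hom C B B\<^esub> ident C B) \<and> p' \<bullet>\<^bsub>C\<^esub> h = p)"

definition is_split :: "('o, 'm, 'k) lcat \<Rightarrow> 'o \<Rightarrow> 'o \<times> 'm \<times> 'm \<Rightarrow> bool" where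
  "is_split C A = (\<lambda>(E, i, p). \<exists>s \<in> mor C A E. p \<bullet>\<^bsub>C\<^esub> s = ident C A)"

definition Ext1 :: "('o, 'm, 'k) lcat \<Rightarrow> 'o \<Rightarrow> 'o \<Rightarrow> ('k, ('o \<times> 'm \<times> 'm) set) module" where
  "Ext1 C A B =
     \<lparr>carrier = extensions C A B // ext_equiv C A B,
      monoid.mult = undefined,
      one = undefined,
      ring.zero = {T \<in> extensions C A B. is_split C A T},
      add = (\<lambda>U V. {T \<in> extensions C A B. \<exists>Y \<in> U. \<exists>Z \<in> V. is_Baer_sum C A B Y Z T}),
      module.smult = (\<lambda>a U. {T \<in> extensions C A B. \<exists>Y \<in> U. is_ext_smult C A B a Y T})\<rparr>"


section \<open>Simple objects, finite length, projective generators\<close>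

definition simple_object :: "('o, 'm, 'k) lcat \<Rightarrow> 'o \<Rightarrow> bool" where
  "simple_object C T \<longleftrightarrow> T \<in> Ob C \<and> \<not> zero_object C T \<and>
     (\<forall>Y \<in> Ob C. \<forall>f. monic C Y T f \<longrightarrow> zero_object C Y \<or> isomorphism C Y T f)"

definition semisimple_object :: "('o, 'm, 'k) lcat \<Rightarrow> 'o \<Rightarrow> bool" where
  "semisimple_object C S \<longleftrightarrow>
     (\<exists>m T \<iota> \<pi>. (\<forall>j<m. simple_object C (T j)) \<and> is_direct_sum C m T S \<iota> \<pi>)"

definition simple_iso_rel :: "('o, 'm, 'k) lcat \<Rightarrow> ('o \<times> 'o) set" where
  "simple_iso_rel C = {(T, Y). simple_object C T \<and> simple_object C Y \<and> isomorphic C T Y}"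

text \<open>A filtration \<open>0 = F m \<subseteq> \<dots> \<subseteq> F 1 \<subseteq> F 0 = A\<close>, where \<open>G j\<close> is the quotient \<open>F j / F (j + 1)\<close>.\<close>

definition has_semisimple_filtration :: "('o, 'm, 'k) lcat \<Rightarrow> 'o \<Rightarrow> bool" where
  "has_semisimple_filtration C A \<longleftrightarrow>
     (\<exists>m F G inc quo. F 0 = A \<and> zero_object C (F m) \<and>
        (\<forall>j<m. short_exact C (F (Suc j)) (F j) (G j) (inc j) (quo j) \<and> semisimple_object C (G j)))"

locale finite_length_category = abelian_category +
  assumes Hom_finite: "\<lbrakk>A \<in> Ob C; B \<in> Ob C\<rbrakk> \<Longrightarrow> finite_dimensional (Hom C A B)"
    and Ext1_finite: "\<lbrakk>A \<in> Ob C; B \<in> Ob C\<rbrakk> \<Longrightarrow> finite_dimensional (Ext1 C A B)"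
    and finite_simples: "finite ({T. simple_object C T} // simple_iso_rel C)"
    and semisimple_filtrations: "A \<in> Ob C \<Longrightarrow> has_semisimple_filtration C A"

definition projective_object :: "('o, 'm, 'k) lcat \<Rightarrow> 'o \<Rightarrow> bool" where
  "projective_object C P \<longleftrightarrow> P \<in> Ob C \<and>
     (\<forall>T \<in> Ob C. \<forall>Y \<in> Ob C. \<forall>e f. epic C T Y e \<and> f \<in> mor C P Y \<longrightarrow>
        (\<exists>g \<in> mor C P T. e \<bullet>\<^bsub>C\<^esub> g = f))"

definition generator :: "('o, 'm, 'k) lcat \<Rightarrow> 'o \<Rightarrow> bool" where
  "generator C P \<longleftrightarrow> P \<in> Ob C \<and>
     (\<forall>T \<in> Ob C. \<forall>Y \<in> Ob C. \<forall>f \<in> mor C T Y. \<forall>g \<in> mor C T Y.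
        (\<forall>h \<in> mor C P T. f \<bullet>\<^bsub>C\<^esub> h = g \<bullet>\<^bsub>C\<^esub> h) \<longrightarrow> f = g)"

definition projective_generator :: "('o, 'm, 'k) lcat \<Rightarrow> 'o \<Rightarrow> bool" where
  "projective_generator C P \<longleftrightarrow> projective_object C P \<and> generator C P"


section \<open>Functors\<close>

record ('o, 'm, 'p, 'q) cfunctor =
  fob :: "'o \<Rightarrow> 'p"
  fmor :: "'m \<Rightarrow> 'q"

definition is_functor ::
    "('o, 'm, 'k) lcat \<Rightarrow> ('p, 'q, 'k) lcat \<Rightarrow> ('o, 'm, 'p, 'q) cfunctor \<Rightarrow> bool" where
  "is_functor C D F \<longleftrightarrow>
     (\<forall>A \<in> Ob C. fob F A \<in> Ob D \<and> fmor F (ident C A) = ident D (fob F A)) \<and>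
     (\<forall>A \<in> Ob C. \<forall>B \<in> Ob C. \<forall>f \<in> mor C A B. fmor F f \<in> mor D (fob F A) (fob F B)) \<and>
     (\<forall>A \<in> Ob C. \<forall>B \<in> Ob C. \<forall>E \<in> Ob C. \<forall>f \<in> mor C A B. \<forall>g \<in> mor C B E.
        fmor F (g \<bullet>\<^bsub>C\<^esub> f) = fmor F g \<bullet>\<^bsub>D\<^esub> fmor F f)"

definition is_linear_functor ::
    "('o, 'm, 'k) lcat \<Rightarrow> ('p, 'q, 'k) lcat \<Rightarrow> ('o, 'm, 'p, 'q) cfunctor \<Rightarrow> bool" where
  "is_linear_functor C D F \<longleftrightarrow> is_functor C D F \<and>
     (\<forall>A \<in> Ob C. \<forall>B \<in> Ob C.
        (\<forall>f \<in> mor C A B. \<forall>g \<in> mor C A B.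
           fmor F (f \<oplus>\<^bsub>Hom C A B\<^esub> g) = fmor F f \<oplus>\<^bsub>Hom D (fob F A) (fob F B)\<^esub> fmor F g) \<and>
        (\<forall>a. \<forall>f \<in> mor C A B.
           fmor F (a \<odot>\<^bsub>Hom C A B\<^esub> f) = a \<odot>\<^bsub>Hom D (fob F A) (fob F B)\<^esub> fmor F f))"

definition fully_faithful ::
    "('o, 'm, 'k) lcat \<Rightarrow> ('p, 'q, 'k) lcat \<Rightarrow> ('o, 'm, 'p, 'q) cfunctor \<Rightarrow> bool" where
  "fully_faithful C D F \<longleftrightarrow>
     (\<forall>A \<in> Ob C. \<forall>B \<in> Ob C. bij_betw (fmor F) (mor C A B) (mor D (fob F A) (fob F B)))"

definition essential_image ::
    "('o, 'm, 'k) lcat \<Rightarrow> ('p, 'q, 'k) lcat \<Rightarrow> ('o, 'm, 'p, 'q) cfunctor \<Rightarrow> 'p set" where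
  "essential_image C D F = {Y. \<exists>A \<in> Ob C. isomorphic D (fob F A) Y}"

definition functor_id :: "('o, 'm, 'o, 'm) cfunctor" where
  "functor_id = \<lparr>fob = (\<lambda>A. A), fmor = (\<lambda>f. f)\<rparr>"

definition functor_comp ::
    "('p, 'q, 'r, 's) cfunctor \<Rightarrow> ('o, 'm, 'p, 'q) cfunctor \<Rightarrow> ('o, 'm, 'r, 's) cfunctor" where
  "functor_comp G F = \<lparr>fob = fob G \<circ> fob F, fmor = fmor G \<circ> fmor F\<rparr>"

definition natural_transformation ::
    "('o, 'm, 'k) lcat \<Rightarrow> ('p, 'q, 'k) lcat \<Rightarrow> ('o, 'm, 'p, 'q) cfunctor \<Rightarrow>
     ('o, 'm, 'p, 'q) cfunctor \<Rightarrow> ('o \<Rightarrow> 'q) \<Rightarrow> bool" where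
  "natural_transformation C D F G \<eta> \<longleftrightarrow>
     (\<forall>A \<in> Ob C. \<eta> A \<in> mor D (fob F A) (fob G A)) \<and>
     (\<forall>A \<in> Ob C. \<forall>B \<in> Ob C. \<forall>f \<in> mor C A B. \<eta> B \<bullet>\<^bsub>D\<^esub> fmor F f = fmor G f \<bullet>\<^bsub>D\<^esub> \<eta> A)"

definition natural_isomorphism ::
    "('o, 'm, 'k) lcat \<Rightarrow> ('p, 'q, 'k) lcat \<Rightarrow> ('o, 'm, 'p, 'q) cfunctor \<Rightarrow>
     ('o, 'm, 'p, 'q) cfunctor \<Rightarrow> ('o \<Rightarrow> 'q) \<Rightarrow> bool" where
  "natural_isomorphism C D F G \<eta> \<longleftrightarrow> natural_transformation C D F G \<eta> \<and>
     (\<forall>A \<in> Ob C. isomorphism D (fob F A) (fob G A) (\<eta> A))"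

definition is_equivalence ::
    "('o, 'm, 'k) lcat \<Rightarrow> ('p, 'q, 'k) lcat \<Rightarrow> ('o, 'm, 'p, 'q) cfunctor \<Rightarrow> bool" where
  "is_equivalence C D F \<longleftrightarrow> is_functor C D F \<and>
     (\<exists>G \<eta> \<epsilon>. is_functor D C G \<and>
        natural_isomorphism C C functor_id (functor_comp G F) \<eta> \<and>
        natural_isomorphism D D (functor_comp F G) functor_id \<epsilon>)"

text \<open>\<open>L : D \<rightarrow> C\<close> is left adjoint to \<open>F : C \<rightarrow> D\<close> with unit \<open>\<eta> : id \<rightarrow> F L\<close>.\<close>

definition left_adjoint_with_unit ::
    "('o, 'm, 'k) lcat \<Rightarrow> ('p, 'q, 'k) lcat \<Rightarrow> ('o, 'm, 'p, 'q) cfunctor \<Rightarrow>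
     ('p, 'q, 'o, 'm) cfunctor \<Rightarrow> ('p \<Rightarrow> 'q) \<Rightarrow> bool" where
  "left_adjoint_with_unit C D F L \<eta> \<longleftrightarrow> is_functor D C L \<and>
     natural_transformation D D functor_id (functor_comp F L) \<eta> \<and>
     (\<forall>Y \<in> Ob D. \<forall>T \<in> Ob C. \<forall>f \<in> mor D Y (fob F T).
        \<exists>!g. g \<in> mor C (fob L Y) T \<and> fmor F g \<bullet>\<^bsub>D\<^esub> \<eta> Y = f)"


section \<open>Finite dimensional modules over \<open>k\<^sup>n\<close>\<close>

definition kn_ring :: "nat \<Rightarrow> 'k::field list ring" where
  "kn_ring n = RDirProd_list (replicate n ring_of_type_algebra)"

text \<open>
  The ring is commutative, so right modules are modules in the sense of HOL-Algebra. The underlying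
  sets are taken inside \<open>nat \<Rightarrow> 'k\<close>, which contains a copy of every finite dimensional vector space;
  so every finite dimensional module is isomorphic to an object of the category below.
\<close>

type_synonym 'k kn_module = "('k list, nat \<Rightarrow> 'k) module"

text \<open>The underlying \<open>k\<close>-vector space: restriction of scalars along the diagonal \<open>k \<rightarrow> k\<^sup>n\<close>.\<close>

definition restrict_scalars :: "nat \<Rightarrow> 'k kn_module \<Rightarrow> ('k, nat \<Rightarrow> 'k) module" where
  "restrict_scalars n M =
     \<lparr>carrier = carrier M, monoid.mult = monoid.mult M, one = one M,
      ring.zero = ring.zero M, add = add M,
      module.smult = (\<lambda>a x. replicate n a \<odot>\<^bsub>M\<^esub> x)\<rparr>"

definition kn_linear_maps ::
    "nat \<Rightarrow> 'k::field kn_module \<Rightarrow> 'k kn_module \<Rightarrow> ((nat \<Rightarrow> 'k) \<Rightarrow> (nat \<Rightarrow> 'k)) set" where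
  "kn_linear_maps n M N = {f \<in> carrier M \<rightarrow>\<^sub>E carrier N.
     (\<forall>x \<in> carrier M. \<forall>y \<in> carrier M. f (x \<oplus>\<^bsub>M\<^esub> y) = f x \<oplus>\<^bsub>N\<^esub> f y) \<and>
     (\<forall>r \<in> carrier (kn_ring n). \<forall>x \<in> carrier M. f (r \<odot>\<^bsub>M\<^esub> x) = r \<odot>\<^bsub>N\<^esub> f x)}"

type_synonym 'k kn_mor = "'k kn_module \<times> 'k kn_module \<times> ((nat \<Rightarrow> 'k) \<Rightarrow> (nat \<Rightarrow> 'k))"

definition mod_kn :: "nat \<Rightarrow> ('k::field kn_module, 'k kn_mor, 'k) lcat" where
  "mod_kn n =
     \<lparr>Ob = {M. module (kn_ring n) M \<and> finite_dimensional (restrict_scalars n M)},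
      Hom = (\<lambda>M N.
        \<lparr>carrier = (\<lambda>f. (M, N, f)) ` kn_linear_maps n M N,
         monoid.mult = undefined,
         one = undefined,
         ring.zero = (M, N, \<lambda>x\<in>carrier M. \<zero>\<^bsub>N\<^esub>),
         add = (\<lambda>(_, _, f) (_, _, g). (M, N, \<lambda>x\<in>carrier M. f x \<oplus>\<^bsub>N\<^esub> g x)),
         module.smult = (\<lambda>a (_, _, f). (M, N, \<lambda>x\<in>carrier M. replicate n a \<odot>\<^bsub>N\<^esub> f x))\<rparr>),
      ident = (\<lambda>M. (M, M, \<lambda>x\<in>carrier M. x)),
      comp = (\<lambda>(_, L, g) (M, _, f). (M, L, compose (carrier M) g f))\<rparr>"

section \<open>The classes \<open>Df\<close> and the subcategories of bounded Loewy length\<close>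

type_synonym ('o, 'm, 'k) kn_functor = "('k kn_module, 'k kn_mor, 'o, 'm) cfunctor"

definition Df_tilde :: "nat \<Rightarrow> (('o, 'm, 'k::field) lcat \<times> ('o, 'm, 'k) kn_functor) set" where
  "Df_tilde n = {(\<A>, Q). finite_length_category \<A> \<and> is_linear_functor (mod_kn n) \<A> Q \<and>
     fully_faithful (mod_kn n) \<A> Q \<and>
     essential_image (mod_kn n) \<A> Q = {S. semisimple_object \<A> S}}"

definition Df :: "nat \<Rightarrow> (('o, 'm, 'k::field) lcat \<times> ('o, 'm, 'k) kn_functor) set" where
  "Df n = {(\<A>, Q) \<in> Df_tilde n. \<exists>P. projective_generator \<A> P}"

text \<open>
  \<open>R\<close> is a radical of \<open>A\<close>, that is, (the object of) a kernel of the unit \<open>A \<rightarrow> Q Q\<^sup>* A\<close>. The left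
  adjoint, its unit and the kernel are unique up to isomorphism, hence so is \<open>R\<close>, and
  \<open>is_radical_power \<dots> l A R\<close> determines the \<open>l\<close>-th iterated radical up to isomorphism.
\<close>

definition is_radical ::
    "nat \<Rightarrow> ('o, 'm, 'k::field) lcat \<Rightarrow> ('o, 'm, 'k) kn_functor \<Rightarrow> 'o \<Rightarrow> 'o \<Rightarrow> bool" where
  "is_radical n \<A> Q A R \<longleftrightarrow>
     (\<exists>L \<eta> i. left_adjoint_with_unit (mod_kn n) \<A> Q L \<eta> \<and>
        is_kernel \<A> A (fob Q (fob L A)) (\<eta> A) R i)"

primrec is_radical_power ::
    "nat \<Rightarrow> ('o, 'm, 'k::field) lcat \<Rightarrow> ('o, 'm, 'k) kn_functor \<Rightarrow> nat \<Rightarrow> 'o \<Rightarrow> 'o \<Rightarrow> bool" where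
  "is_radical_power n \<A> Q 0 A R \<longleftrightarrow> R = A"
| "is_radical_power n \<A> Q (Suc l) A R \<longleftrightarrow>
     (\<exists>B. is_radical_power n \<A> Q l A B \<and> is_radical n \<A> Q B R)"

definition Loewy_subcategory ::
    "nat \<Rightarrow> ('o, 'm, 'k::field) lcat \<Rightarrow> ('o, 'm, 'k) kn_functor \<Rightarrow> nat \<Rightarrow> ('o, 'm, 'k) lcat" where
  "Loewy_subcategory n \<A> Q l =
     full_subcategory \<A> {A. \<exists>R. is_radical_power n \<A> Q (l + 1) A R \<and> zero_object \<A> R}"

end

theory Submission
  imports Defs
begin

text \<open>Both directions go through the Loewy length of objects, described by filtrations whose steps are
  common kernels of finitely many morphisms to simple objects.

  Let \<open>P\<close> be a generator. A spanning family of the finite dimensional space \<open>Hom(P, A)\<close> is an epimorphism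
  from a power of \<open>P\<close> onto \<open>A\<close>. Loewy length does not increase under direct sums
  (\<open>loewy_le_jointly_monic\<close>) and quotients (\<open>loewy_le_quotient\<close>), so the Loewy length of \<open>P\<close>, which is
  finite, bounds that of every \<open>A\<close> (\<open>loewy_bounded_if_generator\<close>).

  Suppose now that Loewy lengths are at most \<open>l\<close>. Finiteness of \<open>Ext\<^sup>1\<close> is used only in the following
  form: for every \<open>P\<close> and \<open>T\<close> there is an epimorphism \<open>E \<rightarrow> P\<close> that factors through every extension of
  \<open>P\<close> by \<open>T\<close>, namely the fibre product of finitely many extensions that span \<open>Ext\<^sup>1(P, T)\<close>
  (\<open>ext_cover\<close>). No linear algebra in \<open>Ext\<^sup>1\<close> is involved: the extensions through which \<open>E \<rightarrow> P\<close> factors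
  are visibly closed under Baer sums and scalar multiples. As there are finitely many simple objects,
  one \<open>E\<close> serves all simple \<open>T\<close>, then all semi-simple kernels (\<open>semisimple_cover\<close>), and \<open>l\<close> iterations
  serve all kernels of Loewy length at most \<open>l\<close> (\<open>loewy_cover\<close>), that is, all kernels. So for every
  object \<open>S\<close> there is an epimorphism \<open>U \<rightarrow> S\<close> factoring through every epimorphism onto \<open>S\<close>. If \<open>U\<close> is
  taken of minimal length, then every endomorphism of \<open>U\<close> over \<open>S\<close> is an isomorphism, which forces every
  epimorphism onto \<open>U\<close> to split: \<open>U\<close> is projective (\<open>projective_cover_exists\<close>). For \<open>S\<close> the direct sum
  of the simple objects, one from each isomorphism class, \<open>U\<close> is a generator.

  It remains to compare Loewy filtrations with iterated radicals. Finite dimensionality of the spaces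
  \<open>Hom(A, T)\<close> yields a maximal semi-simple quotient of \<open>A\<close> and thus a left adjoint of \<open>Q\<close>
  (\<open>left_adjoint_exists\<close>); the radical is contained in the first step of every Loewy filtration
  (\<open>is_radical_power_if_loewy_le\<close>), and the iterated radicals themselves are such a filtration
  (\<open>loewy_le_if_is_radical_power\<close>).\<close>

section \<open>Morphisms of a linear category\<close>

context linear_category
begin

text \<open>Since a morphism lies in at most one Hom-space, source and target are functions of the morphism.
  Membership in a Hom-space thus becomes a pair of equations, which makes the typing conditions of
  composites a matter of rewriting.\<close>

definition arrow :: "'m \<Rightarrow> bool" where
  "arrow f \<longleftrightarrow> (\<exists>A \<in> Ob C. \<exists>B \<in> Ob C. f \<in> mor C A B)"

definition src :: "'m \<Rightarrow> 'o" where
  "src f = (THE A. A \<in> Ob C \<and> (\<exists>B \<in> Ob C. f \<in> mor C A B))"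

definition tgt :: "'m \<Rightarrow> 'o" where
  "tgt f = (THE B. B \<in> Ob C \<and> (\<exists>A \<in> Ob C. f \<in> mor C A B))"

definition arr :: "'m \<Rightarrow> 'o \<Rightarrow> 'o \<Rightarrow> bool" where
  "arr f A B \<longleftrightarrow> A \<in> Ob C \<and> B \<in> Ob C \<and> f \<in> mor C A B"

lemma arr_src_tgt:
  assumes "A \<in> Ob C" "B \<in> Ob C" "f \<in> mor C A B"
  shows "arrow f" "src f = A" "tgt f = B"
proof -
  show "arrow f" using assms by (auto simp: arrow_def)
  show "src f = A"
    unfolding src_def using assms Hom_disjoint by (intro the_equality) blast+
  show "tgt f = B"
    unfolding tgt_def using assms Hom_disjoint by (intro the_equality) blast+
qed

lemma arr_iff: "arr f A B \<longleftrightarrow> A \<in> Ob C \<and> B \<in> Ob C \<and> arrow f \<and> src f = A \<and> tgt f = B"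
  using arr_src_tgt unfolding arr_def arrow_def by blast

declare arr_iff [simp]

lemma arr_mor: "arr f A B \<Longrightarrow> f \<in> mor C A B"
  unfolding arr_def by blast

lemma arrI: "A \<in> Ob C \<Longrightarrow> B \<in> Ob C \<Longrightarrow> f \<in> mor C A B \<Longrightarrow> arr f A B"
  unfolding arr_def by blast

lemma mor_iff: "A \<in> Ob C \<Longrightarrow> B \<in> Ob C \<Longrightarrow> f \<in> mor C A B \<longleftrightarrow> arrow f \<and> src f = A \<and> tgt f = B"
  using arr_iff arr_def by blast

lemma arrow_src_tgt [simp]:
  assumes "arrow f"
  shows "src f \<in> Ob C" "tgt f \<in> Ob C" "f \<in> mor C (src f) (tgt f)"
  using assms arr_src_tgt unfolding arrow_def by blast+

lemma arrow_ident [simp]: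
  assumes "A \<in> Ob C"
  shows "arrow (ident C A)" "src (ident C A) = A" "tgt (ident C A) = A"
  using arr_src_tgt ident_closed assms by blast+

lemma arrow_comp [simp]:
  assumes "arrow f" "arrow g" "src g = tgt f"
  shows "arrow (g \<bullet> f)" "src (g \<bullet> f) = src f" "tgt (g \<bullet> f) = tgt g"
proof -
  have "g \<bullet> f \<in> mor C (src f) (tgt g)"
    using assms comp_closed[of "src f" "tgt f" "tgt g" f g] by (metis arrow_src_tgt)
  from arr_src_tgt[OF _ _ this] show "arrow (g \<bullet> f)" "src (g \<bullet> f) = src f" "tgt (g \<bullet> f) = tgt g"
    using assms by simp_all
qed

lemma assoc [simp]:
  assumes "arrow f" "arrow g" "arrow h" "src g = tgt f" "src h = tgt g"
  shows "(h \<bullet> g) \<bullet> f = h \<bullet> (g \<bullet> f)"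
  using assms comp_assoc[of "src f" "tgt f" "tgt g" "tgt h" f g h] arrow_src_tgt[of f]
    arrow_src_tgt[of g] arrow_src_tgt[of h] by simp

lemma comp_ident [simp]:
  assumes "arrow f"
  shows "A = src f \<Longrightarrow> f \<bullet> ident C A = f" "A = tgt f \<Longrightarrow> ident C A \<bullet> f = f"
  using assms comp_ident_left[of "src f" "tgt f" f] comp_ident_right[of "src f" "tgt f" f] by simp_all

text \<open>The simplifier brackets composites to the right; these two rules apply an equation between
  composites at the front of such a composite, where its left-hand side is not a subterm.\<close>

lemma comp_reduce:
  assumes "g \<bullet> f = r" "arrow f" "arrow g" "arrow x" "src g = tgt f" "src f = tgt x"
  shows "g \<bullet> (f \<bullet> x) = r \<bullet> x"
  using assms assoc by metis

lemma comp_reduce2: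
  assumes "g \<bullet> f = g' \<bullet> f'" "arrow f" "arrow g" "arrow f'" "arrow g'" "arrow x"
    "src g = tgt f" "src f = tgt x" "src g' = tgt f'" "src f' = tgt x"
  shows "g \<bullet> (f \<bullet> x) = g' \<bullet> (f' \<bullet> x)"
  using assms assoc by metis

lemma Hom_abelian_group: "A \<in> Ob C \<Longrightarrow> B \<in> Ob C \<Longrightarrow> abelian_group (Hom C A B)"
  using Hom_module module.axioms(2) by blast

lemma arrow_zero [simp]:
  assumes "A \<in> Ob C" "B \<in> Ob C"
  shows "arrow (zero_mor C A B)" "src (zero_mor C A B) = A" "tgt (zero_mor C A B) = B"
proof -
  interpret abelian_group "Hom C A B" using assms Hom_abelian_group by blast
  show "arrow (zero_mor C A B)" "src (zero_mor C A B) = A" "tgt (zero_mor C A B) = B"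
    using arr_src_tgt[OF assms zero_closed] by auto
qed

lemma comp_zero [simp]:
  assumes "arrow f" "Z \<in> Ob C"
  shows "A = tgt f \<Longrightarrow> zero_mor C A Z \<bullet> f = zero_mor C (src f) Z"
    and "B = src f \<Longrightarrow> f \<bullet> zero_mor C Z B = zero_mor C Z (tgt f)"
proof -
  let ?A = "src f" and ?B = "tgt f"
  have f: "?A \<in> Ob C" "?B \<in> Ob C" "f \<in> mor C ?A ?B" using assms by auto
  interpret AZ: abelian_group "Hom C ?A Z" using assms f Hom_abelian_group by blast
  interpret BZ: abelian_group "Hom C ?B Z" using assms f Hom_abelian_group by blast
  interpret ZA: abelian_group "Hom C Z ?A" using assms f Hom_abelian_group by blast
  interpret ZB: abelian_group "Hom C Z ?B" using assms f Hom_abelian_group by blast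
  have "zero_mor C ?B Z \<bullet> f = zero_mor C ?B Z \<bullet> f \<oplus>\<^bsub>Hom C ?A Z\<^esub> zero_mor C ?B Z \<bullet> f"
    using comp_add_left[of ?A ?B Z f "zero_mor C ?B Z" "zero_mor C ?B Z"] f assms by simp
  moreover have "zero_mor C ?B Z \<bullet> f \<in> mor C ?A Z"
    using comp_closed[of ?A ?B Z] f assms by simp
  ultimately have "zero_mor C ?B Z \<bullet> f = zero_mor C ?A Z"
    using AZ.add.r_cancel_one' by blast
  then show "A = tgt f \<Longrightarrow> zero_mor C A Z \<bullet> f = zero_mor C (src f) Z" for A by simp
  have "f \<bullet> zero_mor C Z ?A = f \<bullet> zero_mor C Z ?A \<oplus>\<^bsub>Hom C Z ?B\<^esub> f \<bullet> zero_mor C Z ?A"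
    using comp_add_right[of Z ?A ?B "zero_mor C Z ?A" "zero_mor C Z ?A" f] f assms by simp
  moreover have "f \<bullet> zero_mor C Z ?A \<in> mor C Z ?B"
    using comp_closed[of Z ?A ?B] f assms by simp
  ultimately have "f \<bullet> zero_mor C Z ?A = zero_mor C Z ?B"
    using ZB.add.r_cancel_one' by blast
  then show "B = src f \<Longrightarrow> f \<bullet> zero_mor C Z B = zero_mor C Z (tgt f)" for B by simp
qed

definition minus_mor :: "'m \<Rightarrow> 'm \<Rightarrow> 'm"  (infixl \<open>\<^bold>-\<close> 65) where
  "f \<^bold>- g = f \<ominus>\<^bsub>Hom C (src f) (tgt f)\<^esub> g"

lemma arrow_minus [simp]:
  assumes "arrow f" "arrow g" "src f = src g" "tgt f = tgt g"
  shows "arrow (f \<^bold>- g)" "src (f \<^bold>- g) = src g" "tgt (f \<^bold>- g) = tgt g"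
proof -
  interpret abelian_group "Hom C (src f) (tgt f)" using assms Hom_abelian_group by auto
  have "f \<^bold>- g \<in> mor C (src f) (tgt f)"
    unfolding minus_mor_def using assms arrow_src_tgt(3)[of f] arrow_src_tgt(3)[of g]
    by (intro minus_closed) auto
  then show "arrow (f \<^bold>- g)" "src (f \<^bold>- g) = src g" "tgt (f \<^bold>- g) = tgt g"
    using arr_src_tgt assms by (metis arrow_src_tgt(1,2))+
qed

lemma minus_eq_zero_iff:
  assumes "arrow f" "arrow g" "src f = src g" "tgt f = tgt g"
  shows "f \<^bold>- g = zero_mor C (src g) (tgt g) \<longleftrightarrow> f = g"
proof -
  let ?H = "Hom C (src g) (tgt g)"
  interpret abelian_group ?H using assms Hom_abelian_group by auto
  have m: "f \<in> carrier ?H" "g \<in> carrier ?H" using assms arrow_src_tgt(3) by metis+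
  have "(f \<ominus>\<^bsub>?H\<^esub> g) \<oplus>\<^bsub>?H\<^esub> g = f" using m by (simp add: minus_eq a_assoc l_neg)
  moreover have "g \<ominus>\<^bsub>?H\<^esub> g = \<zero>\<^bsub>?H\<^esub>" using m by (simp add: minus_eq r_neg)
  ultimately have "f \<ominus>\<^bsub>?H\<^esub> g = \<zero>\<^bsub>?H\<^esub> \<longleftrightarrow> f = g" using m by (metis l_zero)
  then show ?thesis unfolding minus_mor_def using assms by simp
qed

lemma minus_zero [simp]:
  assumes "arrow f" "A = src f" "B = tgt f"
  shows "f \<^bold>- zero_mor C A B = f"
proof -
  interpret abelian_group "Hom C (src f) (tgt f)" using assms Hom_abelian_group by auto
  show ?thesis unfolding minus_mor_def using assms by (simp add: minus_eq)
qed

lemma comp_minus_left: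
  assumes "arrow f" "arrow g" "arrow h" "src f = src g" "tgt f = tgt g" "src h = tgt g"
  shows "h \<bullet> (f \<^bold>- g) = h \<bullet> f \<^bold>- h \<bullet> g"
proof -
  let ?A = "src g" and ?B = "tgt g" and ?D = "tgt h"
  have m: "f \<in> mor C ?A ?B" "g \<in> mor C ?A ?B" "h \<in> mor C ?B ?D"
    and o: "?A \<in> Ob C" "?B \<in> Ob C" "?D \<in> Ob C"
    using assms arrow_src_tgt by metis+
  interpret AB: abelian_group "Hom C ?A ?B" using o Hom_abelian_group by auto
  interpret AD: abelian_group "Hom C ?A ?D" using o Hom_abelian_group by auto
  let ?d = "f \<ominus>\<^bsub>Hom C ?A ?B\<^esub> g"
  have d: "?d \<in> mor C ?A ?B" using m by simp
  have "?d \<oplus>\<^bsub>Hom C ?A ?B\<^esub> g = f"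
    using m by (simp add: AB.minus_eq AB.a_assoc AB.l_neg)
  then have "h \<bullet> f = h \<bullet> ?d \<oplus>\<^bsub>Hom C ?A ?D\<^esub> h \<bullet> g"
    using comp_add_right[OF o d m(2,3)] by simp
  moreover have "h \<bullet> f \<in> mor C ?A ?D" "h \<bullet> g \<in> mor C ?A ?D" "h \<bullet> ?d \<in> mor C ?A ?D"
    using comp_closed o m d by blast+
  ultimately have "h \<bullet> ?d = h \<bullet> f \<ominus>\<^bsub>Hom C ?A ?D\<^esub> h \<bullet> g"
    by (simp add: AD.minus_eq AD.a_assoc AD.r_neg)
  then show ?thesis unfolding minus_mor_def using assms by simp
qed

lemma comp_minus_right:
  assumes "arrow f" "arrow g" "arrow h" "src f = src g" "tgt f = tgt g" "src g = tgt h"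
  shows "(f \<^bold>- g) \<bullet> h = f \<bullet> h \<^bold>- g \<bullet> h"
proof -
  let ?A = "src h" and ?B = "src g" and ?D = "tgt g"
  have m: "f \<in> mor C ?B ?D" "g \<in> mor C ?B ?D" "h \<in> mor C ?A ?B"
    and o: "?A \<in> Ob C" "?B \<in> Ob C" "?D \<in> Ob C"
    using assms arrow_src_tgt by metis+
  interpret BD: abelian_group "Hom C ?B ?D" using o Hom_abelian_group by auto
  interpret AD: abelian_group "Hom C ?A ?D" using o Hom_abelian_group by auto
  let ?d = "f \<ominus>\<^bsub>Hom C ?B ?D\<^esub> g"
  have d: "?d \<in> mor C ?B ?D" using m by simp
  have "?d \<oplus>\<^bsub>Hom C ?B ?D\<^esub> g = f"
    using m by (simp add: BD.minus_eq BD.a_assoc BD.l_neg)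
  then have "f \<bullet> h = ?d \<bullet> h \<oplus>\<^bsub>Hom C ?A ?D\<^esub> g \<bullet> h"
    using comp_add_left[OF o m(3) d m(2)] by simp
  moreover have "f \<bullet> h \<in> mor C ?A ?D" "g \<bullet> h \<in> mor C ?A ?D" "?d \<bullet> h \<in> mor C ?A ?D"
    using comp_closed o m d by blast+
  ultimately have "?d \<bullet> h = f \<bullet> h \<ominus>\<^bsub>Hom C ?A ?D\<^esub> g \<bullet> h"
    by (simp add: AD.minus_eq AD.a_assoc AD.r_neg)
  then show ?thesis unfolding minus_mor_def using assms by simp
qed

lemma arr_finsum:
  assumes "A \<in> Ob C" "B \<in> Ob C" "\<And>i. i \<in> I \<Longrightarrow> arr (f i) A B"
  shows "arr (\<Oplus>\<^bsub>Hom C A B\<^esub>i\<in>I. f i) A B"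
proof -
  interpret abelian_group "Hom C A B" using assms Hom_abelian_group by auto
  have "f \<in> I \<rightarrow> mor C A B" using assms(3) arr_mor by blast
  then show ?thesis using assms(1,2) by (intro arrI finsum_closed)
qed

lemma comp_finsum_left:
  assumes "finite I" "arrow h" "src h = B" "A \<in> Ob C" "B \<in> Ob C"
    and "\<And>i. i \<in> I \<Longrightarrow> arr (f i) A B"
  shows "h \<bullet> (\<Oplus>\<^bsub>Hom C A B\<^esub>i\<in>I. f i) = (\<Oplus>\<^bsub>Hom C A (tgt h)\<^esub>i\<in>I. h \<bullet> f i)"
proof -
  let ?D = "tgt h"
  have o: "?D \<in> Ob C" using assms by simp
  interpret AB: abelian_group "Hom C A B" using assms Hom_abelian_group by auto
  interpret AD: abelian_group "Hom C A ?D" using assms o Hom_abelian_group by auto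
  have hm: "h \<in> mor C B ?D" using assms(2,3) arrow_src_tgt(3) by blast
  have "h \<bullet> (\<Oplus>\<^bsub>Hom C A B\<^esub>i\<in>I. f i) = (\<Oplus>\<^bsub>Hom C A (tgt h)\<^esub>i\<in>I. h \<bullet> f i)
      \<and> (\<Oplus>\<^bsub>Hom C A B\<^esub>i\<in>I. f i) \<in> mor C A B"
    using assms(1,6)
  proof (induction I)
    case empty
    then show ?case using assms(2-5) by simp
  next
    case (insert i I)
    have fI: "f \<in> I \<rightarrow> mor C A B" "f i \<in> mor C A B" using insert.prems arr_mor by blast+
    then have "(\<lambda>i. h \<bullet> f i) \<in> I \<rightarrow> mor C A ?D" "h \<bullet> f i \<in> mor C A ?D"
      using comp_closed[OF assms(4,5) o _ hm] by auto
    moreover have IH: "h \<bullet> (\<Oplus>\<^bsub>Hom C A B\<^esub>i\<in>I. f i) = (\<Oplus>\<^bsub>Hom C A (tgt h)\<^esub>i\<in>I. h \<bullet> f i)"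
      "(\<Oplus>\<^bsub>Hom C A B\<^esub>i\<in>I. f i) \<in> mor C A B" using insert by auto
    ultimately show ?case
      using insert.hyps fI comp_add_right[OF assms(4,5) o fI(2) IH(2) hm] by simp
  qed
  then show ?thesis by blast
qed

lemma comp_finsum_right:
  assumes "finite I" "arrow h" "tgt h = A" "A \<in> Ob C" "B \<in> Ob C"
    and "\<And>i. i \<in> I \<Longrightarrow> arr (f i) A B"
  shows "(\<Oplus>\<^bsub>Hom C A B\<^esub>i\<in>I. f i) \<bullet> h = (\<Oplus>\<^bsub>Hom C (src h) B\<^esub>i\<in>I. f i \<bullet> h)"
proof -
  let ?D = "src h"
  have o: "?D \<in> Ob C" using assms by simp
  interpret AB: abelian_group "Hom C A B" using assms Hom_abelian_group by auto
  interpret DB: abelian_group "Hom C ?D B" using assms o Hom_abelian_group by auto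
  have hm: "h \<in> mor C ?D A" using assms(2,3) arrow_src_tgt(3) by blast
  have "(\<Oplus>\<^bsub>Hom C A B\<^esub>i\<in>I. f i) \<bullet> h = (\<Oplus>\<^bsub>Hom C (src h) B\<^esub>i\<in>I. f i \<bullet> h)
      \<and> (\<Oplus>\<^bsub>Hom C A B\<^esub>i\<in>I. f i) \<in> mor C A B"
    using assms(1,6)
  proof (induction I)
    case empty
    then show ?case using assms(2-5) by simp
  next
    case (insert i I)
    have fI: "f \<in> I \<rightarrow> mor C A B" "f i \<in> mor C A B" using insert.prems arr_mor by blast+
    then have "(\<lambda>i. f i \<bullet> h) \<in> I \<rightarrow> mor C ?D B" "f i \<bullet> h \<in> mor C ?D B"
      using comp_closed[OF o assms(4,5) hm] by auto
    moreover have IH: "(\<Oplus>\<^bsub>Hom C A B\<^esub>i\<in>I. f i) \<bullet> h = (\<Oplus>\<^bsub>Hom C (src h) B\<^esub>i\<in>I. f i \<bullet> h)"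
      "(\<Oplus>\<^bsub>Hom C A B\<^esub>i\<in>I. f i) \<in> mor C A B" using insert by auto
    ultimately show ?case
      using insert.hyps fI comp_add_left[OF o assms(4,5) hm fI(2) IH(2)] by simp
  qed
  then show ?thesis by blast
qed

lemma finsum_single:
  assumes "finite I" "j \<in> I" "arr g A B" "\<And>i. i \<in> I \<Longrightarrow> f i = (if i = j then g else zero_mor C A B)"
  shows "(\<Oplus>\<^bsub>Hom C A B\<^esub>i\<in>I. f i) = g"
proof -
  have o: "A \<in> Ob C" "B \<in> Ob C" using assms(3) by auto
  interpret AB: abelian_group "Hom C A B" using o Hom_abelian_group by auto
  have g: "g \<in> mor C A B" using assms(3) arr_mor by blast
  have "(\<Oplus>\<^bsub>Hom C A B\<^esub>i\<in>I. f i) = (\<Oplus>\<^bsub>Hom C A B\<^esub>i\<in>I. if j = i then g else zero_mor C A B)"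
    using assms(4) g by (intro AB.finsum_cong') auto
  also have "\<dots> = g" using AB.finsum_singleton[OF assms(2,1), of "\<lambda>_. g"] g by simp
  finally show ?thesis .
qed

lemma finsum_zero_mor:
  assumes "A \<in> Ob C" "B \<in> Ob C" "\<And>i. i \<in> I \<Longrightarrow> f i = zero_mor C A B"
  shows "(\<Oplus>\<^bsub>Hom C A B\<^esub>i\<in>I. f i) = zero_mor C A B"
proof -
  interpret AB: abelian_group "Hom C A B" using assms Hom_abelian_group by auto
  show ?thesis using assms(3) by (simp add: AB.add.finprod_one_eqI)
qed

end

section \<open>Monomorphisms, kernels and direct sums\<close>

context linear_category
begin

definition mon :: "'m \<Rightarrow> bool" where
  "mon f \<longleftrightarrow> arrow f \<and> (\<forall>x. arrow x \<longrightarrow> tgt x = src f \<longrightarrow>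
     f \<bullet> x = zero_mor C (src x) (tgt f) \<longrightarrow> x = zero_mor C (src x) (src f))"

definition epi :: "'m \<Rightarrow> bool" where
  "epi f \<longleftrightarrow> arrow f \<and> (\<forall>x. arrow x \<longrightarrow> src x = tgt f \<longrightarrow>
     x \<bullet> f = zero_mor C (src f) (tgt x) \<longrightarrow> x = zero_mor C (tgt f) (tgt x))"

definition iso :: "'m \<Rightarrow> bool" where
  "iso f \<longleftrightarrow> arrow f \<and> (\<exists>g. arr g (tgt f) (src f) \<and> g \<bullet> f = ident C (src f) \<and> f \<bullet> g = ident C (tgt f))"

definition joint_kernel :: "'o \<Rightarrow> 'm set \<Rightarrow> 'm \<Rightarrow> bool" where
  "joint_kernel A \<Phi> k \<longleftrightarrow> mon k \<and> tgt k = A \<and> (\<forall>\<phi> \<in> \<Phi>. \<phi> \<bullet> k = zero_mor C (src k) (tgt \<phi>)) \<and>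
     (\<forall>x. arrow x \<longrightarrow> tgt x = A \<longrightarrow> (\<forall>\<phi> \<in> \<Phi>. \<phi> \<bullet> x = zero_mor C (src x) (tgt \<phi>)) \<longrightarrow>
        (\<exists>u. arr u (src x) (src k) \<and> k \<bullet> u = x))"

definition kernel :: "'m \<Rightarrow> 'm \<Rightarrow> bool" where
  "kernel f k \<longleftrightarrow> arrow f \<and> joint_kernel (src f) {f} k"

definition cokernel :: "'m \<Rightarrow> 'm \<Rightarrow> bool" where
  "cokernel f q \<longleftrightarrow> arrow f \<and> epi q \<and> src q = tgt f \<and> q \<bullet> f = zero_mor C (src f) (tgt q) \<and>
     (\<forall>x. arrow x \<longrightarrow> src x = tgt f \<longrightarrow> x \<bullet> f = zero_mor C (src f) (tgt x) \<longrightarrow>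
        (\<exists>u. arr u (tgt q) (tgt x) \<and> u \<bullet> q = x))"

lemma mon_arrow [simp]: "mon f \<Longrightarrow> arrow f"
  unfolding mon_def by blast

lemma epi_arrow [simp]: "epi f \<Longrightarrow> arrow f"
  unfolding epi_def by blast

lemma monD:
  assumes "mon f" "arrow x" "tgt x = src f" "f \<bullet> x = zero_mor C (src x) (tgt f)"
  shows "x = zero_mor C (src x) (src f)"
  using assms unfolding mon_def by blast

lemma epiD:
  assumes "epi f" "arrow x" "src x = tgt f" "x \<bullet> f = zero_mor C (src f) (tgt x)"
  shows "x = zero_mor C (tgt f) (tgt x)"
  using assms unfolding epi_def by blast

lemma mon_cancel:
  assumes "mon f" "f \<bullet> x = f \<bullet> y" "arrow x" "arrow y" "tgt x = src f" "tgt y = src f" "src x = src y"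
  shows "x = y"
proof -
  have f: "arrow f" using assms(1) by simp
  have "f \<bullet> (x \<^bold>- y) = f \<bullet> x \<^bold>- f \<bullet> y"
    using assms f by (intro comp_minus_left) auto
  also have "\<dots> = zero_mor C (src y) (tgt f)"
    using minus_eq_zero_iff[of "f \<bullet> x" "f \<bullet> y"] assms f by simp
  finally have "x \<^bold>- y = zero_mor C (src y) (src f)"
    using monD[OF assms(1), of "x \<^bold>- y"] assms by simp
  then show ?thesis using minus_eq_zero_iff[of x y] assms by simp
qed

lemma epi_cancel:
  assumes "epi f" "x \<bullet> f = y \<bullet> f" "arrow x" "arrow y" "src x = tgt f" "src y = tgt f" "tgt x = tgt y"
  shows "x = y"
proof -
  have f: "arrow f" using assms(1) by simp
  have "(x \<^bold>- y) \<bullet> f = x \<bullet> f \<^bold>- y \<bullet> f"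
    using assms f by (intro comp_minus_right) auto
  also have "\<dots> = zero_mor C (src f) (tgt y)"
    using minus_eq_zero_iff[of "x \<bullet> f" "y \<bullet> f"] assms f by simp
  finally have "x \<^bold>- y = zero_mor C (tgt f) (tgt y)"
    using epiD[OF assms(1), of "x \<^bold>- y"] assms by simp
  then show ?thesis using minus_eq_zero_iff[of x y] assms by simp
qed

lemma monic_iff:
  assumes "A \<in> Ob C" "B \<in> Ob C"
  shows "monic C A B f \<longleftrightarrow> mon f \<and> src f = A \<and> tgt f = B"
proof
  assume m: "monic C A B f"
  then have f: "f \<in> mor C A B" unfolding monic_def by blast
  then have [simp]: "arrow f" "src f = A" "tgt f = B" using arr_src_tgt[OF assms f] by auto
  have "x = zero_mor C (src x) A"
    if x: "arrow x" "tgt x = A" "f \<bullet> x = zero_mor C (src x) B" for x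
  proof -
    have "f \<bullet> x = f \<bullet> zero_mor C (src x) A" using x by simp
    moreover have "x \<in> mor C (src x) A" "zero_mor C (src x) A \<in> mor C (src x) A"
      using x assms by (simp_all add: mor_iff)
    ultimately show ?thesis
      using m x(1) unfolding monic_def by (metis arrow_src_tgt(1))
  qed
  then show "mon f \<and> src f = A \<and> tgt f = B" unfolding mon_def by simp
next
  assume m: "mon f \<and> src f = A \<and> tgt f = B"
  show "monic C A B f"
    unfolding monic_def using m assms by (auto simp: mor_iff intro: mon_cancel[of f])
qed

lemma epic_iff:
  assumes "A \<in> Ob C" "B \<in> Ob C"
  shows "epic C A B f \<longleftrightarrow> epi f \<and> src f = A \<and> tgt f = B"
proof
  assume m: "epic C A B f"
  then have f: "f \<in> mor C A B" unfolding epic_def by blast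
  then have [simp]: "arrow f" "src f = A" "tgt f = B" using arr_src_tgt[OF assms f] by auto
  have "x = zero_mor C B (tgt x)"
    if x: "arrow x" "src x = B" "x \<bullet> f = zero_mor C A (tgt x)" for x
  proof -
    have "x \<bullet> f = zero_mor C B (tgt x) \<bullet> f" using x by simp
    moreover have "x \<in> mor C B (tgt x)" "zero_mor C B (tgt x) \<in> mor C B (tgt x)"
      using x assms by (simp_all add: mor_iff)
    ultimately show ?thesis
      using m x(1) unfolding epic_def by (metis arrow_src_tgt(2))
  qed
  then show "epi f \<and> src f = A \<and> tgt f = B" unfolding epi_def by simp
next
  assume m: "epi f \<and> src f = A \<and> tgt f = B"
  show "epic C A B f"
    unfolding epic_def using m assms by (auto simp: mor_iff intro: epi_cancel[of f])
qed

lemma isomorphism_iff: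
  assumes "A \<in> Ob C" "B \<in> Ob C"
  shows "isomorphism C A B f \<longleftrightarrow> iso f \<and> src f = A \<and> tgt f = B"
  unfolding isomorphism_def iso_def using assms by (auto simp: mor_iff)

lemma zero_object_iff:
  assumes "A \<in> Ob C"
  shows "zero_object C A \<longleftrightarrow> ident C A = zero_mor C A A"
proof
  assume "zero_object C A"
  then show "ident C A = zero_mor C A A"
    unfolding zero_object_def using assms by (metis arr_iff arr_mor arrow_ident arrow_zero)
next
  assume i: "ident C A = zero_mor C A A"
  have "f = zero_mor C A T" if "arr f A T" for f T
    using that i comp_ident(1)[of f A] by (simp del: comp_ident)
  moreover have "f = zero_mor C T A" if "arr f T A" for f T
    using that i comp_ident(2)[of f A] by (simp del: comp_ident)
  moreover have "zero_mor C A T \<in> mor C A T" "zero_mor C T A \<in> mor C T A" if "T \<in> Ob C" for T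
    using that assms by (simp_all add: mor_iff)
  ultimately show "zero_object C A"
    unfolding zero_object_def using assms arrI by metis
qed

lemma zero_objectD:
  assumes "zero_object C A" "arrow f"
  shows "src f = A \<Longrightarrow> f = zero_mor C A (tgt f)" "tgt f = A \<Longrightarrow> f = zero_mor C (src f) A"
proof -
  have A: "A \<in> Ob C" using assms(1) unfolding zero_object_def by blast
  then have i: "ident C A = zero_mor C A A" using assms(1) zero_object_iff[OF A] by simp
  show "f = zero_mor C A (tgt f)" if "src f = A"
  proof -
    have "f = f \<bullet> zero_mor C A A" using comp_ident(1)[of f A] assms(2) that i by simp
    also have "\<dots> = zero_mor C A (tgt f)" using assms(2) that A by (intro comp_zero(2)) auto
    finally show ?thesis .
  qed
  show "f = zero_mor C (src f) A" if "tgt f = A"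
  proof -
    have "f = zero_mor C A A \<bullet> f" using comp_ident(2)[of f A] assms(2) that i by simp
    also have "\<dots> = zero_mor C (src f) A" using assms(2) that A by (intro comp_zero(1)) auto
    finally show ?thesis .
  qed
qed

lemma kernel_iff:
  "kernel f k \<longleftrightarrow> arrow f \<and> mon k \<and> tgt k = src f \<and> f \<bullet> k = zero_mor C (src k) (tgt f) \<and>
     (\<forall>x. arrow x \<longrightarrow> tgt x = src f \<longrightarrow> f \<bullet> x = zero_mor C (src x) (tgt f) \<longrightarrow>
        (\<exists>u. arr u (src x) (src k) \<and> k \<bullet> u = x))"
  unfolding kernel_def joint_kernel_def by auto

lemma kernelD:
  assumes "kernel f k"
  shows "arrow f" "mon k" "arrow k" "tgt k = src f" "f \<bullet> k = zero_mor C (src k) (tgt f)"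
  using assms unfolding kernel_iff by auto

lemma kernel_lift:
  assumes "kernel f k" "arrow x" "tgt x = src f" "f \<bullet> x = zero_mor C (src x) (tgt f)"
  obtains u where "arrow u" "src u = src x" "tgt u = src k" "k \<bullet> u = x"
  using assms unfolding kernel_iff by auto

lemma joint_kernelD:
  assumes "joint_kernel A \<Phi> k"
  shows "mon k" "arrow k" "tgt k = A" "\<And>\<phi>. \<phi> \<in> \<Phi> \<Longrightarrow> \<phi> \<bullet> k = zero_mor C (src k) (tgt \<phi>)"
  using assms unfolding joint_kernel_def by auto

lemma joint_kernel_lift:
  assumes "joint_kernel A \<Phi> k" "arrow x" "tgt x = A"
    "\<And>\<phi>. \<phi> \<in> \<Phi> \<Longrightarrow> \<phi> \<bullet> x = zero_mor C (src x) (tgt \<phi>)"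
  obtains u where "arrow u" "src u = src x" "tgt u = src k" "k \<bullet> u = x"
proof -
  have "\<exists>u. arr u (src x) (src k) \<and> k \<bullet> u = x"
    using assms unfolding joint_kernel_def by blast
  then show ?thesis using that by auto
qed

lemma cokernelD:
  assumes "cokernel f q"
  shows "arrow f" "epi q" "arrow q" "src q = tgt f" "q \<bullet> f = zero_mor C (src f) (tgt q)"
  using assms unfolding cokernel_def by auto

lemma cokernel_lift:
  assumes "cokernel f q" "arrow x" "src x = tgt f" "x \<bullet> f = zero_mor C (src f) (tgt x)"
  obtains u where "arrow u" "src u = tgt q" "tgt u = tgt x" "u \<bullet> q = x"
  using assms unfolding cokernel_def by auto

lemma is_kernel_iff:
  assumes "A \<in> Ob C" "B \<in> Ob C"
  shows "is_kernel C A B f K k \<longleftrightarrow> kernel f k \<and> src f = A \<and> tgt f = B \<and> src k = K"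
proof
  assume l: "is_kernel C A B f K k"
  then have K: "K \<in> Ob C" and f: "f \<in> mor C A B" and k: "k \<in> mor C K A"
    and z: "f \<bullet> k = zero_mor C K B" unfolding is_kernel_def by blast+
  have u: "\<And>T h. T \<in> Ob C \<Longrightarrow> h \<in> mor C T A \<Longrightarrow> f \<bullet> h = zero_mor C T B \<Longrightarrow>
      \<exists>!u. u \<in> mor C T K \<and> k \<bullet> u = h" using l unfolding is_kernel_def by blast
  have [simp]: "arrow f" "src f = A" "tgt f = B" "arrow k" "src k = K" "tgt k = A"
    using f k K assms by (simp_all add: mor_iff)
  have ex: "\<exists>u. arr u (src x) K \<and> k \<bullet> u = x"
    if "arrow x" "tgt x = A" "f \<bullet> x = zero_mor C (src x) B" for x
    using u[of "src x" x] that K assms by (auto simp: mor_iff)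
  have "x = zero_mor C (src x) K"
    if x: "arrow x" "tgt x = K" "k \<bullet> x = zero_mor C (src x) A" for x
  proof -
    have "\<exists>!u. u \<in> mor C (src x) K \<and> k \<bullet> u = zero_mor C (src x) A"
      using x K assms by (intro u) (simp_all add: mor_iff)
    moreover have "x \<in> mor C (src x) K \<and> k \<bullet> x = zero_mor C (src x) A"
      "zero_mor C (src x) K \<in> mor C (src x) K \<and> k \<bullet> zero_mor C (src x) K = zero_mor C (src x) A"
      using x K assms by (simp_all add: mor_iff)
    ultimately show ?thesis by blast
  qed
  then have "mon k" unfolding mon_def by simp
  then show "kernel f k \<and> src f = A \<and> tgt f = B \<and> src k = K"
    unfolding kernel_iff using z ex by simp
next
  assume r: "kernel f k \<and> src f = A \<and> tgt f = B \<and> src k = K"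
  then have k: "kernel f k" and [simp]: "src f = A" "tgt f = B" "src k = K" by auto
  note [simp] = kernelD[OF k]
  have K: "K \<in> Ob C" using arrow_src_tgt(1)[of k] by simp
  have "\<exists>!u. u \<in> mor C T K \<and> k \<bullet> u = h"
    if h: "T \<in> Ob C" "h \<in> mor C T A" "f \<bullet> h = zero_mor C T B" for T h
  proof -
    have [simp]: "arrow h" "src h = T" "tgt h = A" using h assms by (simp_all add: mor_iff)
    obtain u where u: "arrow u" "src u = src h" "tgt u = src k" "k \<bullet> u = h"
      using kernel_lift[OF k, of h] h by auto
    show ?thesis
    proof (rule ex1I[of _ u])
      show "u \<in> mor C T K \<and> k \<bullet> u = h" using u h K by (simp add: mor_iff)
      show "v = u" if "v \<in> mor C T K \<and> k \<bullet> v = h" for v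
      proof -
        have "arrow v" "src v = T" "tgt v = K" "k \<bullet> v = h"
          using that h(1) K by (simp_all add: mor_iff)
        with u show ?thesis
          by - (rule mon_cancel[OF kernelD(2)[OF k]], simp_all)
      qed
    qed
  qed
  note univ = this
  show "is_kernel C A B f K k"
    unfolding is_kernel_def
  proof (intro conjI ballI impI)
    fix T h assume "T \<in> Ob C" "h \<in> mor C T A" "f \<bullet> h = zero_mor C T B"
    then show "\<exists>!u. u \<in> mor C T K \<and> k \<bullet> u = h" by (rule univ)
  qed (use assms K in \<open>simp_all add: mor_iff\<close>)
qed

lemma is_cokernel_iff:
  assumes "A \<in> Ob C" "B \<in> Ob C"
  shows "is_cokernel C A B f K k \<longleftrightarrow> cokernel f k \<and> src f = A \<and> tgt f = B \<and> tgt k = K"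
proof
  assume l: "is_cokernel C A B f K k"
  then have K: "K \<in> Ob C" and f: "f \<in> mor C A B" and k: "k \<in> mor C B K"
    and z: "k \<bullet> f = zero_mor C A K" unfolding is_cokernel_def by blast+
  have u: "\<And>T h. T \<in> Ob C \<Longrightarrow> h \<in> mor C B T \<Longrightarrow> h \<bullet> f = zero_mor C A T \<Longrightarrow>
      \<exists>!u. u \<in> mor C K T \<and> u \<bullet> k = h" using l unfolding is_cokernel_def by blast
  have [simp]: "arrow f" "src f = A" "tgt f = B" "arrow k" "src k = B" "tgt k = K"
    using f k K assms by (simp_all add: mor_iff)
  have ex: "\<exists>u. arr u K (tgt x) \<and> u \<bullet> k = x"
    if "arrow x" "src x = B" "x \<bullet> f = zero_mor C A (tgt x)" for x
    using u[of "tgt x" x] that K assms by (auto simp: mor_iff)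
  have "x = zero_mor C K (tgt x)"
    if x: "arrow x" "src x = K" "x \<bullet> k = zero_mor C B (tgt x)" for x
  proof -
    have "\<exists>!u. u \<in> mor C K (tgt x) \<and> u \<bullet> k = zero_mor C B (tgt x)"
      using x K assms by (intro u) (simp_all add: mor_iff)
    moreover have "x \<in> mor C K (tgt x) \<and> x \<bullet> k = zero_mor C B (tgt x)"
      "zero_mor C K (tgt x) \<in> mor C K (tgt x) \<and> zero_mor C K (tgt x) \<bullet> k = zero_mor C B (tgt x)"
      using x K assms by (simp_all add: mor_iff)
    ultimately show ?thesis by blast
  qed
  then have "epi k" unfolding epi_def by simp
  then show "cokernel f k \<and> src f = A \<and> tgt f = B \<and> tgt k = K"
    unfolding cokernel_def using z ex by simp
next
  assume r: "cokernel f k \<and> src f = A \<and> tgt f = B \<and> tgt k = K"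
  then have k: "cokernel f k" and [simp]: "src f = A" "tgt f = B" "tgt k = K" by auto
  note [simp] = cokernelD[OF k]
  have K: "K \<in> Ob C" using arrow_src_tgt(2)[of k] by simp
  have "\<exists>!u. u \<in> mor C K T \<and> u \<bullet> k = h"
    if h: "T \<in> Ob C" "h \<in> mor C B T" "h \<bullet> f = zero_mor C A T" for T h
  proof -
    have [simp]: "arrow h" "src h = B" "tgt h = T" using h assms by (simp_all add: mor_iff)
    obtain u where u: "arrow u" "src u = tgt k" "tgt u = tgt h" "u \<bullet> k = h"
      using cokernel_lift[OF k, of h] h by auto
    show ?thesis
    proof (rule ex1I[of _ u])
      show "u \<in> mor C K T \<and> u \<bullet> k = h" using u h K by (simp add: mor_iff)
      show "v = u" if "v \<in> mor C K T \<and> v \<bullet> k = h" for v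
      proof -
        have "arrow v" "src v = K" "tgt v = T" "v \<bullet> k = h"
          using that h(1) K by (simp_all add: mor_iff)
        with u show ?thesis
          by - (rule epi_cancel[OF cokernelD(2)[OF k]], simp_all)
      qed
    qed
  qed
  note univ = this
  show "is_cokernel C A B f K k"
    unfolding is_cokernel_def
  proof (intro conjI ballI impI)
    fix T h assume "T \<in> Ob C" "h \<in> mor C B T" "h \<bullet> f = zero_mor C A T"
    then show "\<exists>!u. u \<in> mor C K T \<and> u \<bullet> k = h" by (rule univ)
  qed (use assms K in \<open>simp_all add: mor_iff\<close>)
qed

lemma isoD:
  assumes "iso f"
  obtains g where "arrow g" "iso g" "src g = tgt f" "tgt g = src f" "g \<bullet> f = ident C (src f)" "f \<bullet> g = ident C (tgt f)"
proof -
  obtain g where g: "arr g (tgt f) (src f)" "g \<bullet> f = ident C (src f)" "f \<bullet> g = ident C (tgt f)"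
    and f: "arrow f" using assms unfolding iso_def by blast
  moreover have "iso g" unfolding iso_def using f g by auto
  ultimately show ?thesis using that[of g] by simp
qed

lemma mon_if_left_inverse:
  assumes "arrow f" "arrow g" "src g = tgt f" "g \<bullet> f = ident C (src f)"
  shows "mon f"
  unfolding mon_def
proof (intro conjI allI impI)
  have g: "tgt g = src f" using assms arrow_comp(3)[of f g] by simp
  fix x assume x: "arrow x" "tgt x = src f" "f \<bullet> x = zero_mor C (src x) (tgt f)"
  have "x = (g \<bullet> f) \<bullet> x" using assms(4) x by simp
  also have "\<dots> = g \<bullet> (f \<bullet> x)" using assms x by (intro assoc) auto
  also have "\<dots> = zero_mor C (src x) (tgt g)" using x assms by simp
  finally show "x = zero_mor C (src x) (src f)" unfolding g .
qed (use assms in auto)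

lemma epi_if_right_inverse:
  assumes "arrow f" "arrow g" "tgt g = src f" "f \<bullet> g = ident C (tgt f)"
  shows "epi f"
  unfolding epi_def
proof (intro conjI allI impI)
  have g: "src g = tgt f" using assms arrow_comp(2)[of g f] by simp
  fix x assume x: "arrow x" "src x = tgt f" "x \<bullet> f = zero_mor C (src f) (tgt x)"
  have "x = x \<bullet> (f \<bullet> g)" using assms(4) x by simp
  also have "\<dots> = (x \<bullet> f) \<bullet> g" by (rule assoc[symmetric]) (use assms x in auto)
  also have "\<dots> = zero_mor C (src g) (tgt x)" using x assms by simp
  finally show "x = zero_mor C (tgt f) (tgt x)" unfolding g .
qed (use assms in auto)

lemma iso_mon_epi: 
  assumes "iso f"
  shows "arrow f" "mon f" "epi f"
proof -
  show f: "arrow f" using assms unfolding iso_def by blast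
  obtain g where g: "arrow g" "src g = tgt f" "tgt g = src f" "g \<bullet> f = ident C (src f)"
    "f \<bullet> g = ident C (tgt f)" using isoD[OF assms] by metis
  show "mon f" by (rule mon_if_left_inverse[OF f g(1,2,4)])
  show "epi f" by (rule epi_if_right_inverse[OF f g(1,3,5)])
qed

lemma iso_ident: "A \<in> Ob C \<Longrightarrow> iso (ident C A)"
  unfolding iso_def by (auto intro!: exI[of _ "ident C A"])

lemma mon_comp:
  assumes "mon f" "mon g" "src g = tgt f"
  shows "mon (g \<bullet> f)"
  unfolding mon_def
proof (intro conjI allI impI)
  fix x assume x: "arrow x" "tgt x = src (g \<bullet> f)" "(g \<bullet> f) \<bullet> x = zero_mor C (src x) (tgt (g \<bullet> f))"
  then have "g \<bullet> (f \<bullet> x) = zero_mor C (src x) (tgt g)" using assms by simp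
  then have "f \<bullet> x = zero_mor C (src x) (tgt f)"
    using monD[OF assms(2), of "f \<bullet> x"] x assms by simp
  then show "x = zero_mor C (src x) (src (g \<bullet> f))"
    using monD[OF assms(1), of x] x assms by simp
qed (use assms in auto)

lemma epi_comp:
  assumes "epi f" "epi g" "src g = tgt f"
  shows "epi (g \<bullet> f)"
  unfolding epi_def
proof (intro conjI allI impI)
  fix x assume x: "arrow x" "src x = tgt (g \<bullet> f)" "x \<bullet> (g \<bullet> f) = zero_mor C (src (g \<bullet> f)) (tgt x)"
  then have "(x \<bullet> g) \<bullet> f = zero_mor C (src f) (tgt x)" using assms by simp
  then have "x \<bullet> g = zero_mor C (tgt f) (tgt x)"
    using epiD[OF assms(1), of "x \<bullet> g"] x assms by simp
  then show "x = zero_mor C (tgt (g \<bullet> f)) (tgt x)"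
    using epiD[OF assms(2), of x] x assms by simp
qed (use assms in auto)

lemma epi_if_comp_epi:
  assumes "epi (g \<bullet> f)" "arrow f" "arrow g" "src g = tgt f"
  shows "epi g"
  unfolding epi_def
proof (intro conjI allI impI)
  fix x assume x: "arrow x" "src x = tgt g" "x \<bullet> g = zero_mor C (src g) (tgt x)"
  then have "x \<bullet> (g \<bullet> f) = zero_mor C (src f) (tgt x)"
    using comp_reduce[of x g] assms by simp
  then show "x = zero_mor C (tgt g) (tgt x)"
    using epiD[OF assms(1), of x] x assms by simp
qed (use assms in auto)

lemma mon_if_comp_mon:
  assumes "mon (g \<bullet> f)" "arrow f" "arrow g" "src g = tgt f"
  shows "mon f"
  unfolding mon_def
proof (intro conjI allI impI)
  fix x assume x: "arrow x" "tgt x = src f" "f \<bullet> x = zero_mor C (src x) (tgt f)"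
  then have "(g \<bullet> f) \<bullet> x = zero_mor C (src x) (tgt g)" using assms by simp
  then show "x = zero_mor C (src x) (src f)"
    using monD[OF assms(1), of x] x assms by simp
qed (use assms in auto)

text \<open>Direct sums enter only through the joint cancellability of the projections and the two universal
  properties below.\<close>

lemma direct_sumD:
  assumes "is_direct_sum C m T S \<iota> \<pi>"
  shows "S \<in> Ob C"
    and "\<And>j. j < m \<Longrightarrow> T j \<in> Ob C \<and> arrow (\<iota> j) \<and> src (\<iota> j) = T j \<and> tgt (\<iota> j) = S \<and>
      arrow (\<pi> j) \<and> src (\<pi> j) = S \<and> tgt (\<pi> j) = T j"
    and "\<And>i. i < m \<Longrightarrow> \<pi> i \<bullet> \<iota> i = ident C (T i)"
    and "\<And>i j. i < m \<Longrightarrow> j < m \<Longrightarrow> i \<noteq> j \<Longrightarrow> \<pi> i \<bullet> \<iota> j = zero_mor C (T j) (T i)"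
proof -
  show S: "S \<in> Ob C" using assms unfolding is_direct_sum_def by blast
  show "\<And>j. j < m \<Longrightarrow> T j \<in> Ob C \<and> arrow (\<iota> j) \<and> src (\<iota> j) = T j \<and> tgt (\<iota> j) = S \<and>
      arrow (\<pi> j) \<and> src (\<pi> j) = S \<and> tgt (\<pi> j) = T j"
    using assms S unfolding is_direct_sum_def by (metis mor_iff)
  show "\<And>i. i < m \<Longrightarrow> \<pi> i \<bullet> \<iota> i = ident C (T i)"
    "\<And>i j. i < m \<Longrightarrow> j < m \<Longrightarrow> i \<noteq> j \<Longrightarrow> \<pi> i \<bullet> \<iota> j = zero_mor C (T j) (T i)"
    using assms unfolding is_direct_sum_def by simp_all
qed

lemma direct_sum_zero:
  assumes "is_direct_sum C m T S \<iota> \<pi>" "arrow x" "tgt x = S"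
    "\<And>j. j < m \<Longrightarrow> \<pi> j \<bullet> x = zero_mor C (src x) (T j)"
  shows "x = zero_mor C (src x) S"
proof -
  note d = direct_sumD[OF assms(1)]
  have "x = (\<Oplus>\<^bsub>Hom C S S\<^esub>j\<in>{..<m}. \<iota> j \<bullet> \<pi> j) \<bullet> x"
    using assms(1-3) unfolding is_direct_sum_def by simp
  also have "\<dots> = (\<Oplus>\<^bsub>Hom C (src x) S\<^esub>j\<in>{..<m}. (\<iota> j \<bullet> \<pi> j) \<bullet> x)"
    using d assms by (intro comp_finsum_right) auto
  also have "\<dots> = zero_mor C (src x) S"
    using d assms by (intro finsum_zero_mor) auto
  finally show ?thesis .
qed

lemma direct_sum_pairing:
  assumes "is_direct_sum C m T S \<iota> \<pi>" "Y \<in> Ob C" "\<And>j. j < m \<Longrightarrow> arr (g j) Y (T j)"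
  obtains u where "arrow u" "src u = Y" "tgt u = S" "\<And>j. j < m \<Longrightarrow> \<pi> j \<bullet> u = g j"
proof
  note d = direct_sumD[OF assms(1)]
  let ?u = "\<Oplus>\<^bsub>Hom C Y S\<^esub>j\<in>{..<m}. \<iota> j \<bullet> g j"
  have t: "arr (\<iota> j \<bullet> g j) Y S" if "j \<in> {..<m}" for j using that d assms by auto
  have "arr ?u Y S"
    using assms(2) d(1) t by (rule arr_finsum)
  then show "arrow ?u" "src ?u = Y" "tgt ?u = S" by auto
  fix j assume j: "j < m"
  have "\<pi> j \<bullet> ?u = (\<Oplus>\<^bsub>Hom C Y (tgt (\<pi> j))\<^esub>i\<in>{..<m}. \<pi> j \<bullet> (\<iota> i \<bullet> g i))"
    using d(1) d(2)[OF j] assms(2) t by (intro comp_finsum_left) auto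
  also have "\<dots> = g j"
  proof (rule finsum_single[of _ j])
    fix i assume i: "i \<in> {..<m}"
    show "\<pi> j \<bullet> (\<iota> i \<bullet> g i) = (if i = j then g j else zero_mor C Y (tgt (\<pi> j)))"
    proof (cases "i = j")
      case True
      then show ?thesis
        using comp_reduce[OF d(3)[OF j], of "g j"] d(2)[OF j] assms(3)[OF j] by simp
    next
      case False
      moreover have "i < m" using i by simp
      ultimately show ?thesis
        using comp_reduce[OF d(4)[OF j \<open>i < m\<close>], of "g i"] d(2)[OF j] d(2)[of i] assms(3)[of i]
        by simp
    qed
  qed (use j assms d in auto)
  finally show "\<pi> j \<bullet> ?u = g j" .
qed

lemma direct_sum_copairing:
  assumes "is_direct_sum C m T S \<iota> \<pi>" "Y \<in> Ob C" "\<And>j. j < m \<Longrightarrow> arr (g j) (T j) Y"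
  obtains u where "arrow u" "src u = S" "tgt u = Y" "\<And>j. j < m \<Longrightarrow> u \<bullet> \<iota> j = g j"
proof
  note d = direct_sumD[OF assms(1)]
  let ?u = "\<Oplus>\<^bsub>Hom C S Y\<^esub>j\<in>{..<m}. g j \<bullet> \<pi> j"
  have t: "arr (g j \<bullet> \<pi> j) S Y" if "j \<in> {..<m}" for j using that d assms by auto
  have "arr ?u S Y"
    using d(1) assms(2) t by (rule arr_finsum)
  then show "arrow ?u" "src ?u = S" "tgt ?u = Y" by auto
  fix j assume j: "j < m"
  have "?u \<bullet> \<iota> j = (\<Oplus>\<^bsub>Hom C (src (\<iota> j)) Y\<^esub>i\<in>{..<m}. (g i \<bullet> \<pi> i) \<bullet> \<iota> j)"
    using d(1) d(2)[OF j] assms(2) t by (intro comp_finsum_right) auto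
  also have "\<dots> = g j"
  proof (rule finsum_single[of _ j])
    fix i assume i: "i \<in> {..<m}"
    show "(g i \<bullet> \<pi> i) \<bullet> \<iota> j = (if i = j then g j else zero_mor C (src (\<iota> j)) Y)"
    proof (cases "i = j")
      case True
      then show ?thesis using d(2,3)[OF j] assms(3)[OF j] by simp
    next
      case False
      moreover have "i < m" using i by simp
      ultimately show ?thesis
        using d(4)[OF \<open>i < m\<close> j] d(2)[OF j] d(2)[of i] assms(3)[of i] by simp
    qed
  qed (use j assms d in auto)
  finally show "?u \<bullet> \<iota> j = g j" .
qed

end

section \<open>Images and fibre products in an abelian category\<close>

context linear_category
begin

text \<open>The uniqueness of the induced morphism is expressed by the cancellation property of the last clause.\<close>

definition pullback :: "'m \<Rightarrow> 'm \<Rightarrow> 'm \<Rightarrow> 'm \<Rightarrow> bool" where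
  "pullback f g q r \<longleftrightarrow> arrow f \<and> arrow g \<and> arrow q \<and> arrow r \<and>
     tgt f = tgt g \<and> tgt q = src f \<and> tgt r = src g \<and> src q = src r \<and> f \<bullet> q = g \<bullet> r \<and>
     (\<forall>s t. arrow s \<longrightarrow> arrow t \<longrightarrow> src s = src t \<longrightarrow> tgt s = src f \<longrightarrow> tgt t = src g \<longrightarrow>
        f \<bullet> s = g \<bullet> t \<longrightarrow> (\<exists>u. arr u (src t) (src r) \<and> q \<bullet> u = s \<and> r \<bullet> u = t)) \<and>
     (\<forall>x y. arrow x \<longrightarrow> arrow y \<longrightarrow> src x = src y \<longrightarrow> tgt x = src r \<longrightarrow> tgt y = src r \<longrightarrow>
        q \<bullet> x = q \<bullet> y \<longrightarrow> r \<bullet> x = r \<bullet> y \<longrightarrow> x = y)"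

lemma pullbackD:
  assumes "pullback f g q r"
  shows "arrow f" "arrow g" "arrow q" "arrow r" "tgt f = tgt g" "tgt q = src f" "tgt r = src g"
    "src q = src r" "f \<bullet> q = g \<bullet> r"
  using assms unfolding pullback_def by blast+

lemma pullback_lift:
  assumes "pullback f g q r" "arrow s" "arrow t" "src s = src t" "tgt s = src f" "tgt t = src g"
    "f \<bullet> s = g \<bullet> t"
  obtains u where "arrow u" "src u = src t" "tgt u = src r" "q \<bullet> u = s" "r \<bullet> u = t"
proof -
  have "\<exists>u. arr u (src t) (src r) \<and> q \<bullet> u = s \<and> r \<bullet> u = t"
    using assms unfolding pullback_def by blast
  then show ?thesis using that by auto
qed

lemma pullback_cancel:
  assumes "pullback f g q r" "q \<bullet> x = q \<bullet> y" "r \<bullet> x = r \<bullet> y" "arrow x" "arrow y" "src x = src y"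
    "tgt x = src r" "tgt y = src r"
  shows "x = y"
  using assms unfolding pullback_def by blast

lemma pullback_kernel:
  assumes pb: "pullback f g q r" and k: "kernel f k"
  obtains k' where "kernel r k'" "src k' = src k" "q \<bullet> k' = k"
proof -
  note [simp] = pullbackD[OF pb] kernelD[OF k]
  have "f \<bullet> k = g \<bullet> zero_mor C (src k) (src g)" by simp
  then obtain k' where k': "arrow k'" "src k' = src k" "tgt k' = src r" "q \<bullet> k' = k"
      "r \<bullet> k' = zero_mor C (src k) (src g)"
    using pullback_lift[OF pb, of k "zero_mor C (src k) (src g)"] by auto
  have "mon k'" using k' kernelD(2)[OF k] by (intro mon_if_comp_mon[of q k']) simp_all
  moreover have "\<exists>u. arr u (src x) (src k') \<and> k' \<bullet> u = x"
    if x: "arrow x" "tgt x = src r" "r \<bullet> x = zero_mor C (src x) (tgt r)" for x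
  proof -
    have "f \<bullet> (q \<bullet> x) = g \<bullet> (r \<bullet> x)"
      by (rule comp_reduce2) (use x in simp_all)
    also have "\<dots> = zero_mor C (src x) (tgt f)" using x by simp
    finally have "f \<bullet> (q \<bullet> x) = zero_mor C (src (q \<bullet> x)) (tgt f)" using x by simp
    then obtain u where u: "arrow u" "src u = src x" "tgt u = src k" "k \<bullet> u = q \<bullet> x"
      using kernel_lift[OF k, of "q \<bullet> x"] x by auto
    have "k' \<bullet> u = x"
    proof (rule pullback_cancel[OF pb])
      show "q \<bullet> (k' \<bullet> u) = q \<bullet> x" using comp_reduce[OF k'(4), of u] u k' by simp
      show "r \<bullet> (k' \<bullet> u) = r \<bullet> x" using comp_reduce[OF k'(5), of u] u k' x by simp
    qed (use u k' x in simp_all)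
    then show ?thesis using u k' x by auto
  qed
  ultimately have "kernel r k'" unfolding kernel_iff using k' by simp
  then show ?thesis using that k' by blast
qed

end

context abelian_category
begin

lemma kernel_exists:
  assumes "arrow f" obtains k where "kernel f k"
  using kernels[of "src f" "tgt f" f] is_kernel_iff[of "src f" "tgt f" f] assms by auto

lemma cokernel_exists:
  assumes "arrow f" obtains q where "cokernel f q"
  using cokernels[of "src f" "tgt f" f] is_cokernel_iff[of "src f" "tgt f" f] assms by auto

lemma kernel_of_cokernel:
  assumes f: "mon f" and q: "cokernel f q"
  shows "kernel q f"
proof -
  note [simp] = cokernelD[OF q]
  have "monic C (src f) (tgt f) f" using monic_iff f by simp
  then obtain D g where D: "D \<in> Ob C" "is_kernel C (tgt f) D g (src f) f"
    using monic_normal[of "src f" "tgt f" f] by auto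
  have g: "kernel g f" using D is_kernel_iff[of "tgt f" D g "src f" f] by simp
  note [simp] = kernelD(1)[OF g] kernelD(4)[OF g, symmetric] kernelD(5)[OF g]
  obtain v where v: "arrow v" "src v = tgt q" "tgt v = tgt g" "v \<bullet> q = g"
    using cokernel_lift[OF q, of g] by auto
  show ?thesis unfolding kernel_iff
  proof (intro conjI allI impI)
    fix x assume x: "arrow x" "tgt x = src q" "q \<bullet> x = zero_mor C (src x) (tgt q)"
    have "g \<bullet> x = v \<bullet> (q \<bullet> x)" using x v assoc[of x q v] by simp
    also have "\<dots> = zero_mor C (src x) (tgt g)" using x v by simp
    finally show "\<exists>u. arr u (src x) (src f) \<and> f \<bullet> u = x"
      using kernel_lift[OF g, of x] x by auto
  qed (use f in auto)
qed

lemma cokernel_of_kernel: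
  assumes f: "epi f" and k: "kernel f k"
  shows "cokernel k f"
proof -
  note [simp] = kernelD[OF k]
  have "epic C (src f) (tgt f) f" using epic_iff f by simp
  then obtain D g where D: "D \<in> Ob C" "is_cokernel C D (src f) g (tgt f) f"
    using epic_normal[of "src f" "tgt f" f] by auto
  have g: "cokernel g f" using D is_cokernel_iff[of D "src f" g "tgt f" f] by simp
  note [simp] = cokernelD(1)[OF g] cokernelD(4)[OF g, symmetric] cokernelD(5)[OF g]
  obtain v where v: "arrow v" "src v = src g" "tgt v = src k" "k \<bullet> v = g"
    using kernel_lift[OF k, of g] by auto
  show ?thesis unfolding cokernel_def
  proof (intro conjI allI impI)
    fix x assume x: "arrow x" "src x = tgt k" "x \<bullet> k = zero_mor C (src k) (tgt x)"
    have "x \<bullet> g = x \<bullet> (k \<bullet> v)" using v by simp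
    also have "\<dots> = (x \<bullet> k) \<bullet> v" by (rule assoc[symmetric]) (use x v in simp_all)
    also have "\<dots> = zero_mor C (src g) (tgt x)" using x v by simp
    finally show "\<exists>u. arr u (tgt f) (tgt x) \<and> u \<bullet> f = x"
      using cokernel_lift[OF g, of x] x by auto
  qed (use f in auto)
qed

lemma iso_if_mon_epi:
  assumes f: "mon f" "epi f"
  shows "iso f"
proof -
  obtain q where q: "cokernel f q" using cokernel_exists[OF mon_arrow[OF f(1)]] by blast
  note qs = cokernelD[OF q]
  have "q = zero_mor C (tgt f) (tgt q)" using epiD[OF f(2), of q] qs by simp
  then have "q \<bullet> ident C (tgt f) = zero_mor C (tgt f) (tgt q)" using qs f by simp
  then obtain u where u: "arrow u" "src u = tgt f" "tgt u = src f" "f \<bullet> u = ident C (tgt f)"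
    using kernel_lift[OF kernel_of_cokernel[OF f(1) q], of "ident C (tgt f)"] f qs by auto
  have "f \<bullet> (u \<bullet> f) = f \<bullet> ident C (src f)" using comp_reduce[OF u(4), of f] u f by simp
  then have "u \<bullet> f = ident C (src f)" by (rule mon_cancel[OF f(1)]) (use u f in auto)
  then show ?thesis unfolding iso_def using u f by auto
qed

text \<open>The first factor \<open>q\<close> is the cokernel of the kernel of \<open>f\<close>. If \<open>m\<close> kills \<open>x\<close>, then \<open>m\<close> factors through
  the cokernel \<open>j\<close> of \<open>x\<close>; the epimorphism \<open>j q\<close> is the cokernel of a morphism that \<open>f\<close>, and hence
  \<open>q\<close>, kills already. So \<open>j\<close> is a split monomorphism, and \<open>x\<close>, which it kills, is zero.\<close>

lemma image_factorization:
  assumes f: "arrow f"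
  obtains q m where "epi q" "mon m" "src q = src f" "tgt q = src m" "tgt m = tgt f" "m \<bullet> q = f"
proof -
  obtain k where k: "kernel f k" using kernel_exists f by blast
  note ks = kernelD[OF k]
  obtain q where q: "cokernel k q" using cokernel_exists ks by blast
  note qs = cokernelD[OF q]
  obtain m where m: "arrow m" "src m = tgt q" "tgt m = tgt f" "m \<bullet> q = f"
    using cokernel_lift[OF q, of f] f ks by auto
  have "x = zero_mor C (src x) (src m)"
    if x: "arrow x" "tgt x = src m" "m \<bullet> x = zero_mor C (src x) (tgt m)" for x
  proof -
    obtain j where j: "cokernel x j" using cokernel_exists x by blast
    note js = cokernelD[OF j]
    obtain m' where m': "arrow m'" "src m' = tgt j" "tgt m' = tgt m" "m' \<bullet> j = m"
      using cokernel_lift[OF j, of m] m x by auto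
    have jq: "epi (j \<bullet> q)" using epi_comp qs js x m by auto
    then obtain g where g: "kernel (j \<bullet> q) g" using kernel_exists[OF epi_arrow] by blast
    note gs = kernelD[OF g]
    have s: "src (j \<bullet> q) = src f" "tgt (j \<bullet> q) = tgt j" using js qs m x ks by auto
    have jqg: "j \<bullet> (q \<bullet> g) = zero_mor C (src g) (tgt j)"
      using gs js qs m x ks by simp
    have "f \<bullet> g = m' \<bullet> (j \<bullet> (q \<bullet> g))"
    proof -
      have "f \<bullet> g = m \<bullet> (q \<bullet> g)" using comp_reduce m gs s qs f ks by auto
      also have "\<dots> = m' \<bullet> (j \<bullet> (q \<bullet> g))"
        using comp_reduce[OF m'(4), of "q \<bullet> g"] m' js gs s qs ks x m by simp
      finally show ?thesis .
    qed
    also have "\<dots> = zero_mor C (src g) (tgt f)" using jqg m' js gs m by simp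
    finally obtain v where v: "arrow v" "src v = src g" "tgt v = src k" "k \<bullet> v = g"
      using kernel_lift[OF k, of g] gs s by auto
    have "q \<bullet> g = zero_mor C (src g) (tgt q)"
      using comp_reduce[OF qs(5), of v] v qs ks by simp
    then obtain t where t: "arrow t" "src t = tgt j" "tgt t = tgt q" "t \<bullet> (j \<bullet> q) = q"
      using cokernel_lift[OF cokernel_of_kernel[OF jq g], of q] gs s qs ks by auto
    have "(t \<bullet> j) \<bullet> q = ident C (tgt q) \<bullet> q" using t js qs x m by simp
    then have "t \<bullet> j = ident C (tgt q)"
      by (rule epi_cancel[OF qs(2)]) (use t js qs x m in auto)
    then have "mon j" using mon_if_left_inverse[of j t] t js x m by simp
    then show ?thesis using monD[of j x] js x by simp
  qed
  then have "mon m" unfolding mon_def using m by blast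
  then show ?thesis using that[of q m] qs m ks by simp
qed

text \<open>The fibre product is the kernel of the difference map on the direct sum. If \<open>f\<close> is an
  epimorphism, then so is this difference, which is therefore the cokernel of the fibre product;
  this is why a morphism killing the fibre product vanishes.\<close>

lemma pullback_exists:
  assumes f: "arrow f" and g: "arrow g" and fg: "tgt f = tgt g"
  obtains q r where "pullback f g q r" "epi f \<Longrightarrow> epi r"
proof -
  let ?T = "\<lambda>j::nat. if j = 0 then src f else src g"
  have "\<exists>S \<iota> \<pi>. is_direct_sum C 2 ?T S \<iota> \<pi>"
    by (rule direct_sums) (use f g in simp)
  then obtain S \<iota> \<pi> where S: "is_direct_sum C 2 ?T S \<iota> \<pi>" by blast
  note d = direct_sumD[OF S]
  have p0: "arrow (\<pi> 0)" "src (\<pi> 0) = S" "tgt (\<pi> 0) = src f"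
    and p1: "arrow (\<pi> 1)" "src (\<pi> 1) = S" "tgt (\<pi> 1) = src g"
    and i0: "arrow (\<iota> 0)" "src (\<iota> 0) = src f" "tgt (\<iota> 0) = S"
    and i1: "arrow (\<iota> 1)" "src (\<iota> 1) = src g" "tgt (\<iota> 1) = S"
    using d(2)[of 0] d(2)[of 1] by auto
  have pi: "\<pi> 0 \<bullet> \<iota> 0 = ident C (src f)" "\<pi> 1 \<bullet> \<iota> 1 = ident C (src g)"
    "\<pi> 1 \<bullet> \<iota> 0 = zero_mor C (src f) (src g)"
    using d(3)[of 0] d(3)[of 1] d(4)[of 1 0] by auto
  define h where "h = f \<bullet> \<pi> 0 \<^bold>- g \<bullet> \<pi> 1"
  have h: "arrow h" "src h = S" "tgt h = tgt g"
    unfolding h_def using f g fg p0 p1 by auto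
  have hx: "h \<bullet> x = f \<bullet> (\<pi> 0 \<bullet> x) \<^bold>- g \<bullet> (\<pi> 1 \<bullet> x)" if "arrow x" "tgt x = S" for x
    unfolding h_def using comp_minus_right[of "f \<bullet> \<pi> 0" "g \<bullet> \<pi> 1" x] that f g fg p0 p1 by simp
  obtain k where k: "kernel h k" using kernel_exists h by blast
  note ks = kernelD[OF k]
  define q where "q = \<pi> 0 \<bullet> k"
  define r where "r = \<pi> 1 \<bullet> k"
  have q: "arrow q" "src q = src k" "tgt q = src f" and r: "arrow r" "src r = src k" "tgt r = src g"
    unfolding q_def r_def using p0 p1 ks h by auto
  have "f \<bullet> q \<^bold>- g \<bullet> r = zero_mor C (src (g \<bullet> r)) (tgt (g \<bullet> r))"
    using hx[of k] ks h g r unfolding q_def[symmetric] r_def[symmetric] by simp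
  then have fq: "f \<bullet> q = g \<bullet> r" using minus_eq_zero_iff[of "f \<bullet> q" "g \<bullet> r"] f g fg q r by simp
  have lift: "\<exists>u. arr u (src t) (src r) \<and> q \<bullet> u = s \<and> r \<bullet> u = t"
    if st: "arrow s" "arrow t" "src s = src t" "tgt s = src f" "tgt t = src g" "f \<bullet> s = g \<bullet> t" for s t
  proof -
    obtain w where w: "arrow w" "src w = src t" "tgt w = S"
      and pw: "\<And>j. j < 2 \<Longrightarrow> \<pi> j \<bullet> w = (if j = 0 then s else t)"
      by (rule direct_sum_pairing[OF S, of "src t" "\<lambda>j. if j = 0 then s else t"])
        (use st f g in auto)
    have pw: "\<pi> 0 \<bullet> w = s" "\<pi> 1 \<bullet> w = t" using pw[of 0] pw[of 1] by auto
    have "h \<bullet> w = zero_mor C (src w) (tgt h)"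
      using hx[OF w(1,3)] pw st w h g minus_eq_zero_iff[of "f \<bullet> s" "g \<bullet> t"] by simp
    then obtain u where u: "arrow u" "src u = src w" "tgt u = src k" "k \<bullet> u = w"
      using kernel_lift[OF k, of w] w h by auto
    have "q \<bullet> u = s" "r \<bullet> u = t" unfolding q_def r_def using u pw p0 p1 ks h by simp_all
    then show ?thesis using u w r st ks(3) by (intro exI[of _ u]) simp
  qed
  have cancel: "x = y" if xy: "arrow x" "arrow y" "src x = src y" "tgt x = src r" "tgt y = src r"
      "q \<bullet> x = q \<bullet> y" "r \<bullet> x = r \<bullet> y" for x y
  proof -
    let ?z = "k \<bullet> x \<^bold>- k \<bullet> y"
    have z: "arrow ?z" "src ?z = src y" "tgt ?z = S" using xy r ks h by auto
    have "\<pi> j \<bullet> ?z = zero_mor C (src ?z) (?T j)" if j: "j < 2" for j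
    proof -
      have pj: "arrow (\<pi> j)" "src (\<pi> j) = S" "tgt (\<pi> j) = ?T j" using d(2)[OF j] by auto
      have "\<pi> j \<bullet> (k \<bullet> x) = \<pi> j \<bullet> (k \<bullet> y)"
      proof (cases "j = 0")
        case True
        then show ?thesis using xy(6) xy r p0 ks h unfolding q_def by simp
      next
        case False
        then have "j = 1" using j by simp
        then show ?thesis using xy(7) xy r p1 ks h unfolding r_def by simp
      qed
      then show ?thesis
        using comp_minus_left[of "k \<bullet> x" "k \<bullet> y" "\<pi> j"]
          minus_eq_zero_iff[of "\<pi> j \<bullet> (k \<bullet> x)" "\<pi> j \<bullet> (k \<bullet> y)"] pj xy r ks h z by simp
    qed
    then have "?z = zero_mor C (src ?z) S" using direct_sum_zero[OF S z(1,3)] by blast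
    then have "k \<bullet> x = k \<bullet> y"
      using minus_eq_zero_iff[of "k \<bullet> x" "k \<bullet> y"] z xy r ks h by simp
    then show "x = y" by (rule mon_cancel[OF ks(2)]) (use xy r in auto)
  qed
  have pb: "pullback f g q r"
    unfolding pullback_def using f g fg q r fq lift cancel by simp
  have "epi r" if ef: "epi f"
  proof -
    have "h \<bullet> \<iota> 0 = f"
      using hx[OF i0(1,3)] pi f g fg p0 p1 i0 by simp
    then have eh: "epi h" using epi_if_comp_epi[of h "\<iota> 0"] ef h i0 by simp
    show ?thesis unfolding epi_def
    proof (intro conjI allI impI)
      fix t assume t: "arrow t" "src t = tgt r" "t \<bullet> r = zero_mor C (src r) (tgt t)"
      have "(t \<bullet> \<pi> 1) \<bullet> k = zero_mor C (src k) (tgt t)"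
        using t p1 ks h r unfolding r_def by simp
      then obtain s where s: "arrow s" "src s = tgt h" "tgt s = tgt t" "s \<bullet> h = t \<bullet> \<pi> 1"
        using cokernel_lift[OF cokernel_of_kernel[OF eh k], of "t \<bullet> \<pi> 1"] t p1 ks h r by auto
      have "s \<bullet> f = s \<bullet> (h \<bullet> \<iota> 0)" using \<open>h \<bullet> \<iota> 0 = f\<close> by simp
      also have "\<dots> = (t \<bullet> \<pi> 1) \<bullet> \<iota> 0" using s(4) s h i0 assoc[of "\<iota> 0" h s] by simp
      also have "\<dots> = zero_mor C (src f) (tgt t)" using t p1 i0 pi r f by simp
      finally have "s = zero_mor C (tgt f) (tgt s)" using epiD[OF ef, of s] s h fg by simp
      then have "t \<bullet> \<pi> 1 = zero_mor C S (tgt t)" using s h fg t by simp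
      then have "t \<bullet> (\<pi> 1 \<bullet> \<iota> 1) = zero_mor C (src g) (tgt t)"
        using comp_reduce[of t "\<pi> 1" _ "\<iota> 1"] t p1 i1 r by simp
      then show "t = zero_mor C (tgt r) (tgt t)" using pi t r by simp
    qed (use r in auto)
  qed
  then show ?thesis using that pb by blast
qed

text \<open>Epimorphisms are locally surjective on generalized elements.\<close>

lemma epi_lift:
  assumes "epi e" "arrow x" "tgt x = tgt e"
  obtains e' y where "epi e'" "arrow y" "src y = src e'" "tgt e' = src x" "tgt y = src e" "e \<bullet> y = x \<bullet> e'"
proof -
  obtain q r where pb: "pullback e x q r" and r: "epi e \<Longrightarrow> epi r"
    using pullback_exists[of e x] assms by auto
  show ?thesis using that[of r q] pullbackD[OF pb] r assms(1) by simp
qed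

lemma joint_kernel_exists:
  assumes "finite \<Phi>" "A \<in> Ob C" "\<And>\<phi>. \<phi> \<in> \<Phi> \<Longrightarrow> arrow \<phi> \<and> src \<phi> = A"
  obtains k where "joint_kernel A \<Phi> k"
proof -
  have "\<exists>k. joint_kernel A \<Phi> k" using assms(1,3)
  proof (induction \<Phi>)
    case empty
    have "joint_kernel A {} (ident C A)"
      unfolding joint_kernel_def using assms(2) iso_mon_epi(2)[OF iso_ident] by auto
    then show ?case by blast
  next
    case (insert \<phi> \<Phi>)
    then obtain k where k: "joint_kernel A \<Phi> k" by blast
    note ks = joint_kernelD[OF k]
    have \<phi>: "arrow \<phi>" "src \<phi> = A" using insert.prems by auto
    have "arrow (\<phi> \<bullet> k)" using \<phi> ks by simp
    then obtain j where j: "kernel (\<phi> \<bullet> k) j" using kernel_exists by blast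
    note js = kernelD[OF j]
    have s: "src (\<phi> \<bullet> k) = src k" "tgt (\<phi> \<bullet> k) = tgt \<phi>" using \<phi> ks by auto
    have "joint_kernel A (insert \<phi> \<Phi>) (k \<bullet> j)" unfolding joint_kernel_def
    proof (intro conjI allI impI ballI)
      show "mon (k \<bullet> j)" using mon_comp js ks s by simp
      show "tgt (k \<bullet> j) = A" using js ks s by simp
      fix \<psi> assume "\<psi> \<in> insert \<phi> \<Phi>"
      then show "\<psi> \<bullet> (k \<bullet> j) = zero_mor C (src (k \<bullet> j)) (tgt \<psi>)"
      proof (elim insertE)
        assume "\<psi> = \<phi>"
        then show ?thesis using js ks(1-3) s \<phi> by simp
      next
        assume \<psi>: "\<psi> \<in> \<Phi>"
        then have "arrow \<psi>" "src \<psi> = A" using insert.prems by auto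
        moreover from this have "\<psi> \<bullet> (k \<bullet> j) = zero_mor C (src k) (tgt \<psi>) \<bullet> j"
          by - (rule comp_reduce[OF ks(4)[OF \<psi>]], use js ks s in simp_all)
        ultimately show ?thesis using js ks s by simp
      qed
    next
      fix x assume x: "arrow x" "tgt x = A" "\<forall>\<phi>\<in>insert \<phi> \<Phi>. \<phi> \<bullet> x = zero_mor C (src x) (tgt \<phi>)"
      then obtain u where u: "arrow u" "src u = src x" "tgt u = src k" "k \<bullet> u = x"
        using joint_kernel_lift[OF k, of x] by auto
      then have "(\<phi> \<bullet> k) \<bullet> u = zero_mor C (src u) (tgt (\<phi> \<bullet> k))" using x \<phi> ks s by simp
      then obtain v where v: "arrow v" "src v = src u" "tgt v = src j" "j \<bullet> v = u"
        using kernel_lift[OF j, of u] u s by auto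
      then have "(k \<bullet> j) \<bullet> v = x" using u js ks s by simp
      then show "\<exists>u. arr u (src x) (src (k \<bullet> j)) \<and> (k \<bullet> j) \<bullet> u = x"
        using v u js ks s arrow_src_tgt(1)[OF x(1)] by (intro exI[of _ v]) simp
    qed
    then show ?case by blast
  qed
  then show ?thesis using that by blast
qed

lemma simple_Ob [simp]: "simple_object C T \<Longrightarrow> T \<in> Ob C"
  unfolding simple_object_def by blast

lemma mon_to_simple_iso:
  assumes "simple_object C T" "mon f" "tgt f = T" "f \<noteq> zero_mor C (src f) T"
  shows "iso f"
proof -
  have "monic C (src f) T f" using assms monic_iff[of "src f" T] by simp
  then have "zero_object C (src f) \<or> isomorphism C (src f) T f"
    using assms unfolding simple_object_def by simp
  moreover have "\<not> zero_object C (src f)"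
    using zero_objectD(1)[of "src f" f] assms by auto
  ultimately show ?thesis using isomorphism_iff[of "src f" T f] assms by simp
qed

lemma epi_to_simple:
  assumes "simple_object C T" "arrow f" "tgt f = T" "f \<noteq> zero_mor C (src f) T"
  shows "epi f"
proof -
  obtain q m where qm: "epi q" "mon m" "src q = src f" "tgt q = src m" "tgt m = tgt f" "m \<bullet> q = f"
    using image_factorization assms(2) by blast
  have "m \<noteq> zero_mor C (src m) T"
  proof
    assume "m = zero_mor C (src m) T"
    then have "m \<bullet> q = zero_mor C (src q) T"
      using comp_zero(1)[of q T "src m"] qm(1,4) assms(1) by simp
    then show False using assms(4) qm(3,6) by simp
  qed
  then have "iso m" using mon_to_simple_iso[OF assms(1), of m] qm assms by simp
  then have "epi m" using iso_mon_epi by blast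
  then show ?thesis using epi_comp[of q m] qm by simp
qed

end

section \<open>Semi-simple objects\<close>

context abelian_category
begin

definition to_simples :: "'a \<Rightarrow> 'b set \<Rightarrow> bool" where
  "to_simples A \<Phi> \<longleftrightarrow> A \<in> Ob C \<and> finite \<Phi> \<and>
     (\<forall>\<phi> \<in> \<Phi>. arrow \<phi> \<and> src \<phi> = A \<and> simple_object C (tgt \<phi>))"

definition jointly_monic :: "'a \<Rightarrow> 'b set \<Rightarrow> bool" where
  "jointly_monic A \<Phi> \<longleftrightarrow> (\<forall>x. arrow x \<longrightarrow> tgt x = A \<longrightarrow>
     (\<forall>\<phi> \<in> \<Phi>. \<phi> \<bullet> x = zero_mor C (src x) (tgt \<phi>)) \<longrightarrow> x = zero_mor C (src x) A)"

lemma jointly_monicD: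
  assumes "jointly_monic A \<Phi>" "arrow x" "tgt x = A"
    "\<And>\<phi>. \<phi> \<in> \<Phi> \<Longrightarrow> \<phi> \<bullet> x = zero_mor C (src x) (tgt \<phi>)"
  shows "x = zero_mor C (src x) A"
  using assms unfolding jointly_monic_def by blast

lemma to_simplesD:
  assumes "to_simples A \<Phi>" "\<phi> \<in> \<Phi>"
  shows "arrow \<phi>" "src \<phi> = A" "simple_object C (tgt \<phi>)"
  using assms unfolding to_simples_def by blast+

lemma jointly_monic_cancel:
  assumes "jointly_monic A \<Phi>" "\<And>\<phi>. \<phi> \<in> \<Phi> \<Longrightarrow> arrow \<phi> \<and> src \<phi> = A"
    and xy: "arrow x" "arrow y" "src x = src y" "tgt x = A" "tgt y = A"
    and eq: "\<And>\<phi>. \<phi> \<in> \<Phi> \<Longrightarrow> \<phi> \<bullet> x = \<phi> \<bullet> y"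
  shows "x = y"
proof -
  have "x \<^bold>- y = zero_mor C (src (x \<^bold>- y)) A"
  proof (rule jointly_monicD[OF assms(1)])
    fix \<phi> assume \<phi>: "\<phi> \<in> \<Phi>"
    then have a: "arrow \<phi>" "src \<phi> = A" using assms(2) by auto
    have "\<phi> \<bullet> (x \<^bold>- y) = \<phi> \<bullet> x \<^bold>- \<phi> \<bullet> y"
      by (rule comp_minus_left) (use a xy in simp_all)
    also have "\<dots> = zero_mor C (src (\<phi> \<bullet> y)) (tgt (\<phi> \<bullet> y))"
      using minus_eq_zero_iff[of "\<phi> \<bullet> x" "\<phi> \<bullet> y"] eq[OF \<phi>] a xy by simp
    finally show "\<phi> \<bullet> (x \<^bold>- y) = zero_mor C (src (x \<^bold>- y)) (tgt \<phi>)"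
      using a xy by simp
  qed (use xy in simp_all)
  then show ?thesis using minus_eq_zero_iff[of x y] xy by simp
qed

lemma direct_sum_jointly_monic:
  assumes "is_direct_sum C m T S \<iota> \<pi>"
  shows "jointly_monic S (\<pi> ` {..<m})"
  unfolding jointly_monic_def
proof (intro allI impI)
  fix x assume x: "arrow x" "tgt x = S" "\<forall>\<phi> \<in> \<pi> ` {..<m}. \<phi> \<bullet> x = zero_mor C (src x) (tgt \<phi>)"
  show "x = zero_mor C (src x) S"
  proof (rule direct_sum_zero[OF assms x(1,2)])
    fix j assume "j < m"
    then show "\<pi> j \<bullet> x = zero_mor C (src x) (T j)"
      using x(3) direct_sumD(2)[OF assms, of j] by auto
  qed
qed

text \<open>In a jointly monic family of minimal size each \<open>\<psi>\<close> is nonzero on the common kernel of the others, and this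
  common kernel is embedded by \<open>\<psi>\<close> into a simple object; so it is a copy of the target of \<open>\<psi>\<close>,
  and these copies are the summands. The family is taken on an ambient object \<open>A\<close> and
  restricted along \<open>n\<close>, so that the projections of the direct sum extend to \<open>A\<close>.\<close>

lemma direct_sum_if_jointly_monic:
  assumes \<Phi>: "to_simples A \<Phi>" and n: "arrow n" "tgt n = A"
    and jm: "jointly_monic (src n) ((\<lambda>\<phi>. \<phi> \<bullet> n) ` \<Phi>)"
  obtains m T \<iota> \<pi> \<psi> where "is_direct_sum C m T (src n) \<iota> \<pi>"
    "\<And>j. j < m \<Longrightarrow> simple_object C (T j)"
    "\<And>j. j < m \<Longrightarrow> arr (\<psi> j) A (T j) \<and> \<pi> j = \<psi> j \<bullet> n"
proof -
  define K where "K = src n"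
  have K: "K \<in> Ob C" unfolding K_def using n by simp
  let ?P = "\<lambda>\<Psi>. \<Psi> \<subseteq> \<Phi> \<and> jointly_monic K ((\<lambda>\<phi>. \<phi> \<bullet> n) ` \<Psi>)"
  have "?P \<Phi>" using jm unfolding K_def by simp
  then obtain \<Psi> where \<Psi>: "?P \<Psi>" and min: "\<And>\<Theta>. ?P \<Theta> \<Longrightarrow> card \<Psi> \<le> card \<Theta>"
    using ex_has_least_nat[of ?P \<Phi> card] by blast
  have fin: "finite \<Psi>" using \<Psi> \<Phi> unfolding to_simples_def by (meson finite_subset)
  have \<Psi>s: "arrow \<psi>" "src \<psi> = A" "simple_object C (tgt \<psi>)" if "\<psi> \<in> \<Psi>" for \<psi>
    using that \<Psi> to_simplesD[OF \<Phi>, of \<psi>] by auto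
  have \<Psi>n: "arrow (\<psi> \<bullet> n)" "src (\<psi> \<bullet> n) = K" "tgt (\<psi> \<bullet> n) = tgt \<psi>" if "\<psi> \<in> \<Psi>" for \<psi>
    using \<Psi>s[OF that] n unfolding K_def by simp_all
  have "\<exists>i. arr i (tgt \<psi>) K \<and> (\<psi> \<bullet> n) \<bullet> i = ident C (tgt \<psi>) \<and>
      (\<forall>\<phi> \<in> \<Psi> - {\<psi>}. (\<phi> \<bullet> n) \<bullet> i = zero_mor C (tgt \<psi>) (tgt \<phi>))" if \<psi>: "\<psi> \<in> \<Psi>" for \<psi>
  proof -
    have "card (\<Psi> - {\<psi>}) < card \<Psi>" using \<psi> fin by (meson card_Diff1_less)
    then have "\<not> ?P (\<Psi> - {\<psi>})" using min[of "\<Psi> - {\<psi>}"] by linarith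
    moreover have "\<Psi> - {\<psi>} \<subseteq> \<Phi>" using \<Psi> by blast
    ultimately have "\<not> jointly_monic K ((\<lambda>\<phi>. \<phi> \<bullet> n) ` (\<Psi> - {\<psi>}))" by simp
    \<comment> \<open>The image \<open>j\<close> of \<open>x\<close> lies in the common kernel of the other members and turns out to be simple.\<close>
    then obtain x where x: "arrow x" "tgt x = K" "x \<noteq> zero_mor C (src x) K"
      and kill': "\<forall>\<phi> \<in> (\<lambda>\<phi>. \<phi> \<bullet> n) ` (\<Psi> - {\<psi>}). \<phi> \<bullet> x = zero_mor C (src x) (tgt \<phi>)"
      unfolding jointly_monic_def by blast
    have kill: "(\<phi> \<bullet> n) \<bullet> x = zero_mor C (src x) (tgt \<phi>)" if "\<phi> \<in> \<Psi> - {\<psi>}" for \<phi>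
      using kill' that \<Psi>n(3)[of \<phi>] by auto
    obtain q j where qj: "epi q" "mon j" "src q = src x" "tgt q = src j" "tgt j = tgt x" "j \<bullet> q = x"
      using image_factorization[OF x(1)] by blast
    have jo: "src j \<in> Ob C" using qj by simp
    have kj: "(\<phi> \<bullet> n) \<bullet> j = zero_mor C (src j) (tgt \<phi>)" if \<phi>: "\<phi> \<in> \<Psi> - {\<psi>}" for \<phi>
    proof (rule epi_cancel[OF qj(1)])
      have p: "\<phi> \<in> \<Psi>" using \<phi> by blast
      have "((\<phi> \<bullet> n) \<bullet> j) \<bullet> q = (\<phi> \<bullet> n) \<bullet> (j \<bullet> q)"
        by (rule assoc) (use \<Psi>n[OF p] qj x in simp_all)
      also have "\<dots> = zero_mor C (src x) (tgt \<phi>)" using kill[OF \<phi>] qj by simp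
      also have "\<dots> = zero_mor C (src j) (tgt \<phi>) \<bullet> q"
        using qj \<Psi>s[OF p] by simp
      finally show "((\<phi> \<bullet> n) \<bullet> j) \<bullet> q = zero_mor C (src j) (tgt \<phi>) \<bullet> q" .
    qed (use \<Psi>n[of \<phi>] \<Psi>s[of \<phi>] \<phi> qj x jo in simp_all)
    let ?t = "(\<psi> \<bullet> n) \<bullet> j"
    have t: "arrow ?t" "src ?t = src j" "tgt ?t = tgt \<psi>"
      using \<Psi>n[OF \<psi>] qj x by (simp_all del: assoc)
    have "mon ?t" unfolding mon_def
    proof (intro conjI allI impI t(1))
      fix y assume y: "arrow y" "tgt y = src ?t" "?t \<bullet> y = zero_mor C (src y) (tgt ?t)"
      have jy: "arrow (j \<bullet> y)" "src (j \<bullet> y) = src y" "tgt (j \<bullet> y) = K"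
        using qj x y t by simp_all
      have "j \<bullet> y = zero_mor C (src (j \<bullet> y)) K"
      proof (rule jointly_monicD[of K "(\<lambda>\<phi>. \<phi> \<bullet> n) ` \<Psi>"])
        fix \<theta> assume "\<theta> \<in> (\<lambda>\<phi>. \<phi> \<bullet> n) ` \<Psi>"
        then obtain \<phi> where \<phi>: "\<phi> \<in> \<Psi>" "\<theta> = \<phi> \<bullet> n" by blast
        have "\<theta> \<bullet> (j \<bullet> y) = (\<theta> \<bullet> j) \<bullet> y"
          by (rule assoc[symmetric]) (use \<Psi>n[OF \<phi>(1)] \<phi>(2) qj x y t in simp_all)
        also have "\<dots> = zero_mor C (src y) (tgt \<phi>)"
        proof (cases "\<phi> = \<psi>")
          case True
          then show ?thesis using y(3) t \<phi> by simp
        next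
          case False
          then have "\<theta> \<bullet> j = zero_mor C (src j) (tgt \<phi>)" using kj[of \<phi>] \<phi> by blast
          then show ?thesis using y t \<Psi>s[OF \<phi>(1)] by simp
        qed
        finally show "\<theta> \<bullet> (j \<bullet> y) = zero_mor C (src (j \<bullet> y)) (tgt \<theta>)"
          using jy \<Psi>n[OF \<phi>(1)] \<phi>(2) by simp
      qed (use \<Psi> jy in simp_all)
      then have "y = zero_mor C (src y) (src j)"
        using monD[OF qj(2), of y] y t qj x jy by simp
      then show "y = zero_mor C (src y) (src ?t)" using t by simp
    qed
    moreover have "?t \<noteq> zero_mor C (src ?t) (tgt \<psi>)"
    proof
      assume z: "?t = zero_mor C (src ?t) (tgt \<psi>)"
      have "x = zero_mor C (src x) K"
      proof (rule jointly_monicD[of K "(\<lambda>\<phi>. \<phi> \<bullet> n) ` \<Psi>"])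
        fix \<theta> assume "\<theta> \<in> (\<lambda>\<phi>. \<phi> \<bullet> n) ` \<Psi>"
        then obtain \<phi> where \<phi>: "\<phi> \<in> \<Psi>" "\<theta> = \<phi> \<bullet> n" by blast
        show "\<theta> \<bullet> x = zero_mor C (src x) (tgt \<theta>)"
        proof (cases "\<phi> = \<psi>")
          case True
          have "\<theta> \<bullet> x = (\<theta> \<bullet> j) \<bullet> q"
            using assoc[of q j \<theta>] \<Psi>n[OF \<phi>(1)] \<phi>(2) qj x by (simp del: assoc)
          also have "\<dots> = zero_mor C (src j) (tgt \<psi>) \<bullet> q" using z t \<phi> True by simp
          also have "\<dots> = zero_mor C (src x) (tgt \<theta>)"
            using qj \<Psi>s[OF \<phi>(1)] \<Psi>n[OF \<phi>(1)] \<phi> True by simp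
          finally show ?thesis .
        next
          case False
          then show ?thesis using kill[of \<phi>] \<phi> \<Psi>n[OF \<phi>(1)] by simp
        qed
      qed (use \<Psi> x in simp_all)
      then show False using x by blast
    qed
    ultimately have "iso ?t" using mon_to_simple_iso[OF \<Psi>s(3)[OF \<psi>]] t by blast
    then obtain g where g: "arrow g" "src g = tgt \<psi>" "tgt g = src j" "?t \<bullet> g = ident C (tgt \<psi>)"
      using isoD[of ?t] t by metis
    have jg: "arrow (j \<bullet> g)" "src (j \<bullet> g) = tgt \<psi>" "tgt (j \<bullet> g) = K" using g qj x by simp_all
    have "(\<phi> \<bullet> n) \<bullet> (j \<bullet> g) = ((\<phi> \<bullet> n) \<bullet> j) \<bullet> g" if "\<phi> \<in> \<Psi>" for \<phi>
      by (rule assoc[symmetric]) (use \<Psi>n[OF that] g qj x in simp_all)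
    moreover have "zero_mor C (src j) (tgt \<phi>) \<bullet> g = zero_mor C (tgt \<psi>) (tgt \<phi>)" if "\<phi> \<in> \<Psi>" for \<phi>
      using g \<Psi>s[OF that] by simp
    ultimately show ?thesis
      using jg g(4) kj \<psi> K \<Psi>s(1)[OF \<psi>] by (intro exI[of _ "j \<bullet> g"]) (simp del: assoc)
  qed
  then have "\<forall>\<psi>\<in>\<Psi>. \<exists>i. arr i (tgt \<psi>) K \<and> (\<psi> \<bullet> n) \<bullet> i = ident C (tgt \<psi>) \<and>
      (\<forall>\<phi> \<in> \<Psi> - {\<psi>}. (\<phi> \<bullet> n) \<bullet> i = zero_mor C (tgt \<psi>) (tgt \<phi>))" by blast
  then obtain i where i: "\<forall>\<psi>\<in>\<Psi>. arr (i \<psi>) (tgt \<psi>) K \<and> (\<psi> \<bullet> n) \<bullet> i \<psi> = ident C (tgt \<psi>) \<and>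
      (\<forall>\<phi> \<in> \<Psi> - {\<psi>}. (\<phi> \<bullet> n) \<bullet> i \<psi> = zero_mor C (tgt \<psi>) (tgt \<phi>))"
    by (rule bchoice[THEN exE])
  obtain e where e: "bij_betw e {..<card \<Psi>} \<Psi>"
    using ex_bij_betw_nat_finite[OF fin] by (auto simp: atLeast0LessThan)
  define m where "m = card \<Psi>"
  have e\<Psi>: "e j \<in> \<Psi>" if "j < m" for j using e that unfolding m_def bij_betw_def by auto
  have einj: "e j \<noteq> e k" if "j < m" "k < m" "j \<noteq> k" for j k
    using e that unfolding m_def bij_betw_def inj_on_def by auto
  have esurj: "\<exists>j<m. \<psi> = e j" if "\<psi> \<in> \<Psi>" for \<psi>
    using e that unfolding m_def bij_betw_def by auto
  define \<iota> where "\<iota> = (\<lambda>j. i (e j))"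
  define \<pi> where "\<pi> = (\<lambda>j. e j \<bullet> n)"
  define T where "T = (\<lambda>j. tgt (e j))"
  have \<iota>: "arrow (\<iota> j)" "src (\<iota> j) = T j" "tgt (\<iota> j) = K" if "j < m" for j
    unfolding \<iota>_def T_def using i e\<Psi>[OF that] by auto
  have \<pi>: "arrow (\<pi> j)" "src (\<pi> j) = K" "tgt (\<pi> j) = T j" if "j < m" for j
    unfolding \<pi>_def T_def using \<Psi>n[OF e\<Psi>[OF that]] by auto
  have T: "simple_object C (T j)" if "j < m" for j
    unfolding T_def using \<Psi>s(3)[OF e\<Psi>[OF that]] .
  have \<pi>\<iota>: "\<pi> j \<bullet> \<iota> k = (if j = k then ident C (T j) else zero_mor C (T k) (T j))"
    if "j < m" "k < m" for j k
    unfolding \<pi>_def \<iota>_def T_def using i e\<Psi>[OF that(1)] e\<Psi>[OF that(2)] einj[OF that] by auto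
  have \<iota>\<pi>: "arr (\<iota> j \<bullet> \<pi> j) K K" if "j \<in> {..<m}" for j
    using that \<iota>[of j] \<pi>[of j] K by auto
  let ?s = "\<Oplus>\<^bsub>Hom C K K\<^esub>j\<in>{..<m}. \<iota> j \<bullet> \<pi> j"
  have s: "arr ?s K K" using K K \<iota>\<pi> by (rule arr_finsum)
  have "\<pi> k \<bullet> ?s = \<pi> k" if k: "k < m" for k
  proof -
    have "\<pi> k \<bullet> ?s = (\<Oplus>\<^bsub>Hom C K (tgt (\<pi> k))\<^esub>j\<in>{..<m}. \<pi> k \<bullet> (\<iota> j \<bullet> \<pi> j))"
      by (rule comp_finsum_left) (use \<pi>[OF k] K \<iota>\<pi> in auto)
    also have "\<dots> = \<pi> k"
    proof (rule finsum_single)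
      show "arr (\<pi> k) K (tgt (\<pi> k))" using \<pi>[OF k] K T[OF k] by simp
      fix j assume "j \<in> {..<m}"
      then have j: "j < m" by simp
      have "\<pi> k \<bullet> (\<iota> j \<bullet> \<pi> j) = (\<pi> k \<bullet> \<iota> j) \<bullet> \<pi> j"
        by (rule assoc[symmetric]) (use \<pi>[OF k] \<pi>[OF j] \<iota>[OF j] in simp_all)
      then show "\<pi> k \<bullet> (\<iota> j \<bullet> \<pi> j) = (if j = k then \<pi> k else zero_mor C K (tgt (\<pi> k)))"
        using \<pi>\<iota>[OF k j] \<pi>[OF k] \<pi>[OF j] T[OF k] by simp
    qed (use k in simp_all)
    finally show ?thesis .
  qed
  note \<pi>s = this
  have "?s = ident C K"
  proof (rule jointly_monic_cancel[of K "(\<lambda>\<phi>. \<phi> \<bullet> n) ` \<Psi>"])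
    fix \<theta> assume "\<theta> \<in> (\<lambda>\<phi>. \<phi> \<bullet> n) ` \<Psi>"
    then obtain \<psi> where \<psi>: "\<psi> \<in> \<Psi>" "\<theta> = \<psi> \<bullet> n" by blast
    then show "arrow \<theta> \<and> src \<theta> = K" using \<Psi>n by simp
    obtain k where k: "k < m" "\<psi> = e k" using esurj[OF \<psi>(1)] by blast
    then have "\<theta> = \<pi> k" using \<psi> unfolding \<pi>_def by simp
    then show "\<theta> \<bullet> ?s = \<theta> \<bullet> ident C K" using \<pi>s[OF k(1)] \<pi>[OF k(1)] by simp
  qed (use \<Psi> s K in simp_all)
  then have "is_direct_sum C m T K \<iota> \<pi>"
    unfolding is_direct_sum_def using K T \<iota> \<pi> \<pi>\<iota> by (simp add: mor_iff)
  moreover have "arr (e j) A (T j) \<and> \<pi> j = e j \<bullet> n" if "j < m" for j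
    using \<Psi>s[OF e\<Psi>[OF that]] T[OF that] n unfolding \<pi>_def T_def by auto
  ultimately show ?thesis using that[of m T \<iota> \<pi> e] T unfolding K_def by blast
qed

lemma semisimple_iff_jointly_monic:
  "semisimple_object C A \<longleftrightarrow> (\<exists>\<Phi>. to_simples A \<Phi> \<and> jointly_monic A \<Phi>)"
proof
  assume "semisimple_object C A"
  then obtain m T \<iota> \<pi> where T: "\<forall>j<m. simple_object C (T j)" and d: "is_direct_sum C m T A \<iota> \<pi>"
    unfolding semisimple_object_def by blast
  have "to_simples A (\<pi> ` {..<m})"
    unfolding to_simples_def using T direct_sumD(1,2)[OF d] by auto
  then show "\<exists>\<Phi>. to_simples A \<Phi> \<and> jointly_monic A \<Phi>"
    using direct_sum_jointly_monic[OF d] by blast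
next
  assume "\<exists>\<Phi>. to_simples A \<Phi> \<and> jointly_monic A \<Phi>"
  then obtain \<Phi> where \<Phi>: "to_simples A \<Phi>" "jointly_monic A \<Phi>" by blast
  then have A: "A \<in> Ob C" unfolding to_simples_def by blast
  have "(\<lambda>\<phi>. \<phi> \<bullet> ident C A) ` \<Phi> = \<Phi>"
    using to_simplesD[OF \<Phi>(1)] by (auto simp: image_iff)
  then obtain m T \<iota> \<pi> where "is_direct_sum C m T A \<iota> \<pi>" "\<And>j. j < m \<Longrightarrow> simple_object C (T j)"
    using direct_sum_if_jointly_monic[OF \<Phi>(1), of "ident C A"] \<Phi>(2) A by (metis arrow_ident)
  then show "semisimple_object C A" unfolding semisimple_object_def by blast
qed

lemma semisimple_subobject:
  assumes n: "mon n" and ss: "semisimple_object C (tgt n)"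
  shows "semisimple_object C (src n)"
    and "\<exists>r. arr r (tgt n) (src n) \<and> r \<bullet> n = ident C (src n)"
proof -
  let ?A = "tgt n"
  obtain \<Phi> where \<Phi>: "to_simples ?A \<Phi>" "jointly_monic ?A \<Phi>"
    using ss unfolding semisimple_iff_jointly_monic by blast
  have "jointly_monic (src n) ((\<lambda>\<phi>. \<phi> \<bullet> n) ` \<Phi>)"
    unfolding jointly_monic_def
  proof (intro allI impI)
    fix x assume x: "arrow x" "tgt x = src n"
      "\<forall>\<phi> \<in> (\<lambda>\<phi>. \<phi> \<bullet> n) ` \<Phi>. \<phi> \<bullet> x = zero_mor C (src x) (tgt \<phi>)"
    have "n \<bullet> x = zero_mor C (src (n \<bullet> x)) ?A"
    proof (rule jointly_monicD[OF \<Phi>(2)])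
      fix \<phi> assume \<phi>: "\<phi> \<in> \<Phi>"
      then have "(\<phi> \<bullet> n) \<bullet> x = zero_mor C (src x) (tgt (\<phi> \<bullet> n))" using x(3) by blast
      then show "\<phi> \<bullet> (n \<bullet> x) = zero_mor C (src (n \<bullet> x)) (tgt \<phi>)"
        using to_simplesD[OF \<Phi>(1) \<phi>] x n by simp
    qed (use x n in simp_all)
    then show "x = zero_mor C (src x) (src n)" using monD[OF n, of x] x n by simp
  qed
  then obtain m T \<iota> \<pi> \<psi> where d: "is_direct_sum C m T (src n) \<iota> \<pi>"
    and T: "\<And>j. j < m \<Longrightarrow> simple_object C (T j)"
    and \<psi>: "\<And>j. j < m \<Longrightarrow> arr (\<psi> j) ?A (T j) \<and> \<pi> j = \<psi> j \<bullet> n"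
    using direct_sum_if_jointly_monic[OF \<Phi>(1) mon_arrow[OF n] refl] by blast
  show "semisimple_object C (src n)" unfolding semisimple_object_def using d T by blast
  have A: "?A \<in> Ob C" using n by simp
  have \<psi>': "\<And>j. j < m \<Longrightarrow> arr (\<psi> j) ?A (T j)" using \<psi> by blast
  obtain r where r: "arrow r" "src r = ?A" "tgt r = src n" "\<And>j. j < m \<Longrightarrow> \<pi> j \<bullet> r = \<psi> j"
    using direct_sum_pairing[OF d A \<psi>'] by blast
  have "r \<bullet> n = ident C (src n)"
  proof (rule jointly_monic_cancel[OF direct_sum_jointly_monic[OF d]])
    fix \<phi> assume "\<phi> \<in> \<pi> ` {..<m}"
    then obtain j where j: "j < m" "\<phi> = \<pi> j" by blast
    have "\<pi> j \<bullet> (r \<bullet> n) = \<psi> j \<bullet> n"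
      by (rule comp_reduce[OF r(4)[OF j(1)]]) (use direct_sumD(2)[OF d j(1)] r n in simp_all)
    then show "\<phi> \<bullet> (r \<bullet> n) = \<phi> \<bullet> ident C (src n)"
      using \<psi>[OF j(1)] direct_sumD(2)[OF d j(1)] j n by simp
  next
    fix \<phi> assume "\<phi> \<in> \<pi> ` {..<m}"
    then show "arrow \<phi> \<and> src \<phi> = src n" using direct_sumD(2)[OF d] by auto
  qed (use r n in simp_all)
  then show "\<exists>r. arr r (tgt n) (src n) \<and> r \<bullet> n = ident C (src n)"
    using r n by (intro exI[of _ r]) simp
qed

text \<open>The kernel of an epimorphism from a semi-simple object has a retraction, so the epimorphism
  splits and its target is also a subobject.\<close>

lemma semisimple_quotient:
  assumes q: "epi q" and ss: "semisimple_object C (src q)"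
  shows "semisimple_object C (tgt q)"
proof -
  obtain n where n: "kernel q n" using kernel_exists[OF epi_arrow[OF q]] by blast
  note ns = kernelD[OF n]
  obtain r where r: "arr r (tgt n) (src n)" and rn: "r \<bullet> n = ident C (src n)"
    using semisimple_subobject(2)[OF ns(2)] ss ns(4) by auto
  have r': "arrow r" "src r = src q" "tgt r = src n" using r ns by auto
  let ?p = "ident C (src q) \<^bold>- n \<bullet> r"
  have p: "arrow ?p" "src ?p = src q" "tgt ?p = src q" using r' ns by simp_all
  have "?p \<bullet> n = ident C (src q) \<bullet> n \<^bold>- (n \<bullet> r) \<bullet> n"
    by (rule comp_minus_right) (use r' ns in simp_all)
  also have "(n \<bullet> r) \<bullet> n = n" using rn r' ns by simp
  also have "ident C (src q) \<bullet> n \<^bold>- n = zero_mor C (src n) (tgt n)"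
    using minus_eq_zero_iff[of "ident C (src q) \<bullet> n" n] ns by simp
  finally have "?p \<bullet> n = zero_mor C (src n) (tgt ?p)" using p ns by simp
  then obtain s where s: "arrow s" "src s = tgt q" "tgt s = tgt ?p" "s \<bullet> q = ?p"
    using cokernel_lift[OF cokernel_of_kernel[OF q n], of ?p] p ns by auto
  have "(q \<bullet> s) \<bullet> q = q \<bullet> ?p" using s p q by simp
  also have "\<dots> = q \<bullet> ident C (src q) \<^bold>- q \<bullet> (n \<bullet> r)"
    by (rule comp_minus_left) (use r' ns in simp_all)
  also have "q \<bullet> (n \<bullet> r) = zero_mor C (src n) (tgt q) \<bullet> r"
    by (rule comp_reduce[OF ns(5)]) (use r' ns in simp_all)
  also have "q \<bullet> ident C (src q) \<^bold>- zero_mor C (src n) (tgt q) \<bullet> r = ident C (tgt q) \<bullet> q"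
    using q r' by simp
  finally have "q \<bullet> s = ident C (tgt q)" by (rule epi_cancel[OF q]) (use q s p in simp_all)
  then have "mon s" using mon_if_left_inverse[of s q] s p q by simp
  then show ?thesis using semisimple_subobject(1)[of s] ss s p by simp
qed

text \<open>Modulo the common kernel of a family, the family becomes jointly monic.\<close>

lemma coimage_semisimple:
  assumes \<Phi>: "to_simples A \<Phi>" and k: "joint_kernel A \<Phi> k" and c: "cokernel k c"
  shows "semisimple_object C (tgt c)"
proof -
  note ks = joint_kernelD[OF k] and cs = cokernelD[OF c]
  have "\<exists>\<phi>'. arr \<phi>' (tgt c) (tgt \<phi>) \<and> \<phi>' \<bullet> c = \<phi>" if \<phi>: "\<phi> \<in> \<Phi>" for \<phi>
  proof -
    note p = to_simplesD[OF \<Phi> \<phi>]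
    obtain u where "arrow u" "src u = tgt c" "tgt u = tgt \<phi>" "u \<bullet> c = \<phi>"
      using cokernel_lift[OF c, of \<phi>] p ks(3) ks(4)[OF \<phi>] by auto
    then show ?thesis using p cs by (intro exI[of _ u]) simp
  qed
  then have "\<forall>\<phi>\<in>\<Phi>. \<exists>\<phi>'. arr \<phi>' (tgt c) (tgt \<phi>) \<and> \<phi>' \<bullet> c = \<phi>" by blast
  then obtain d where d: "\<forall>\<phi>\<in>\<Phi>. arr (d \<phi>) (tgt c) (tgt \<phi>) \<and> d \<phi> \<bullet> c = \<phi>"
    by (rule bchoice[THEN exE])
  have "to_simples (tgt c) (d ` \<Phi>)"
    using \<Phi> d cs(3) unfolding to_simples_def by auto
  moreover have "jointly_monic (tgt c) (d ` \<Phi>)" unfolding jointly_monic_def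
  proof (intro allI impI)
    fix x assume x: "arrow x" "tgt x = tgt c"
      "\<forall>\<phi>\<in>d ` \<Phi>. \<phi> \<bullet> x = zero_mor C (src x) (tgt \<phi>)"
    obtain e y where e: "epi e" "arrow y" "src y = src e" "tgt e = src x" "tgt y = src c" "c \<bullet> y = x \<bullet> e"
      using epi_lift[OF cs(2) x(1,2)] by blast
    have "\<phi> \<bullet> y = zero_mor C (src y) (tgt \<phi>)" if \<phi>: "\<phi> \<in> \<Phi>" for \<phi>
    proof -
      have dp: "arrow (d \<phi>)" "src (d \<phi>) = tgt c" "tgt (d \<phi>) = tgt \<phi>" "d \<phi> \<bullet> c = \<phi>"
        using d \<phi> by auto
      have "\<phi> \<bullet> y = d \<phi> \<bullet> (c \<bullet> y)" using assoc[of y c "d \<phi>"] dp e cs by simp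
      also have "\<dots> = (d \<phi> \<bullet> x) \<bullet> e" using dp e x by simp
      also have "d \<phi> \<bullet> x = zero_mor C (src x) (tgt \<phi>)" using x(3) \<phi> dp by auto
      finally show ?thesis using e to_simplesD[OF \<Phi> \<phi>] by simp
    qed
    then obtain u where u: "arrow u" "src u = src y" "tgt u = src k" "k \<bullet> u = y"
      using joint_kernel_lift[OF k, of y] e cs ks by auto
    have "x \<bullet> e = c \<bullet> (k \<bullet> u)" using e u by simp
    also have "\<dots> = zero_mor C (src k) (tgt c) \<bullet> u"
      by (rule comp_reduce[OF cs(5)]) (use cs u ks in simp_all)
    also have "\<dots> = zero_mor C (src e) (tgt x)" using u e x cs by simp
    finally show "x = zero_mor C (src x) (tgt c)" using epiD[OF e(1), of x] e x by simp
  qed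
  ultimately show ?thesis unfolding semisimple_iff_jointly_monic by blast
qed

section \<open>Loewy length\<close>

text \<open>Loewy length at most \<open>j\<close>, with Loewy length \<open>0\<close> for zero objects, that is, shifted by one against
  the convention in which the semi-simple objects have length \<open>0\<close>. The steps of the filtration are
  common kernels of finite families of morphisms to simple objects; in this form they can be
  intersected, pulled back and restricted without mentioning their quotients.\<close>

primrec loewy_le :: "nat \<Rightarrow> 'a \<Rightarrow> bool" where
  "loewy_le 0 A \<longleftrightarrow> zero_object C A"
| "loewy_le (Suc j) A \<longleftrightarrow> (\<exists>\<Phi> k. to_simples A \<Phi> \<and> joint_kernel A \<Phi> k \<and> loewy_le j (src k))"

lemma loewy_le_Ob: "loewy_le j A \<Longrightarrow> A \<in> Ob C"
  by (cases j) (auto simp: zero_object_def to_simples_def)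

lemma loewy_le_Suc:
  assumes "loewy_le j A"
  shows "loewy_le (Suc j) A"
proof -
  have A: "A \<in> Ob C" using loewy_le_Ob[OF assms] .
  have "to_simples A {}" "joint_kernel A {} (ident C A)"
    unfolding to_simples_def joint_kernel_def using A iso_mon_epi(2)[OF iso_ident[OF A]] by auto
  moreover have "loewy_le j (src (ident C A))" using assms A by simp
  ultimately show ?thesis by auto
qed

text \<open>For a single monomorphism this is the passage to subobjects, for the projections of a direct sum
  the closure under direct sums. The filtrations of the targets are pulled back and intersected.\<close>

lemma loewy_le_jointly_monic:
  assumes "finite \<Xi>" "A \<in> Ob C" "\<And>p. p \<in> \<Xi> \<Longrightarrow> arrow p \<and> src p = A \<and> loewy_le j (tgt p)"
    "jointly_monic A \<Xi>"
  shows "loewy_le j A"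
  using assms
proof (induction j arbitrary: A \<Xi>)
  case 0
  have "ident C A = zero_mor C (src (ident C A)) A"
  proof (rule jointly_monicD[OF 0(4)])
    fix p assume "p \<in> \<Xi>"
    then have p: "arrow p" "src p = A" "zero_object C (tgt p)" using 0(3)[of p] by auto
    then show "p \<bullet> ident C A = zero_mor C (src (ident C A)) (tgt p)"
      using zero_objectD(2)[OF p(3,1)] 0(2) by simp
  qed (use 0 in simp_all)
  then show ?case using zero_object_iff[OF 0(2)] 0(2) by simp
next
  case (Suc j)
  have "\<forall>p\<in>\<Xi>. \<exists>\<Phi>k. to_simples (tgt p) (fst \<Phi>k) \<and> joint_kernel (tgt p) (fst \<Phi>k) (snd \<Phi>k) \<and> loewy_le j (src (snd \<Phi>k))"
    using Suc.prems(3) by auto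
  then obtain \<Phi>k where \<Phi>k: "\<forall>p\<in>\<Xi>. to_simples (tgt p) (fst (\<Phi>k p)) \<and>
      joint_kernel (tgt p) (fst (\<Phi>k p)) (snd (\<Phi>k p)) \<and> loewy_le j (src (snd (\<Phi>k p)))"
    by (rule bchoice[THEN exE])
  define \<Phi> where "\<Phi> = (\<lambda>p. fst (\<Phi>k p))"
  define \<kappa> where "\<kappa> = (\<lambda>p. snd (\<Phi>k p))"
  have \<Phi>: "to_simples (tgt p) (\<Phi> p)" "joint_kernel (tgt p) (\<Phi> p) (\<kappa> p)" "loewy_le j (src (\<kappa> p))"
    if "p \<in> \<Xi>" for p unfolding \<Phi>_def \<kappa>_def using \<Phi>k that by auto
  have p: "arrow p" "src p = A" if "p \<in> \<Xi>" for p using Suc.prems(3)[OF that] by auto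
  define \<Theta> where "\<Theta> = (\<Union>p\<in>\<Xi>. (\<lambda>\<phi>. \<phi> \<bullet> p) ` \<Phi> p)"
  have \<Theta>: "to_simples A \<Theta>" unfolding to_simples_def
  proof (intro conjI ballI)
    show "finite \<Theta>" unfolding \<Theta>_def using Suc.prems(1) \<Phi>(1) unfolding to_simples_def by blast
    fix \<theta> assume "\<theta> \<in> \<Theta>"
    then obtain p' \<phi> where t: "p' \<in> \<Xi>" "\<phi> \<in> \<Phi> p'" "\<theta> = \<phi> \<bullet> p'" unfolding \<Theta>_def by blast
    show "arrow \<theta>" "src \<theta> = A" "simple_object C (tgt \<theta>)"
      using t p[OF t(1)] to_simplesD[OF \<Phi>(1)[OF t(1)] t(2)] by auto
  qed (use Suc.prems in simp)
  obtain k where k: "joint_kernel A \<Theta> k"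
    using joint_kernel_exists[of \<Theta> A] \<Theta> unfolding to_simples_def by blast
  note ks = joint_kernelD[OF k]
  have "\<exists>u. arr u (src k) (src (\<kappa> p')) \<and> \<kappa> p' \<bullet> u = p' \<bullet> k" if p': "p' \<in> \<Xi>" for p'
  proof -
    note ps = p[OF p']
    have "\<phi> \<bullet> (p' \<bullet> k) = zero_mor C (src (p' \<bullet> k)) (tgt \<phi>)" if \<phi>: "\<phi> \<in> \<Phi> p'" for \<phi>
    proof -
      note s = to_simplesD[OF \<Phi>(1)[OF p'] \<phi>]
      have "\<phi> \<bullet> p' \<in> \<Theta>" unfolding \<Theta>_def using p' \<phi> by blast
      then have "(\<phi> \<bullet> p') \<bullet> k = zero_mor C (src k) (tgt (\<phi> \<bullet> p'))" using ks(4) by blast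
      then show ?thesis using s ps ks by simp
    qed
    then obtain u where "arrow u" "src u = src (p' \<bullet> k)" "tgt u = src (\<kappa> p')" "\<kappa> p' \<bullet> u = p' \<bullet> k"
      using joint_kernel_lift[OF \<Phi>(2)[OF p'], of "p' \<bullet> k"] ps ks by auto
    then show ?thesis using ps ks loewy_le_Ob[OF \<Phi>(3)[OF p']] by (intro exI[of _ u]) simp
  qed
  then have "\<forall>p\<in>\<Xi>. \<exists>u. arr u (src k) (src (\<kappa> p)) \<and> \<kappa> p \<bullet> u = p \<bullet> k" by blast
  then obtain u where u: "\<forall>p\<in>\<Xi>. arr (u p) (src k) (src (\<kappa> p)) \<and> \<kappa> p \<bullet> u p = p \<bullet> k"
    by (rule bchoice[THEN exE])
  have "loewy_le j (src k)"
  proof (rule Suc.IH[of "u ` \<Xi>"])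
    show "finite (u ` \<Xi>)" using Suc.prems by simp
    show "src k \<in> Ob C" using ks by simp
    show "arrow v \<and> src v = src k \<and> loewy_le j (tgt v)" if "v \<in> u ` \<Xi>" for v
      using that u \<Phi>(3) by auto
    show "jointly_monic (src k) (u ` \<Xi>)" unfolding jointly_monic_def
    proof (intro allI impI)
      fix x assume x: "arrow x" "tgt x = src k" "\<forall>v\<in>u ` \<Xi>. v \<bullet> x = zero_mor C (src x) (tgt v)"
      have "k \<bullet> x = zero_mor C (src (k \<bullet> x)) A"
      proof (rule jointly_monicD[OF Suc.prems(4)])
        fix p' assume p': "p' \<in> \<Xi>"
        have up: "arrow (u p')" "src (u p') = src k" "tgt (u p') = src (\<kappa> p')" "\<kappa> p' \<bullet> u p' = p' \<bullet> k"
          using u p' by auto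
        note kp = joint_kernelD(2,3)[OF \<Phi>(2)[OF p']]
        have "p' \<bullet> (k \<bullet> x) = (p' \<bullet> k) \<bullet> x" using p[OF p'] ks x by simp
        also have "\<dots> = \<kappa> p' \<bullet> (u p' \<bullet> x)"
          using assoc[of x "u p'" "\<kappa> p'"] up kp x by (simp del: assoc)
        also have "u p' \<bullet> x = zero_mor C (src x) (src (\<kappa> p'))" using x(3) p' up by auto
        finally show "p' \<bullet> (k \<bullet> x) = zero_mor C (src (k \<bullet> x)) (tgt p')"
          using kp x ks by simp
      qed (use x ks in simp_all)
      then show "x = zero_mor C (src x) (src k)" using monD[OF ks(1), of x] x ks by simp
    qed
  qed
  then show ?case using \<Theta> k by auto
qed

lemma loewy_le_subobject:
  assumes "mon u" "loewy_le j (tgt u)"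
  shows "loewy_le j (src u)"
proof (rule loewy_le_jointly_monic[of "{u}"])
  show "jointly_monic (src u) {u}"
    unfolding jointly_monic_def using monD[OF assms(1)] by auto
qed (use assms in auto)

lemma loewy_le_kernel:
  assumes k: "kernel f k" and ss: "semisimple_object C (tgt f)" and l: "loewy_le j (src k)"
  shows "loewy_le (Suc j) (src f)"
proof -
  note ks = kernelD[OF k]
  obtain \<Phi> where \<Phi>: "to_simples (tgt f) \<Phi>" "jointly_monic (tgt f) \<Phi>"
    using ss unfolding semisimple_iff_jointly_monic by blast
  let ?\<Theta> = "(\<lambda>\<phi>. \<phi> \<bullet> f) ` \<Phi>"
  have \<Theta>: "to_simples (src f) ?\<Theta>"
    using \<Phi>(1) ks(1) unfolding to_simples_def by auto
  have jk: "joint_kernel (src f) ?\<Theta> k" unfolding joint_kernel_def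
  proof (intro conjI ballI allI impI)
    fix \<theta> assume "\<theta> \<in> ?\<Theta>"
    then obtain \<phi> where \<phi>: "\<phi> \<in> \<Phi>" "\<theta> = \<phi> \<bullet> f" by blast
    then show "\<theta> \<bullet> k = zero_mor C (src k) (tgt \<theta>)"
      using to_simplesD[OF \<Phi>(1) \<phi>(1)] ks by simp
  next
    fix x assume x: "arrow x" "tgt x = src f" "\<forall>\<theta>\<in>?\<Theta>. \<theta> \<bullet> x = zero_mor C (src x) (tgt \<theta>)"
    have "f \<bullet> x = zero_mor C (src (f \<bullet> x)) (tgt f)"
    proof (rule jointly_monicD[OF \<Phi>(2)])
      fix \<phi> assume \<phi>: "\<phi> \<in> \<Phi>"
      then have "(\<phi> \<bullet> f) \<bullet> x = zero_mor C (src x) (tgt (\<phi> \<bullet> f))" using x(3) by blast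
      then show "\<phi> \<bullet> (f \<bullet> x) = zero_mor C (src (f \<bullet> x)) (tgt \<phi>)"
        using to_simplesD[OF \<Phi>(1) \<phi>] ks x by simp
    qed (use x ks in simp_all)
    then obtain u where "arrow u" "src u = src x" "tgt u = src k" "k \<bullet> u = x"
      using kernel_lift[OF k x(1,2)] x ks by auto
    then show "\<exists>u. arr u (src x) (src k) \<and> k \<bullet> u = x" using x(1) ks(3) by (intro exI[of _ u]) simp
  qed (use ks in simp_all)
  show ?thesis using \<Theta> jk l by auto
qed

text \<open>The first step \<open>K\<close> of the filtration of the source has an image \<open>b\<close> in the target. The quotient of
  the target by \<open>b\<close> is a quotient of the source modulo \<open>K\<close>, hence semi-simple.\<close>

lemma loewy_le_quotient:
  assumes "epi q" "loewy_le j (src q)"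
  shows "loewy_le j (tgt q)"
  using assms
proof (induction j arbitrary: q)
  case 0
  have "q = zero_mor C (src q) (tgt q)" using zero_objectD(1)[of "src q" q] 0 by simp
  then have "ident C (tgt q) \<bullet> q = zero_mor C (src q) (tgt q)" using 0 by simp
  then have "ident C (tgt q) = zero_mor C (tgt q) (tgt q)"
    using epiD[OF 0(1), of "ident C (tgt q)"] 0 by simp
  then show ?case using zero_object_iff[of "tgt q"] 0 by simp
next
  case (Suc j)
  have qa: "arrow q" using Suc.prems(1) by simp
  obtain \<Phi> k where \<Phi>: "to_simples (src q) \<Phi>" and k: "joint_kernel (src q) \<Phi> k"
    and l: "loewy_le j (src k)" using Suc.prems(2) by auto
  note ks = joint_kernelD[OF k]
  obtain a where a: "cokernel k a" using cokernel_exists[OF ks(2)] by blast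
  note as = cokernelD[OF a]
  have ss: "semisimple_object C (tgt a)" using coimage_semisimple[OF \<Phi> k a] .
  have qk: "arrow (q \<bullet> k)" "src (q \<bullet> k) = src k" "tgt (q \<bullet> k) = tgt q" using qa ks by simp_all
  obtain e b where eb: "epi e" "mon b" "src e = src k" "tgt e = src b" "tgt b = tgt q" "b \<bullet> e = q \<bullet> k"
    using image_factorization[OF qk(1)] qk by metis
  obtain c where c: "cokernel b c" using cokernel_exists[OF mon_arrow[OF eb(2)]] by blast
  note cs = cokernelD[OF c]
  have cq: "arrow (c \<bullet> q)" "src (c \<bullet> q) = src q" "tgt (c \<bullet> q) = tgt c" using cs eb qa by simp_all
  have "(c \<bullet> q) \<bullet> k = c \<bullet> (b \<bullet> e)" using cs eb qa ks by simp
  also have "\<dots> = zero_mor C (src b) (tgt c) \<bullet> e"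
    by (rule comp_reduce[OF cs(5)]) (use cs eb in simp_all)
  also have "\<dots> = zero_mor C (src k) (tgt (c \<bullet> q))" using eb cs cq by simp
  finally obtain t where t: "arrow t" "src t = tgt a" "tgt t = tgt (c \<bullet> q)" "t \<bullet> a = c \<bullet> q"
    using cokernel_lift[OF a cq(1)] cq ks by auto
  have "epi (t \<bullet> a)" using t(4) epi_comp[of q c] cs eb Suc.prems(1) by simp
  then have "epi t" using epi_if_comp_epi[of t a] t as by simp
  then have "semisimple_object C (tgt c)" using semisimple_quotient[of t] ss t cq by simp
  moreover have "loewy_le j (src b)" using Suc.IH[OF eb(1)] l eb by simp
  ultimately show ?case using loewy_le_kernel[OF kernel_of_cokernel[OF eb(2) c]] cs eb by simp
qed

lemma semisimple_filtration_loewy_le: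
  assumes "has_semisimple_filtration C A"
  obtains m where "loewy_le m A"
proof -
  obtain m F G i q where F: "F 0 = A" "zero_object C (F m)"
    "\<And>j. j < m \<Longrightarrow> short_exact C (F (Suc j)) (F j) (G j) (i j) (q j) \<and> semisimple_object C (G j)"
    using assms unfolding has_semisimple_filtration_def by metis
  have "loewy_le d (F (m - d))" if "d \<le> m" for d
    using that
  proof (induction d)
    case 0
    then show ?case using F by simp
  next
    case (Suc d)
    let ?j = "m - Suc d"
    have j: "?j < m" "Suc ?j = m - d" using Suc.prems by auto
    have "short_exact C (F (m - d)) (F ?j) (G ?j) (i ?j) (q ?j)" "semisimple_object C (G ?j)"
      using F(3)[OF j(1)] j(2) by auto
    then have "kernel (q ?j) (i ?j)" "src (q ?j) = F ?j" "tgt (q ?j) = G ?j" "src (i ?j) = F (m - d)"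
      using is_kernel_iff unfolding short_exact_def by blast+
    then show ?case
      using loewy_le_kernel[of "q ?j" "i ?j" d] Suc \<open>semisimple_object C (G ?j)\<close> by simp
  qed
  from this[of m] show ?thesis using that F by simp
qed

end

section \<open>Length\<close>

context abelian_category
begin

text \<open>An upper bound for the length. The morphisms \<open>\<phi>\<close> may be zero, so that every finite Loewy filtration
  can be refined without discarding superfluous steps. That the least such bound strictly decreases
  under proper subobjects and proper quotients is proved directly, without the Jordan-Hoelder theorem.\<close>

primrec length_le :: "nat \<Rightarrow> 'a \<Rightarrow> bool" where
  "length_le 0 A \<longleftrightarrow> zero_object C A"
| "length_le (Suc k) A \<longleftrightarrow>
     (\<exists>\<phi> a. kernel \<phi> a \<and> src \<phi> = A \<and> simple_object C (tgt \<phi>) \<and> length_le k (src a))"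

lemma length_le_SucI:
  "kernel \<phi> a \<Longrightarrow> src \<phi> = A \<Longrightarrow> simple_object C (tgt \<phi>) \<Longrightarrow> length_le k (src a) \<Longrightarrow>
    length_le (Suc k) A"
  by auto

text \<open>Intersect the subobject \<open>u\<close> with the kernel \<open>a\<close> of the first step. If this intersection is all of
  the kernel, then \<open>u\<close> contains the kernel; since
  \<open>\<phi>\<close> has a simple target, \<open>u\<close> is then either contained in the kernel or everything.\<close>

lemma length_le_subobject:
  assumes "mon u" "length_le k (tgt u)"
  shows "\<exists>k'\<le>k. length_le k' (src u) \<and> (iso u \<or> k' < k)"
  using assms
proof (induction k arbitrary: u)
  case 0
  have ua: "arrow u" using 0(1) by simp
  have z: "zero_object C (tgt u)" using 0(2) by simp
  have "epi u" unfolding epi_def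
    using zero_objectD(1)[OF z] ua by blast
  then have "iso u" using iso_if_mon_epi 0 by blast
  moreover have "zero_object C (src u)"
    using loewy_le_subobject[OF 0(1), of 0] z by simp
  ultimately show ?case by auto
next
  case (Suc k)
  have ua: "arrow u" using Suc.prems(1) by simp
  obtain \<phi> a where a: "kernel \<phi> a" and \<phi>: "src \<phi> = tgt u" "simple_object C (tgt \<phi>)"
    and l: "length_le k (src a)" using Suc.prems(2) by auto
  note as = kernelD[OF a]
  have \<phi>u: "arrow (\<phi> \<bullet> u)" "src (\<phi> \<bullet> u) = src u" "tgt (\<phi> \<bullet> u) = tgt \<phi>" using as ua \<phi> by simp_all
  obtain b where b: "kernel (\<phi> \<bullet> u) b" using kernel_exists[OF \<phi>u(1)] by blast
  note bs = kernelD[OF b]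
  have "\<phi> \<bullet> (u \<bullet> b) = zero_mor C (src (u \<bullet> b)) (tgt \<phi>)" using bs as ua \<phi> \<phi>u by simp
  then obtain v where v: "arrow v" "src v = src b" "tgt v = src a" "a \<bullet> v = u \<bullet> b"
    using kernel_lift[OF a, of "u \<bullet> b"] bs ua \<phi> \<phi>u by auto
  have "mon (a \<bullet> v)" using v mon_comp[OF bs(2) Suc.prems(1)] bs \<phi>u by simp
  then have mv: "mon v" using mon_if_comp_mon[of a v] v as by simp
  obtain k' where k': "k' \<le> k" "length_le k' (src b)" "iso v \<or> k' < k"
    using Suc.IH[OF mv] l v by auto
  have l': "length_le (Suc k') (src u)"
    by (rule length_le_SucI[OF b]) (use \<phi>u \<phi> k' in simp_all)
  show ?case
  proof (cases "k' < k")
    case True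
    then show ?thesis using l' by (intro exI[of _ "Suc k'"]) simp
  next
    case False
    then have iv: "iso v" using k' by blast
    show ?thesis
    proof (cases "\<phi> \<bullet> u = zero_mor C (src u) (tgt \<phi>)")
      case True
      then have "(\<phi> \<bullet> u) \<bullet> ident C (src u) = zero_mor C (src (ident C (src u))) (tgt (\<phi> \<bullet> u))"
        using \<phi>u ua by (simp del: assoc)
      then obtain w where w: "arrow w" "src w = src u" "tgt w = src b" "b \<bullet> w = ident C (src u)"
        using kernel_lift[OF b, of "ident C (src u)"] ua \<phi>u by auto
      have "mon w" using mon_if_left_inverse[of w b] w bs by simp
      then have "mon (v \<bullet> w)" using mv mon_comp v w by simp
      then have "\<exists>k'\<le>k. length_le k' (src (v \<bullet> w)) \<and> (iso (v \<bullet> w) \<or> k' < k)"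
        using l v w by (intro Suc.IH) simp_all
      then show ?thesis using v w by (metis arrow_comp(2) le_imp_less_Suc less_imp_le_nat)
    next
      case False
      then have ep: "epi (\<phi> \<bullet> u)" using epi_to_simple[OF \<phi>(2) \<phi>u(1,3)] \<phi>u by simp
      then have "epi \<phi>" using epi_if_comp_epi[of \<phi> u] as ua \<phi> by simp
      note ck = cokernel_of_kernel[OF this a]
      have "epi u" unfolding epi_def
      proof (intro conjI allI impI ua)
        fix x assume x: "arrow x" "src x = tgt u" "x \<bullet> u = zero_mor C (src u) (tgt x)"
        have "(x \<bullet> a) \<bullet> v = x \<bullet> (u \<bullet> b)" using v as \<phi> x by simp
        also have "\<dots> = zero_mor C (src u) (tgt x) \<bullet> b"
          by (rule comp_reduce[OF x(3)]) (use x bs \<phi>u ua in simp_all)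
        also have "\<dots> = zero_mor C (src v) (tgt (x \<bullet> a))" using x bs as \<phi> \<phi>u v by simp
        finally have "x \<bullet> a = zero_mor C (tgt v) (tgt (x \<bullet> a))"
          using epiD[OF iso_mon_epi(3)[OF iv], of "x \<bullet> a"] x as \<phi> v by simp
        then obtain y where y: "arrow y" "src y = tgt \<phi>" "tgt y = tgt x" "y \<bullet> \<phi> = x"
          using cokernel_lift[OF ck, of x] x as \<phi> v by auto
        have "y \<bullet> (\<phi> \<bullet> u) = x \<bullet> u" using y \<phi> as ua assoc[of u \<phi> y] by simp
        then have "y = zero_mor C (tgt (\<phi> \<bullet> u)) (tgt y)"
          using epiD[OF ep, of y] y x \<phi>u by simp
        then show "x = zero_mor C (tgt u) (tgt x)" using y \<phi> \<phi>u as comp_zero(1)[of \<phi> "tgt x" "tgt \<phi>"]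
          by (metis arrow_src_tgt(2))
      qed
      then have "iso u" using iso_if_mon_epi Suc.prems(1) by blast
      then show ?thesis using l' k' by (intro exI[of _ "Suc k'"]) simp
    qed
  qed
qed

text \<open>If the kernel \<open>n\<close> of \<open>q\<close> lies in the kernel \<open>a\<close> of \<open>\<phi>\<close>, then \<open>\<phi>\<close> descends to the quotient and the
  first step is passed to its image. Otherwise the restriction of \<open>\<phi>\<close> to \<open>n\<close> is an epimorphism onto a
  simple object, \<open>a\<close> and \<open>n\<close> together span the source, and the quotient is already a quotient of \<open>a\<close>.\<close>

lemma length_le_quotient:
  assumes "epi q" "length_le k (src q)"
  shows "\<exists>k'\<le>k. length_le k' (tgt q) \<and> (mon q \<or> k' < k)"
  using assms
proof (induction k arbitrary: q)
  case 0
  have qa: "arrow q" using 0(1) by simp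
  have z: "zero_object C (src q)" using 0(2) by simp
  have "mon q" unfolding mon_def
    using zero_objectD(2)[OF z] qa by blast
  moreover have "zero_object C (tgt q)"
    using loewy_le_quotient[OF 0(1), of 0] z by simp
  ultimately show ?case by auto
next
  case (Suc k)
  have qa: "arrow q" using Suc.prems(1) by simp
  obtain \<phi> a where a: "kernel \<phi> a" and \<phi>: "src \<phi> = src q" "simple_object C (tgt \<phi>)"
    and l: "length_le k (src a)" using Suc.prems(2) by auto
  note as = kernelD[OF a]
  obtain n where n: "kernel q n" using kernel_exists[OF qa] by blast
  note ns = kernelD[OF n]
  note ck = cokernel_of_kernel[OF Suc.prems(1) n]
  have \<phi>n: "arrow (\<phi> \<bullet> n)" "src (\<phi> \<bullet> n) = src n" "tgt (\<phi> \<bullet> n) = tgt \<phi>" using as ns \<phi> by simp_all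
  show ?case
  proof (cases "\<phi> \<bullet> n = zero_mor C (src n) (tgt \<phi>)")
    case True
    then obtain \<psi> where \<psi>: "arrow \<psi>" "src \<psi> = tgt q" "tgt \<psi> = tgt \<phi>" "\<psi> \<bullet> q = \<phi>"
      using cokernel_lift[OF ck, of \<phi>] as \<phi> ns by auto
    obtain b where b: "kernel \<psi> b" using kernel_exists[OF \<psi>(1)] by blast
    note bs = kernelD[OF b]
    have "\<psi> \<bullet> (q \<bullet> a) = \<phi> \<bullet> a" by (rule comp_reduce[OF \<psi>(4)]) (use \<psi> qa as \<phi> in simp_all)
    then have "\<psi> \<bullet> (q \<bullet> a) = zero_mor C (src (q \<bullet> a)) (tgt \<psi>)" using as qa \<phi> \<psi> by simp
    then obtain p where p: "arrow p" "src p = src a" "tgt p = src b" "b \<bullet> p = q \<bullet> a"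
      using kernel_lift[OF b, of "q \<bullet> a"] as qa \<phi> \<psi> by auto
    have "tgt b = tgt q" using bs \<psi> by simp
    then obtain e y where e: "epi e" "arrow y" "src y = src e" "tgt e = src b" "tgt y = src q"
        "q \<bullet> y = b \<bullet> e"
      using epi_lift[OF Suc.prems(1) bs(3)] by blast
    have "\<phi> \<bullet> y = \<psi> \<bullet> (q \<bullet> y)" using \<psi> qa e assoc[of y q \<psi>] by simp
    also have "\<dots> = \<psi> \<bullet> (b \<bullet> e)" using e by simp
    also have "\<dots> = zero_mor C (src b) (tgt \<psi>) \<bullet> e"
      by (rule comp_reduce[OF bs(5)]) (use bs e in simp_all)
    also have "\<dots> = zero_mor C (src y) (tgt \<phi>)" using e \<psi> \<phi>(2) by simp
    finally obtain w where w: "arrow w" "src w = src y" "tgt w = src a" "a \<bullet> w = y"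
      using kernel_lift[OF a, of y] e \<phi> by auto
    have "b \<bullet> (p \<bullet> w) = (q \<bullet> a) \<bullet> w" by (rule comp_reduce[OF p(4)]) (use bs p w in simp_all)
    also have "\<dots> = b \<bullet> e" using w e qa as \<phi> by simp
    finally have "p \<bullet> w = e" by (rule mon_cancel[OF bs(2)]) (use p w e in simp_all)
    then have "epi p" using epi_if_comp_epi[of p w] e p w by simp
    then have "\<exists>k'\<le>k. length_le k' (tgt p) \<and> (mon p \<or> k' < k)"
      using Suc.IH[of p] l p by simp
    then obtain k' where k': "k' \<le> k" "length_le k' (src b)" "mon p \<or> k' < k" using p by auto
    have l': "length_le (Suc k') (tgt q)"
      by (rule length_le_SucI[OF b]) (use \<psi> \<phi> k' in simp_all)
    have "mon q" if mp: "mon p" unfolding mon_def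
    proof (intro conjI allI impI qa)
      fix x assume x: "arrow x" "tgt x = src q" "q \<bullet> x = zero_mor C (src x) (tgt q)"
      have "\<phi> \<bullet> x = \<psi> \<bullet> (q \<bullet> x)" using \<psi> qa x assoc[of x q \<psi>] by simp
      then have "\<phi> \<bullet> x = zero_mor C (src x) (tgt \<phi>)" using x \<psi> by simp
      then obtain y where y: "arrow y" "src y = src x" "tgt y = src a" "a \<bullet> y = x"
        using kernel_lift[OF a, of x] x \<phi> by auto
      have "b \<bullet> (p \<bullet> y) = (q \<bullet> a) \<bullet> y" by (rule comp_reduce[OF p(4)]) (use bs p y in simp_all)
      then have "b \<bullet> (p \<bullet> y) = zero_mor C (src y) (tgt b)"
        using y x qa as \<phi> bs \<psi> by simp
      then have "p \<bullet> y = zero_mor C (src y) (tgt p)"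
        using monD[OF bs(2), of "p \<bullet> y"] p y by simp
      then have "y = zero_mor C (src y) (src p)" using monD[OF mp, of y] p y by simp
      then have "a \<bullet> y = a \<bullet> zero_mor C (src x) (src a)" using y p by simp
      then show "x = zero_mor C (src x) (src q)" using y x as \<phi> by simp
    qed
    then show ?thesis using l' k' by (intro exI[of _ "Suc k'"]) auto
  next
    case False
    then have ep: "epi (\<phi> \<bullet> n)" using epi_to_simple[OF \<phi>(2) \<phi>n(1,3)] \<phi>n by simp
    then have "epi \<phi>" using epi_if_comp_epi[of \<phi> n] as ns \<phi> by simp
    note ck\<phi> = cokernel_of_kernel[OF this a]
    have qas: "arrow (q \<bullet> a)" "src (q \<bullet> a) = src a" "tgt (q \<bullet> a) = tgt q" using qa as \<phi> by simp_all
    have "epi (q \<bullet> a)" unfolding epi_def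
    proof (intro conjI allI impI qas(1))
      fix t assume t: "arrow t" "src t = tgt (q \<bullet> a)" "t \<bullet> (q \<bullet> a) = zero_mor C (src (q \<bullet> a)) (tgt t)"
      have tq: "arrow (t \<bullet> q)" "src (t \<bullet> q) = src q" "tgt (t \<bullet> q) = tgt t" using t qas qa by simp_all
      have "(t \<bullet> q) \<bullet> a = zero_mor C (src a) (tgt (t \<bullet> q))" using t qa as \<phi> qas by simp
      then obtain s where s: "arrow s" "src s = tgt \<phi>" "tgt s = tgt t" "s \<bullet> \<phi> = t \<bullet> q"
        using cokernel_lift[OF ck\<phi>, of "t \<bullet> q"] tq as \<phi> by auto
      have "s \<bullet> (\<phi> \<bullet> n) = (t \<bullet> q) \<bullet> n"
        by (rule comp_reduce[OF s(4)]) (use s as \<phi> ns in simp_all)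
      also have "\<dots> = zero_mor C (src n) (tgt s)" using t qas qa ns s by simp
      finally have "s = zero_mor C (tgt \<phi>) (tgt s)" using epiD[OF ep, of s] s \<phi>n by simp
      then have "s \<bullet> \<phi> = zero_mor C (src q) (tgt t)"
        using comp_zero(1)[of \<phi> "tgt t" "tgt \<phi>"] s as(1) \<phi> t by simp
      then show "t = zero_mor C (tgt (q \<bullet> a)) (tgt t)"
        using epiD[OF Suc.prems(1), of t] s t qas by simp
    qed
    then show ?thesis using Suc.IH[of "q \<bullet> a"] l qas by (metis le_imp_less_Suc less_imp_le_nat)
  qed
qed

lemma length_le_of_joint_kernel:
  assumes "finite \<Phi>" "to_simples A \<Phi>" "joint_kernel A \<Phi> k" "length_le l (src k)"
  shows "\<exists>l'. length_le l' A"
  using assms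
proof (induction \<Phi> arbitrary: k l)
  case empty
  have A: "A \<in> Ob C" using empty unfolding to_simples_def by simp
  note ks = joint_kernelD[OF empty(2)]
  obtain u where u: "arrow u" "src u = src (ident C A)" "tgt u = src k" "k \<bullet> u = ident C A"
    using joint_kernel_lift[OF empty(2), of "ident C A"] A by auto
  have "mon u" using mon_if_left_inverse[of u k] u ks A by simp
  then show ?case using length_le_subobject[of u l] empty u A by auto
next
  case (insert \<phi> \<Phi>)
  note ks = joint_kernelD[OF insert.prems(2)]
  have A: "A \<in> Ob C" "finite \<Phi>" "to_simples A \<Phi>" using insert.prems unfolding to_simples_def by auto
  have \<phi>: "arrow \<phi>" "src \<phi> = A" "simple_object C (tgt \<phi>)"
    using to_simplesD[OF insert.prems(1), of \<phi>] by auto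
  obtain j where j: "joint_kernel A \<Phi> j"
    using joint_kernel_exists[OF A(2,1)] to_simplesD[OF A(3)] by blast
  note js = joint_kernelD[OF j]
  have \<phi>j: "arrow (\<phi> \<bullet> j)" "src (\<phi> \<bullet> j) = src j" "tgt (\<phi> \<bullet> j) = tgt \<phi>" using \<phi> js by simp_all
  obtain v where v: "arrow v" "src v = src k" "tgt v = src j" "j \<bullet> v = k"
    using joint_kernel_lift[OF j ks(2,3)] ks(4) by blast
  have "kernel (\<phi> \<bullet> j) v" unfolding kernel_iff
  proof (intro conjI allI impI)
    show "mon v" using mon_if_comp_mon[of j v] v ks js by simp
    show "(\<phi> \<bullet> j) \<bullet> v = zero_mor C (src v) (tgt (\<phi> \<bullet> j))" using v ks(4)[of \<phi>] \<phi> js \<phi>j by simp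
    fix x assume x: "arrow x" "tgt x = src (\<phi> \<bullet> j)" "(\<phi> \<bullet> j) \<bullet> x = zero_mor C (src x) (tgt (\<phi> \<bullet> j))"
    have jx: "arrow (j \<bullet> x)" "src (j \<bullet> x) = src x" "tgt (j \<bullet> x) = A" using x js \<phi>j by simp_all
    have "\<psi> \<bullet> (j \<bullet> x) = zero_mor C (src (j \<bullet> x)) (tgt \<psi>)" if "\<psi> \<in> insert \<phi> \<Phi>" for \<psi>
    proof (cases "\<psi> = \<phi>")
      case True
      then show ?thesis using x \<phi> js \<phi>j by simp
    next
      case False
      then have \<psi>: "\<psi> \<in> \<Phi>" using that by blast
      note s = to_simplesD[OF A(3) \<psi>]
      have "\<psi> \<bullet> (j \<bullet> x) = zero_mor C (src j) (tgt \<psi>) \<bullet> x"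
        by (rule comp_reduce[OF js(4)[OF \<psi>]]) (use s js x \<phi>j in simp_all)
      then show ?thesis using s x \<phi>j jx by simp
    qed
    then obtain y where y: "arrow y" "src y = src x" "tgt y = src k" "k \<bullet> y = j \<bullet> x"
      using joint_kernel_lift[OF insert.prems(2) jx(1,3)] jx by metis
    have "j \<bullet> (v \<bullet> y) = k \<bullet> y" by (rule comp_reduce[OF v(4)]) (use v y js in simp_all)
    then have "v \<bullet> y = x"
      by - (rule mon_cancel[OF js(1)], use v y x \<phi>j js in simp_all)
    then show "\<exists>u. arr u (src x) (src v) \<and> v \<bullet> u = x"
      using y v arrow_src_tgt(1)[OF x(1)] arrow_src_tgt(1)[OF ks(2)] by (intro exI[of _ y]) simp
  qed (use v \<phi>j in simp_all)
  then have "length_le (Suc l) (src j)"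
    by (rule length_le_SucI) (use \<phi>j \<phi> insert.prems v in simp_all)
  then show ?case using insert.IH[OF A(3) j] by blast
qed

lemma length_le_of_loewy_le:
  "loewy_le j A \<Longrightarrow> \<exists>k. length_le k A"
proof (induction j arbitrary: A)
  case 0
  then have "length_le 0 A" by simp
  then show ?case by blast
next
  case (Suc j)
  then obtain \<Phi> k where k: "to_simples A \<Phi>" "joint_kernel A \<Phi> k" "loewy_le j (src k)" by auto
  then obtain l where "length_le l (src k)" using Suc.IH by blast
  then show ?case using length_le_of_joint_kernel[OF _ k(1,2)] k(1) unfolding to_simples_def by blast
qed

lemma ident_simple_nonzero:
  assumes "simple_object C T"
  shows "ident C T \<noteq> zero_mor C T T"
  using assms zero_object_iff[of T] unfolding simple_object_def by blast

text \<open>The last nonzero step of a filtration with simple factors is simple.\<close>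

lemma simple_subobject_exists:
  assumes "length_le k A" "\<not> zero_object C A"
  obtains x where "arrow x" "simple_object C (src x)" "tgt x = A" "x \<noteq> zero_mor C (src x) A"
proof -
  have "\<exists>x. arrow x \<and> simple_object C (src x) \<and> tgt x = A \<and> x \<noteq> zero_mor C (src x) A"
    using assms
  proof (induction k arbitrary: A)
    case 0
    then show ?case by simp
  next
    case (Suc k)
    obtain \<phi> a where a: "kernel \<phi> a" and \<phi>: "src \<phi> = A" "simple_object C (tgt \<phi>)"
      and l: "length_le k (src a)" using Suc.prems(1) by auto
    note as = kernelD[OF a]
    show ?case
    proof (cases "zero_object C (src a)")
      case False
      then obtain x where x: "arrow x" "simple_object C (src x)" "tgt x = src a"
        "x \<noteq> zero_mor C (src x) (src a)" using Suc.IH[OF l] by blast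
      then have "a \<bullet> x \<noteq> zero_mor C (src x) A" using monD[OF as(2), of x] as \<phi> by auto
      then show ?thesis using x as \<phi> by (intro exI[of _ "a \<bullet> x"]) simp
    next
      case True
      have "mon \<phi>" unfolding mon_def
      proof (intro conjI allI impI as(1))
        fix x assume x: "arrow x" "tgt x = src \<phi>" "\<phi> \<bullet> x = zero_mor C (src x) (tgt \<phi>)"
        then obtain u where u: "arrow u" "src u = src x" "tgt u = src a" "a \<bullet> u = x"
          using kernel_lift[OF a] by blast
        have "u = zero_mor C (src x) (src a)" using zero_objectD(2)[OF True u(1,3)] u by simp
        then have "a \<bullet> u = zero_mor C (src x) (tgt a)" using as x by simp
        then show "x = zero_mor C (src x) (src \<phi>)" using u as by simp
      qed
      moreover have "\<phi> \<noteq> zero_mor C (src \<phi>) (tgt \<phi>)"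
      proof
        assume "\<phi> = zero_mor C (src \<phi>) (tgt \<phi>)"
        then have "\<phi> \<bullet> ident C A = zero_mor C A (tgt \<phi>)" using \<phi> as by simp
        then have "ident C A = zero_mor C A A"
          using monD[OF \<open>mon \<phi>\<close>, of "ident C A"] \<phi> arrow_src_tgt(1)[OF as(1)] by simp
        then show False using Suc.prems(2) zero_object_iff[of A] \<phi> arrow_src_tgt(1)[OF as(1)] by simp
      qed
      ultimately have "iso \<phi>" using mon_to_simple_iso[OF \<phi>(2)] by blast
      then obtain g where g: "arrow g" "src g = tgt \<phi>" "tgt g = src \<phi>" "\<phi> \<bullet> g = ident C (tgt \<phi>)"
        using isoD by metis
      have "g \<noteq> zero_mor C (src g) A"
      proof
        assume "g = zero_mor C (src g) A"
        then have "\<phi> \<bullet> g = zero_mor C (tgt \<phi>) (tgt \<phi>)" using g \<phi> as by simp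
        then show False using g(4) ident_simple_nonzero[OF \<phi>(2)] by simp
      qed
      then show ?thesis using g \<phi> by (intro exI[of _ g]) simp
    qed
  qed
  then show ?thesis using that by blast
qed

end

section \<open>Covers and projective objects\<close>

context abelian_category
begin

lemma short_exact_iff:
  "short_exact C B E A i p \<longleftrightarrow>
     kernel p i \<and> cokernel i p \<and> src i = B \<and> src p = E \<and> tgt p = A"
proof
  assume s: "short_exact C B E A i p"
  then have o: "A \<in> Ob C" "B \<in> Ob C" "E \<in> Ob C" unfolding short_exact_def by auto
  then show "kernel p i \<and> cokernel i p \<and> src i = B \<and> src p = E \<and> tgt p = A"
    using s is_kernel_iff[of E A p B i] is_cokernel_iff[of B E i A p] unfolding short_exact_def by auto
next
  assume s: "kernel p i \<and> cokernel i p \<and> src i = B \<and> src p = E \<and> tgt p = A"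
  then have a: "arrow p" "arrow i" "tgt i = E" using kernelD[of p i] by auto
  then have o: "A \<in> Ob C" "B \<in> Ob C" "E \<in> Ob C"
    using s arrow_src_tgt[OF a(1)] arrow_src_tgt[OF a(2)] by auto
  show "short_exact C B E A i p"
    unfolding short_exact_def
    using s o a is_kernel_iff[of E A p B i] is_cokernel_iff[of B E i A p] by auto
qed

lemma short_exact_epi:
  "epi p \<Longrightarrow> kernel p i \<Longrightarrow> short_exact C (src i) (src p) (tgt p) i p"
  using short_exact_iff cokernel_of_kernel by blast

text \<open>A cover of \<open>P\<close> is built as an epimorphism onto \<open>P\<close> that factors through prescribed epimorphisms onto
  \<open>P\<close>; equivalently, the pullbacks of the latter along it split.\<close>

definition factors_through :: "'b \<Rightarrow> 'b \<Rightarrow> bool" where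
  "factors_through e p \<longleftrightarrow> (\<exists>h. arr h (src e) (src p) \<and> p \<bullet> h = e)"

lemma factors_throughE:
  assumes "factors_through e p"
  obtains h where "arrow h" "src h = src e" "tgt h = src p" "p \<bullet> h = e"
  using assms unfolding factors_through_def by auto

lemma factors_throughI:
  assumes "arrow h" "src h = src e" "tgt h = src p" "p \<bullet> h = e"
  shows "factors_through e p"
  using assms arrow_src_tgt[OF assms(1)] unfolding factors_through_def by auto

lemma common_refinement:
  assumes "finite \<E>" "P \<in> Ob C" "\<And>p. p \<in> \<E> \<Longrightarrow> epi p \<and> tgt p = P"
  obtains e where "epi e" "tgt e = P" "\<And>p. p \<in> \<E> \<Longrightarrow> factors_through e p"
proof -
  have "\<exists>e. epi e \<and> tgt e = P \<and> (\<forall>p\<in>\<E>. factors_through e p)" using assms(1,3)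
  proof (induction \<E>)
    case empty
    then show ?case using iso_mon_epi(3)[OF iso_ident[OF assms(2)]] assms(2)
      by (intro exI[of _ "ident C P"]) simp
  next
    case (insert p \<E>)
    then obtain e where e: "epi e" "tgt e = P" "\<forall>p\<in>\<E>. factors_through e p" by blast
    have p: "epi p" "tgt p = P" using insert.prems by auto
    obtain q r where pb: "pullback p e q r" and r': "epi p \<Longrightarrow> epi r"
      using pullback_exists[of p e] p e epi_arrow by metis
    note ps = pullbackD[OF pb] and r = r'[OF p(1)]
    have er: "arrow (e \<bullet> r)" "src (e \<bullet> r) = src r" "tgt (e \<bullet> r) = P" using ps e by simp_all
    have "factors_through (e \<bullet> r) x" if x: "x \<in> insert p \<E>" for x
    proof (cases "x = p")
      case True
      show ?thesis by (rule factors_throughI[of q]) (use ps er True in simp_all)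
    next
      case False
      then obtain h where h: "arrow h" "src h = src e" "tgt h = src x" "x \<bullet> h = e"
        using e(3) x factors_throughE by blast
      have xa: "arrow x" using insert.prems[OF x] by simp
      have "x \<bullet> (h \<bullet> r) = e \<bullet> r" by (rule comp_reduce[OF h(4)]) (use h ps xa in simp_all)
      then show ?thesis
        by - (rule factors_throughI[of "h \<bullet> r"], use h ps er in simp_all)
    qed
    moreover have "epi (e \<bullet> r)" using epi_comp[OF r e(1)] ps by simp
    ultimately show ?case using er by blast
  qed
  then show ?thesis using that by blast
qed

text \<open>Push an extension forward along an epimorphism \<open>g\<close> of its kernel \<open>i\<close>: divide its middle object
  by the kernel of \<open>g\<close>.\<close>

lemma pushforward_extension:
  assumes f: "epi f" and i: "kernel f i" and g: "epi g" "src g = src i" and k: "kernel g k"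
  obtains c t p where "kernel c (i \<bullet> k)" "epi c" "src c = src f" "epi p" "src p = tgt c"
    "tgt p = tgt f" "p \<bullet> c = f" "kernel p t" "src t = tgt g" "t \<bullet> g = c \<bullet> i"
proof -
  note ki = kernelD[OF i] and ks = kernelD[OF k]
  have ik: "mon (i \<bullet> k)" using mon_comp[OF ks(2) ki(2)] ks g by simp
  have iks: "arrow (i \<bullet> k)" "src (i \<bullet> k) = src k" "tgt (i \<bullet> k) = src f" using ki ks g by simp_all
  obtain c where c: "cokernel (i \<bullet> k) c" using cokernel_exists[OF iks(1)] by blast
  note cs = cokernelD[OF c]
  have kc: "kernel c (i \<bullet> k)" using kernel_of_cokernel[OF ik c] .
  have "f \<bullet> (i \<bullet> k) = zero_mor C (src i) (tgt f) \<bullet> k"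
    by (rule comp_reduce[OF ki(5)]) (use ki ks g in simp_all)
  then have "f \<bullet> (i \<bullet> k) = zero_mor C (src (i \<bullet> k)) (tgt f)" using ki ks g by simp
  then obtain p where p: "arrow p" "src p = tgt c" "tgt p = tgt f" "p \<bullet> c = f"
    using cokernel_lift[OF c ki(1)] iks by auto
  have ep: "epi p" using epi_if_comp_epi[of p c] f p cs by simp
  have "(c \<bullet> i) \<bullet> k = zero_mor C (src k) (tgt (c \<bullet> i))" using cs iks ki ks g by simp
  then obtain t where t: "arrow t" "src t = tgt g" "tgt t = tgt c" "t \<bullet> g = c \<bullet> i"
    using cokernel_lift[OF cokernel_of_kernel[OF g(1) k], of "c \<bullet> i"] cs iks ki ks g by auto
  have ga: "arrow g" using g by simp
  have "mon t" unfolding mon_def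
  proof (intro conjI allI impI t(1))
    fix x assume x: "arrow x" "tgt x = src t" "t \<bullet> x = zero_mor C (src x) (tgt t)"
    obtain e y where e: "epi e" "arrow y" "src y = src e" "tgt e = src x" "tgt y = src g" "g \<bullet> y = x \<bullet> e"
      using epi_lift[OF g(1), of x] x t by metis
    have iy: "arrow (i \<bullet> y)" "src (i \<bullet> y) = src e" "tgt (i \<bullet> y) = src f" using ki e g by simp_all
    have "c \<bullet> (i \<bullet> y) = (t \<bullet> g) \<bullet> y" using t(4) cs iks ki e g by simp
    also have "\<dots> = t \<bullet> (g \<bullet> y)" by (rule assoc) (use e t ga in simp_all)
    also have "\<dots> = t \<bullet> (x \<bullet> e)" using e by simp
    also have "\<dots> = zero_mor C (src x) (tgt t) \<bullet> e"
      by (rule comp_reduce[OF x(3)]) (use t x e in simp_all)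
    also have "\<dots> = zero_mor C (src (i \<bullet> y)) (tgt c)" using e x t iy cs by simp
    finally obtain z where z: "arrow z" "src z = src e" "tgt z = src k" "(i \<bullet> k) \<bullet> z = i \<bullet> y"
      using kernel_lift[OF kc iy(1)] iy iks cs by metis
    have "i \<bullet> (k \<bullet> z) = i \<bullet> y" using z ki ks g by simp
    then have "k \<bullet> z = y" by - (rule mon_cancel[OF ki(2)], use z ks e g in simp_all)
    then have "x \<bullet> e = g \<bullet> (k \<bullet> z)" using e by simp
    also have "\<dots> = zero_mor C (src k) (tgt g) \<bullet> z"
      by (rule comp_reduce[OF ks(5)]) (use ks z in simp_all)
    also have "\<dots> = zero_mor C (src e) (tgt x)" using z x t ga by simp
    finally show "x = zero_mor C (src x) (src t)" using epiD[OF e(1), of x] e x by simp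
  qed
  have "kernel p t" unfolding kernel_iff
  proof (intro conjI allI impI)
    have "(p \<bullet> t) \<bullet> g = p \<bullet> (c \<bullet> i)" using t p ga by simp
    also have "\<dots> = f \<bullet> i" by (rule comp_reduce[OF p(4)]) (use p cs ki iks in simp_all)
    also have "\<dots> = zero_mor C (src g) (tgt (p \<bullet> t))" using ki g p t by simp
    finally show "p \<bullet> t = zero_mor C (src t) (tgt p)"
      using epiD[OF g(1), of "p \<bullet> t"] p t by simp
    fix x assume x: "arrow x" "tgt x = src p" "p \<bullet> x = zero_mor C (src x) (tgt p)"
    obtain e y where e: "epi e" "arrow y" "src y = src e" "tgt e = src x" "tgt y = src c" "c \<bullet> y = x \<bullet> e"
      using epi_lift[OF cs(2), of x] x p by metis
    have "f \<bullet> y = p \<bullet> (c \<bullet> y)" using p e cs assoc[of y c p] by simp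
    also have "\<dots> = p \<bullet> (x \<bullet> e)" using e by simp
    also have "\<dots> = zero_mor C (src x) (tgt p) \<bullet> e"
      by (rule comp_reduce[OF x(3)]) (use p x e in simp_all)
    also have "\<dots> = zero_mor C (src y) (tgt f)" using e x p ki by simp
    finally obtain z where z: "arrow z" "src z = src y" "tgt z = src i" "i \<bullet> z = y"
      using kernel_lift[OF i e(2)] e cs iks by auto
    obtain d where d: "cokernel t d" using cokernel_exists[OF t(1)] by blast
    note ds = cokernelD[OF d]
    have "x \<bullet> e = c \<bullet> (i \<bullet> z)" using e z by simp
    also have "\<dots> = (t \<bullet> g) \<bullet> z" using t(4) cs ki iks z by simp
    also have "\<dots> = t \<bullet> (g \<bullet> z)" by (rule assoc) (use t z ga g in simp_all)
    finally have xe: "x \<bullet> e = t \<bullet> (g \<bullet> z)" .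
    have "(d \<bullet> x) \<bullet> e = d \<bullet> (t \<bullet> (g \<bullet> z))" using xe ds x e p t by simp
    also have "\<dots> = zero_mor C (src t) (tgt d) \<bullet> (g \<bullet> z)"
      by (rule comp_reduce[OF ds(5)]) (use ds t z ga g in simp_all)
    also have "\<dots> = zero_mor C (src e) (tgt (d \<bullet> x))" using t z ga g ds e x p by simp
    finally have "d \<bullet> x = zero_mor C (src x) (tgt d)"
      using epiD[OF e(1), of "d \<bullet> x"] ds x e p t by simp
    then obtain v where "arrow v" "src v = src x" "tgt v = src t" "t \<bullet> v = x"
      using kernel_lift[OF kernel_of_cokernel[OF \<open>mon t\<close> d], of x] x p t ds by auto
    then show "\<exists>u. arr u (src x) (src t) \<and> t \<bullet> u = x"
      using x(1) t(1) by (intro exI[of _ v]) simp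
  qed (use p t \<open>mon t\<close> in simp_all)
  then show ?thesis using that[of c p t] kc cs p ep t iks by simp
qed

end

context finite_length_category
begin

lemma ext_equiv_refl:
  assumes "x \<in> extensions C A B" shows "(x, x) \<in> ext_equiv C A B"
proof -
  obtain E i p where x: "x = (E, i, p)" "short_exact C B E A i p"
    using assms unfolding extensions_def by auto
  then have s: "kernel p i" "src p = E" using short_exact_iff by auto
  note ks = kernelD[OF s(1)]
  have E: "E \<in> Ob C" using ks s by auto
  then have "isomorphism C E E (ident C E)" using isomorphism_iff[OF E E] iso_ident by simp
  then show ?thesis
    unfolding ext_equiv_def using x assms ks s by (auto intro!: exI[of _ "ident C E"])
qed

text \<open>Take the fibre product over \<open>P\<close> of extensions that span \<open>Ext\<^sup>1(P, T)\<close>. The set of extensions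
  through which its map to \<open>P\<close> factors is closed under Baer sums and scalar multiples, directly
  from the definition of these operations, and so consists of all extensions.\<close>

lemma ext_cover:
  assumes P: "P \<in> Ob C" and T: "T \<in> Ob C"
  obtains e where "epi e" "tgt e = P"
    "\<And>F i p. short_exact C T F P i p \<Longrightarrow> factors_through e p"
proof -
  let ?\<E> = "extensions C P T" and ?R = "ext_equiv C P T" and ?M = "Ext1 C P T"
  obtain S where S: "finite S" "S \<subseteq> carrier ?M" "carrier ?M \<subseteq> lin_span ?M S"
    using Ext1_finite[OF P T] unfolding finite_dimensional_def by blast
  have "S \<subseteq> ?\<E> // ?R" using S(2) unfolding Ext1_def by simp
  then have "\<forall>U\<in>S. \<exists>x. x \<in> ?\<E> \<and> U = ?R `` {x}" unfolding quotient_def by blast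
  then obtain x where x: "\<forall>U\<in>S. x U \<in> ?\<E> \<and> U = ?R `` {x U}"
    by (rule bchoice[THEN exE])
  define p0 where "p0 = (\<lambda>U. snd (snd (x U)))"
  have p0: "epi (p0 U)" "tgt (p0 U) = P" if "U \<in> S" for U
  proof -
    obtain E i p where xU: "x U = (E, i, p)" by (metis prod_cases3)
    then have "short_exact C T E P i p" using x that unfolding extensions_def by auto
    then show "epi (p0 U)" "tgt (p0 U) = P"
      unfolding p0_def xU using short_exact_iff cokernelD(2) by auto
  qed
  have "finite (p0 ` S)" using S by simp
  then obtain e where e: "epi e" "tgt e = P" and fe: "\<And>p. p \<in> p0 ` S \<Longrightarrow> factors_through e p"
    using common_refinement[of "p0 ` S" P] P p0 by blast
  have ea: "arrow e" using e by simp
  have span: "U \<in> lin_span ?M S \<Longrightarrow>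
      \<forall>(F, i, p) \<in> U. \<exists>h. arr h (src e) F \<and> p \<bullet> h = e" for U
  proof (induction rule: lin_span.induct)
    case (base U)
    show ?case
    proof (clarify)
      fix F i p assume t: "(F, i, p) \<in> U"
      obtain E i' p' where xU: "x U = (E, i', p')" by (metis prod_cases3)
      have "((E, i', p'), (F, i, p)) \<in> ?R" using x base t xU by auto
      then obtain g where g: "isomorphism C E F g" "p \<bullet> g = p'"
        and \<E>: "short_exact C T E P i' p'" "short_exact C T F P i p"
        unfolding ext_equiv_def extensions_def by auto
      have s: "src p' = E" "src p = F" "arrow p" "arrow p'"
        using \<E> kernelD(1) unfolding short_exact_iff by blast+
      have EF: "E \<in> Ob C" "F \<in> Ob C" using s by auto
      then have gs: "arrow g" "src g = E" "tgt g = F"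
        using g isomorphism_iff[OF EF] iso_mon_epi(1) by auto
      have "factors_through e (p0 U)" using fe base by blast
      then have "factors_through e p'" unfolding p0_def xU by simp
      then obtain h where h: "arrow h" "src h = src e" "tgt h = src p'" "p' \<bullet> h = e"
        using factors_throughE by blast
      have "p \<bullet> (g \<bullet> h) = p' \<bullet> h" by (rule comp_reduce[OF g(2)]) (use gs h s in simp_all)
      then show "\<exists>h. arr h (src e) F \<and> p \<bullet> h = e"
        using h gs s EF ea by (intro exI[of _ "g \<bullet> h"]) simp
    qed
  next
    case zero
    show ?case
    proof (clarify)
      fix F i p assume "(F, i, p) \<in> \<zero>\<^bsub>?M\<^esub>"
      then obtain s where s: "s \<in> mor C P F" "p \<bullet> s = ident C P" and \<E>: "short_exact C T F P i p"
        unfolding Ext1_def is_split_def extensions_def by auto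
      have p: "src p = F" "arrow p" using \<E> kernelD(1) unfolding short_exact_iff by blast+
      then have F: "F \<in> Ob C" by auto
      then have ss: "arrow s" "src s = P" "tgt s = F" using s P by (simp_all add: mor_iff)
      have "p \<bullet> (s \<bullet> e) = ident C P \<bullet> e" by (rule comp_reduce[OF s(2)]) (use ss p e in simp_all)
      then show "\<exists>h. arr h (src e) F \<and> p \<bullet> h = e"
        using ss e F by (intro exI[of _ "s \<bullet> e"]) simp
    qed
  next
    case (add U V)
    show ?case
    proof (clarify)
      fix F i p assume "(F, i, p) \<in> U \<oplus>\<^bsub>?M\<^esub> V"
      then obtain Y Z where \<E>: "short_exact C T F P i p" and Y: "Y \<in> U" and Z: "Z \<in> V"
        and baer: "is_Baer_sum C P T Y Z (F, i, p)"
        unfolding Ext1_def extensions_def by auto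
      obtain E1 i1 p1 E2 i2 p2 where YZ: "Y = (E1, i1, p1)" "Z = (E2, i2, p2)" by (metis prod_cases3)
      obtain W q1 q2 j1 j2 d where pb: "is_pullback C E1 E2 P p1 p2 W q1 q2"
        and d: "is_cokernel C T W (j1 \<ominus>\<^bsub>Hom C T W\<^esub> j2) F d" and pd: "p \<bullet> d = p1 \<bullet> q1"
        using baer unfolding is_Baer_sum_def YZ by auto
      obtain h1 where h1: "arr h1 (src e) E1" "p1 \<bullet> h1 = e" using add.IH(1) Y YZ by blast
      obtain h2 where h2: "arr h2 (src e) E2" "p2 \<bullet> h2 = e" using add.IH(2) Z YZ by blast
      have o: "E1 \<in> Ob C" "E2 \<in> Ob C" "src e \<in> Ob C" using h1 h2 ea by auto
      have W: "W \<in> Ob C" "q1 \<in> mor C W E1" "p1 \<in> mor C E1 P" using pb unfolding is_pullback_def by auto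
      obtain u where u: "u \<in> mor C (src e) W" "q1 \<bullet> u = h1"
        using pb o(3) arr_mor[OF h1(1)] arr_mor[OF h2(1)] h1(2) h2(2) unfolding is_pullback_def by metis
      have F: "F \<in> Ob C" "d \<in> mor C W F" using d unfolding is_cokernel_def by auto
      have p: "src p = F" "arrow p" using \<E> kernelD(1) unfolding short_exact_iff by blast+
      have a: "arrow u" "src u = src e" "tgt u = W" "arrow d" "src d = W" "tgt d = F"
        "arrow q1" "src q1 = W" "tgt q1 = E1" "arrow p1" "src p1 = E1" "tgt p1 = P"
        using u W F o P by (simp_all add: mor_iff)
      have "p \<bullet> (d \<bullet> u) = (p1 \<bullet> q1) \<bullet> u" by (rule comp_reduce[OF pd]) (use a p in simp_all)
      also have "\<dots> = e" using a u(2) h1(2) by simp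
      finally show "\<exists>h. arr h (src e) F \<and> p \<bullet> h = e"
        using a F o by (intro exI[of _ "d \<bullet> u"]) simp
    qed
  next
    case (smult U c)
    show ?case
    proof (clarify)
      fix F i p assume "(F, i, p) \<in> c \<odot>\<^bsub>?M\<^esub> U"
      then obtain Y where \<E>: "short_exact C T F P i p" and Y: "Y \<in> U"
        and sm: "is_ext_smult C P T c Y (F, i, p)"
        unfolding Ext1_def extensions_def by auto
      obtain E1 i1 p1 where Y1: "Y = (E1, i1, p1)" by (metis prod_cases3)
      obtain g where g: "g \<in> mor C E1 F" "p \<bullet> g = p1" using sm unfolding is_ext_smult_def Y1 by auto
      obtain h1 where h1: "arr h1 (src e) E1" "p1 \<bullet> h1 = e" using smult.IH Y Y1 by blast
      have p: "src p = F" "arrow p" using \<E> kernelD(1) unfolding short_exact_iff by blast+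
      then have F: "F \<in> Ob C" by auto
      have a: "arrow g" "src g = E1" "tgt g = F" using g F h1 by (simp_all add: mor_iff)
      have "p \<bullet> (g \<bullet> h1) = p1 \<bullet> h1" by (rule comp_reduce[OF g(2)]) (use a p h1 in simp_all)
      then show "\<exists>h. arr h (src e) F \<and> p \<bullet> h = e"
        using a F h1 by (intro exI[of _ "g \<bullet> h1"]) simp
    qed
  qed
  have "factors_through e p" if \<E>: "short_exact C T F P i p" for F i p
  proof -
    have t: "(F, i, p) \<in> ?\<E>" using \<E> unfolding extensions_def by simp
    then have "?R `` {(F, i, p)} \<in> carrier ?M" unfolding Ext1_def quotient_def by auto
    then have "?R `` {(F, i, p)} \<in> lin_span ?M S" using S by blast
    moreover have "(F, i, p) \<in> ?R `` {(F, i, p)}" using ext_equiv_refl[OF t] by blast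
    ultimately have "\<exists>h. arr h (src e) F \<and> p \<bullet> h = e" using span by blast
    moreover have "src p = F" using \<E> unfolding short_exact_iff by blast
    ultimately show ?thesis unfolding factors_through_def by blast
  qed
  then show ?thesis using that e by blast
qed

lemma simple_representatives:
  obtains \<R> where "finite \<R>" "\<And>T. T \<in> \<R> \<Longrightarrow> simple_object C T"
    "\<And>T. simple_object C T \<Longrightarrow> \<exists>T' \<in> \<R>. \<exists>g. iso g \<and> src g = T' \<and> tgt g = T"
proof -
  let ?Q = "{T. simple_object C T} // simple_iso_rel C"
  have "\<forall>V\<in>?Q. \<exists>T. simple_object C T \<and> V = simple_iso_rel C `` {T}"
    unfolding quotient_def by blast
  then obtain r where r: "\<forall>V\<in>?Q. simple_object C (r V) \<and> V = simple_iso_rel C `` {r V}"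
    by (rule bchoice[THEN exE])
  have "\<exists>T' \<in> r ` ?Q. \<exists>g. iso g \<and> src g = T' \<and> tgt g = T" if T: "simple_object C T" for T
  proof -
    let ?V = "simple_iso_rel C `` {T}"
    have V: "?V \<in> ?Q" using T unfolding quotient_def by blast
    have TO: "T \<in> Ob C" using T by simp
    have "isomorphic C T T" unfolding isomorphic_def
      using TO isomorphism_iff[OF TO TO, of "ident C T"] iso_ident by auto
    then have "T \<in> ?V" unfolding simple_iso_rel_def using T by auto
    then have "(r ?V, T) \<in> simple_iso_rel C" using r V by blast
    then obtain g where g: "r ?V \<in> Ob C" "isomorphism C (r ?V) T g"
      unfolding simple_iso_rel_def isomorphic_def by blast
    then have "iso g \<and> src g = r ?V \<and> tgt g = T" using isomorphism_iff[OF g(1) TO] by blast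
    then show ?thesis using V by blast
  qed
  moreover have "finite (r ` ?Q)" using finite_simples by simp
  ultimately show ?thesis using that[of "r ` ?Q"] r by blast
qed

lemma kernel_comp_iso:
  assumes k: "kernel f k" and g: "iso g" "tgt g = src k"
  shows "kernel f (k \<bullet> g)"
proof -
  note ks = kernelD[OF k]
  obtain g' where g': "arrow g'" "src g' = tgt g" "tgt g' = src g" "g \<bullet> g' = ident C (tgt g)"
    using isoD[OF g(1)] by metis
  note gs = iso_mon_epi[OF g(1)]
  show ?thesis unfolding kernel_iff
  proof (intro conjI allI impI)
    show "mon (k \<bullet> g)" using mon_comp[OF gs(2) ks(2)] g by simp
    have "f \<bullet> (k \<bullet> g) = zero_mor C (src k) (tgt f) \<bullet> g"
      by (rule comp_reduce[OF ks(5)]) (use ks gs g in simp_all)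
    then show "f \<bullet> (k \<bullet> g) = zero_mor C (src (k \<bullet> g)) (tgt f)" using ks gs g by simp
    fix x assume x: "arrow x" "tgt x = src f" "f \<bullet> x = zero_mor C (src x) (tgt f)"
    then obtain u where u: "arrow u" "src u = src x" "tgt u = src k" "k \<bullet> u = x"
      using kernel_lift[OF k] by blast
    have "g \<bullet> (g' \<bullet> u) = ident C (tgt g) \<bullet> u"
      by (rule comp_reduce[OF g'(4)]) (use gs g' u g in simp_all)
    then have "(k \<bullet> g) \<bullet> (g' \<bullet> u) = x" using u gs g' g ks by simp
    then show "\<exists>u. arr u (src x) (src (k \<bullet> g)) \<and> (k \<bullet> g) \<bullet> u = x"
      using u g' gs g ks x(1) by (intro exI[of _ "g' \<bullet> u"]) simp
  qed (use ks gs g in simp_all)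
qed

lemma simple_cover:
  assumes P: "P \<in> Ob C"
  obtains e where "epi e" "tgt e = P"
    "\<And>f i. epi f \<Longrightarrow> tgt f = P \<Longrightarrow> kernel f i \<Longrightarrow> simple_object C (src i) \<Longrightarrow> factors_through e f"
proof -
  obtain \<R> where \<R>: "finite \<R>" "\<And>T. T \<in> \<R> \<Longrightarrow> simple_object C T"
    "\<And>T. simple_object C T \<Longrightarrow> \<exists>T' \<in> \<R>. \<exists>g. iso g \<and> src g = T' \<and> tgt g = T"
    using simple_representatives by blast
  have "\<forall>T\<in>\<R>. \<exists>e. epi e \<and> tgt e = P \<and> (\<forall>F i p. short_exact C T F P i p \<longrightarrow> factors_through e p)"
    using ext_cover[OF P] \<R>(2) simple_Ob by metis
  then obtain c where c: "\<forall>T\<in>\<R>. epi (c T) \<and> tgt (c T) = P \<and>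
      (\<forall>F i p. short_exact C T F P i p \<longrightarrow> factors_through (c T) p)"
    by (rule bchoice[THEN exE])
  obtain e where e: "epi e" "tgt e = P" and fe: "\<And>p. p \<in> c ` \<R> \<Longrightarrow> factors_through e p"
    using common_refinement[of "c ` \<R>" P] P \<R>(1) c by blast
  have "factors_through e f"
    if f: "epi f" "tgt f = P" "kernel f i" "simple_object C (src i)" for f i
  proof -
    obtain T g where T: "T \<in> \<R>" "iso g" "src g = T" "tgt g = src i" using \<R>(3)[OF f(4)] by blast
    note ki = kernelD[OF f(3)] and gs = iso_mon_epi[OF T(2)]
    have "short_exact C (src (i \<bullet> g)) (src f) (tgt f) (i \<bullet> g) f"
      by (rule short_exact_epi[OF f(1) kernel_comp_iso[OF f(3) T(2,4)]])
    then have "short_exact C T (src f) P (i \<bullet> g) f" using ki gs T f by simp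
    then have "factors_through (c T) f" using c T by blast
    then obtain h where h: "arrow h" "src h = src (c T)" "tgt h = src f" "f \<bullet> h = c T"
      using factors_throughE by blast
    obtain h' where h': "arrow h'" "src h' = src e" "tgt h' = src (c T)" "c T \<bullet> h' = e"
      using fe T factors_throughE by blast
    have "f \<bullet> (h \<bullet> h') = c T \<bullet> h'" by (rule comp_reduce[OF h(4)]) (use h h' ki in simp_all)
    then show ?thesis by - (rule factors_throughI[of "h \<bullet> h'"], use h h' in simp_all)
  qed
  then show ?thesis using that e by blast
qed

text \<open>Pull \<open>f\<close> back along \<open>e\<close>. Pushing \<open>f\<close> forward along a projection of its kernel \<open>K\<close> onto a simple
  summand gives an extension through which \<open>e\<close> factors; comparing the two maps from the fibre
  product to this extension extends the projection from \<open>K\<close> to the fibre product. Together these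
  extensions form a retraction onto \<open>K\<close>, so that the pulled back extension splits.\<close>

lemma semisimple_cover:
  assumes P: "P \<in> Ob C"
  obtains e where "epi e" "tgt e = P"
    "\<And>f i. epi f \<Longrightarrow> tgt f = P \<Longrightarrow> kernel f i \<Longrightarrow> semisimple_object C (src i) \<Longrightarrow> factors_through e f"
proof -
  obtain e where e: "epi e" "tgt e = P" and simple_lift:
    "\<And>f i. epi f \<Longrightarrow> tgt f = P \<Longrightarrow> kernel f i \<Longrightarrow> simple_object C (src i) \<Longrightarrow> factors_through e f"
    using simple_cover[OF P] by blast
  have ea: "arrow e" using e by simp
  have "factors_through e f"
    if f: "epi f" "tgt f = P" and i: "kernel f i" and ss: "semisimple_object C (src i)" for f i
  proof -
    note ki = kernelD[OF i]
    let ?K = "src i"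
    obtain m T \<iota> \<pi> where T: "\<And>j. j < m \<Longrightarrow> simple_object C (T j)" and ds: "is_direct_sum C m T ?K \<iota> \<pi>"
      using ss unfolding semisimple_object_def by blast
    note d = direct_sumD[OF ds]
    obtain q r where pb: "pullback f e q r" and r': "epi f \<Longrightarrow> epi r"
      using pullback_exists[of f e] ki(1) ea e f by metis
    note ps = pullbackD[OF pb] and er = r'[OF f(1)]
    obtain k where k: "kernel r k" "src k = ?K" "q \<bullet> k = i" using pullback_kernel[OF pb i] by blast
    note ks = kernelD[OF k(1)]
    have "\<exists>\<rho>. arr \<rho> (src r) (T j) \<and> \<rho> \<bullet> k = \<pi> j" if j: "j < m" for j
    proof -
      have \<pi>: "arrow (\<pi> j)" "src (\<pi> j) = ?K" "tgt (\<pi> j) = T j"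
        and \<iota>: "arrow (\<iota> j)" "src (\<iota> j) = T j" "tgt (\<iota> j) = ?K" using d(2)[OF j] by auto
      have ep: "epi (\<pi> j)" using epi_if_right_inverse[OF \<pi>(1) \<iota>(1)] d(3)[OF j] \<pi> \<iota> by simp
      obtain n where n: "kernel (\<pi> j) n" using kernel_exists[OF \<pi>(1)] by blast
      obtain c t p where c: "epi c" "src c = src f" and p: "epi p" "src p = tgt c" "tgt p = tgt f"
        "p \<bullet> c = f" and t: "kernel p t" "src t = T j" "t \<bullet> \<pi> j = c \<bullet> i"
        using pushforward_extension[OF f(1) i ep \<pi>(2) n] \<pi>(3) by metis
      note ts = kernelD[OF t(1)]
      have ca: "arrow c" and pa: "arrow p" using c p by auto
      obtain h where h: "arrow h" "src h = src e" "tgt h = src p" "p \<bullet> h = e"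
        using simple_lift[OF p(1) _ t(1)] p f T[OF j] t factors_throughE by metis
      \<comment> \<open>Both \<open>c q\<close> and \<open>h r\<close> lie over the same map to \<open>P\<close>; their difference lands in the simple kernel \<open>t\<close>.\<close>
      let ?w = "c \<bullet> q \<^bold>- h \<bullet> r"
      have cq: "arrow (c \<bullet> q)" "src (c \<bullet> q) = src r" "tgt (c \<bullet> q) = tgt c"
        and hr: "arrow (h \<bullet> r)" "src (h \<bullet> r) = src r" "tgt (h \<bullet> r) = tgt c"
        using ca c ps h p by simp_all
      have w: "arrow ?w" "src ?w = src r" "tgt ?w = tgt c" using cq hr by simp_all
      have "p \<bullet> (c \<bullet> q) = f \<bullet> q" by (rule comp_reduce[OF p(4)]) (use pa ca c p ps in simp_all)
      also have "\<dots> = e \<bullet> r" by (rule ps(9))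
      also have "\<dots> = p \<bullet> (h \<bullet> r)"
        by (rule comp_reduce[OF h(4), symmetric]) (use pa h ps in simp_all)
      finally have "p \<bullet> ?w = zero_mor C (src ?w) (tgt p)"
        using comp_minus_left[of "c \<bullet> q" "h \<bullet> r" p] minus_eq_zero_iff[of "p \<bullet> (c \<bullet> q)" "p \<bullet> (h \<bullet> r)"]
          cq hr pa p w by simp
      then obtain \<rho> where \<rho>: "arrow \<rho>" "src \<rho> = src r" "tgt \<rho> = T j" "t \<bullet> \<rho> = ?w"
        using kernel_lift[OF t(1) w(1)] w p t by metis
      have hrk: "(h \<bullet> r) \<bullet> k = zero_mor C (src k) (tgt c)"
        using h ps ks p by simp
      have cqk: "(c \<bullet> q) \<bullet> k = c \<bullet> i" using k ca c ps ks by simp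
      have "t \<bullet> (\<rho> \<bullet> k) = ?w \<bullet> k" by (rule comp_reduce[OF \<rho>(4)]) (use ts t \<rho> ks in simp_all)
      also have "\<dots> = (c \<bullet> q) \<bullet> k \<^bold>- (h \<bullet> r) \<bullet> k"
        by (rule comp_minus_right) (use cq hr ks in simp_all)
      also have "\<dots> = c \<bullet> i"
        unfolding hrk cqk using ca c ki k by simp
      finally have "t \<bullet> (\<rho> \<bullet> k) = t \<bullet> \<pi> j" using t by simp
      then have "\<rho> \<bullet> k = \<pi> j" by - (rule mon_cancel[OF ts(2)], use \<rho> ks k \<pi> t in simp_all)
      then show ?thesis using \<rho> d(2)[OF j] ps(4) by (intro exI[of _ \<rho>]) simp
    qed
    then obtain \<rho> where \<rho>: "\<And>j. j < m \<Longrightarrow> arr (\<rho> j) (src r) (T j) \<and> \<rho> j \<bullet> k = \<pi> j" by metis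
    have rO: "src r \<in> Ob C" using ps by simp
    have \<rho>': "\<And>j. j < m \<Longrightarrow> arr (\<rho> j) (src r) (T j)" using \<rho> by blast
    obtain s where s: "arrow s" "src s = src r" "tgt s = ?K" "\<And>j. j < m \<Longrightarrow> \<pi> j \<bullet> s = \<rho> j"
      using direct_sum_pairing[OF ds rO \<rho>'] by blast
    have sk: "s \<bullet> k = ident C ?K"
    proof (rule jointly_monic_cancel[OF direct_sum_jointly_monic[OF ds]])
      fix \<phi> assume "\<phi> \<in> \<pi> ` {..<m}"
      then obtain j where j: "j < m" "\<phi> = \<pi> j" by blast
      have "\<pi> j \<bullet> (s \<bullet> k) = \<rho> j \<bullet> k"
        by (rule comp_reduce[OF s(4)[OF j(1)]]) (use d(2)[OF j(1)] s ks in simp_all)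
      then show "\<phi> \<bullet> (s \<bullet> k) = \<phi> \<bullet> ident C ?K" using \<rho>[OF j(1)] d(2)[OF j(1)] j by simp
    next
      fix \<phi> assume "\<phi> \<in> \<pi> ` {..<m}"
      then show "arrow \<phi> \<and> src \<phi> = ?K" using d(2) by auto
    qed (use s ks k ki in simp_all)
    let ?z = "q \<^bold>- i \<bullet> s"
    have ki': "arrow (i \<bullet> s)" "src (i \<bullet> s) = src r" "tgt (i \<bullet> s) = src f" using ki s by simp_all
    have z: "arrow ?z" "src ?z = src r" "tgt ?z = src f" using ki' ps by simp_all
    have "?z \<bullet> k = q \<bullet> k \<^bold>- (i \<bullet> s) \<bullet> k" by (rule comp_minus_right) (use ki' ps ks in simp_all)
    also have "(i \<bullet> s) \<bullet> k = i" using sk s ki ks by simp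
    also have "q \<bullet> k \<^bold>- i = zero_mor C (src k) (tgt ?z)"
      using minus_eq_zero_iff[of i i] k ki z by simp
    finally obtain h where h: "arrow h" "src h = tgt r" "tgt h = src f" "h \<bullet> r = ?z"
      using cokernel_lift[OF cokernel_of_kernel[OF er k(1)] z(1)] z ks by metis
    have "(f \<bullet> h) \<bullet> r = f \<bullet> ?z" using h ki ps by simp
    also have "\<dots> = f \<bullet> q \<^bold>- f \<bullet> (i \<bullet> s)" by (rule comp_minus_left) (use ki' ki ps in simp_all)
    also have "f \<bullet> (i \<bullet> s) = zero_mor C ?K (tgt f) \<bullet> s"
      by (rule comp_reduce[OF ki(5)]) (use ki s in simp_all)
    also have "f \<bullet> q \<^bold>- zero_mor C ?K (tgt f) \<bullet> s = f \<bullet> q" using ki s ps(1-8) by simp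
    also have "\<dots> = e \<bullet> r" by (rule ps(9))
    finally have "f \<bullet> h = e" by (rule epi_cancel[OF er]) (use h ki ps e f in simp_all)
    then show ?thesis by - (rule factors_throughI[of h], use h ps in simp_all)
  qed
  then show ?thesis using that e by blast
qed

text \<open>Iterating the construction deals with kernels of larger Loewy length: first lift modulo
  the next step of a Loewy filtration of the kernel, then along the remaining extension, pulled back
  to the first cover.\<close>

lemma loewy_cover:
  assumes "P \<in> Ob C"
  obtains e where "epi e" "tgt e = P"
    "\<And>f i. epi f \<Longrightarrow> tgt f = P \<Longrightarrow> kernel f i \<Longrightarrow> loewy_le j (src i) \<Longrightarrow> factors_through e f"
proof -
  have "\<exists>e. epi e \<and> tgt e = P \<and>
      (\<forall>f i. epi f \<longrightarrow> tgt f = P \<longrightarrow> kernel f i \<longrightarrow> loewy_le j (src i) \<longrightarrow> factors_through e f)"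
    using assms
  proof (induction j arbitrary: P)
    case 0
    have "factors_through (ident C P) f"
      if f: "epi f" "tgt f = P" "kernel f i" "zero_object C (src i)" for f i
    proof -
      note ki = kernelD[OF f(3)]
      have "mon f" unfolding mon_def
      proof (intro conjI allI impI ki(1))
        fix x assume x: "arrow x" "tgt x = src f" "f \<bullet> x = zero_mor C (src x) (tgt f)"
        then obtain u where u: "arrow u" "src u = src x" "tgt u = src i" "i \<bullet> u = x"
          using kernel_lift[OF f(3)] by blast
        have "u = zero_mor C (src x) (src i)" using zero_objectD(2)[OF f(4) u(1,3)] u by simp
        then have "i \<bullet> u = zero_mor C (src x) (tgt i)" using ki x by simp
        then show "x = zero_mor C (src x) (src f)" using u ki by simp
      qed
      then have "iso f" using iso_if_mon_epi f by blast
      then obtain g where "arrow g" "src g = tgt f" "tgt g = src f" "f \<bullet> g = ident C (tgt f)"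
        using isoD by metis
      then show ?thesis using f 0 by - (rule factors_throughI[of g], simp_all)
    qed
    then show ?case using iso_mon_epi(3)[OF iso_ident[OF 0]] 0
      by (intro exI[of _ "ident C P"]) simp
  next
    case (Suc j)
    \<comment> \<open>The cover \<open>e\<close> handles the top layer of the kernel, and \<open>d\<close> the \<open>j\<close> layers below.\<close>
    obtain e where e: "epi e" "tgt e = P" and ss_lift:
      "\<And>f i. epi f \<Longrightarrow> tgt f = P \<Longrightarrow> kernel f i \<Longrightarrow> semisimple_object C (src i) \<Longrightarrow> factors_through e f"
      using semisimple_cover[OF Suc.prems] by blast
    have ea: "arrow e" using e by simp
    then have "src e \<in> Ob C" by simp
    then obtain d where d: "epi d" "tgt d = src e" and d_lift:
      "\<forall>f i. epi f \<longrightarrow> tgt f = src e \<longrightarrow> kernel f i \<longrightarrow> loewy_le j (src i) \<longrightarrow> factors_through d f"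
      using Suc.IH by blast
    have da: "arrow d" using d by simp
    have ed: "epi (e \<bullet> d)" "src (e \<bullet> d) = src d" "tgt (e \<bullet> d) = P" using epi_comp[OF d(1) e(1)] d da ea e by simp_all
    have "factors_through (e \<bullet> d) f"
      if f: "epi f" "tgt f = P" and i: "kernel f i" and l: "loewy_le (Suc j) (src i)" for f i
    proof -
      note ki = kernelD[OF i]
      obtain \<Phi> k where \<Phi>: "to_simples (src i) \<Phi>" and k: "joint_kernel (src i) \<Phi> k"
        and lk: "loewy_le j (src k)" using l by auto
      note ks = joint_kernelD[OF k]
      obtain g where g: "cokernel k g" using cokernel_exists[OF ks(2)] by blast
      note gs = cokernelD[OF g]
      have ss: "semisimple_object C (tgt g)" using coimage_semisimple[OF \<Phi> k g] .
      have sg: "src g = src i" using gs ks by simp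
      obtain c t p where c: "kernel c (i \<bullet> k)" "epi c" "src c = src f" and p: "epi p" "src p = tgt c"
        "tgt p = tgt f" "p \<bullet> c = f" and t: "kernel p t" "src t = tgt g"
        using pushforward_extension[OF f(1) i gs(2) sg kernel_of_cokernel[OF ks(1) g]] by metis
      have pa: "arrow p" and ca: "arrow c" using p c by auto
      obtain h where h: "arrow h" "src h = src e" "tgt h = src p" "p \<bullet> h = e"
        using ss_lift[OF p(1) _ t(1)] p f ss t factors_throughE by metis
      obtain q r where pb: "pullback c h q r" and r': "epi c \<Longrightarrow> epi r"
        using pullback_exists[of c h] ca h p by metis
      note ps = pullbackD[OF pb] and er = r'[OF c(2)]
      obtain k' where k': "kernel r k'" "src k' = src (i \<bullet> k)" using pullback_kernel[OF pb c(1)] by blast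
      have "loewy_le j (src k')" using k' lk ki ks by simp
      then obtain h' where h': "arrow h'" "src h' = src d" "tgt h' = src r" "r \<bullet> h' = d"
        using d_lift er k' ps h factors_throughE by metis
      have "f \<bullet> (q \<bullet> h') = p \<bullet> (c \<bullet> (q \<bullet> h'))" using p(4) assoc[of "q \<bullet> h'" c p] pa ca p h' ps c by simp
      also have "c \<bullet> (q \<bullet> h') = h \<bullet> (r \<bullet> h')" by (rule comp_reduce2[OF ps(9)]) (use ps h' in simp_all)
      also have "r \<bullet> h' = d" by (rule h'(4))
      also have "p \<bullet> (h \<bullet> d) = e \<bullet> d" by (rule comp_reduce[OF h(4)]) (use pa h da d in simp_all)
      finally show ?thesis
        by - (rule factors_throughI[of "q \<bullet> h'"], use ps h' ed c in simp_all)
    qed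
    then show ?case using ed by blast
  qed
  then show ?thesis using that by blast
qed

lemma length_le_exists:
  assumes "A \<in> Ob C" obtains k where "length_le k A"
  using semisimple_filtration_loewy_le[OF semisimple_filtrations[OF assms]] length_le_of_loewy_le
  by metis

text \<open>Among the epimorphisms onto \<open>S\<close> that factor through every other one, take one with source
  \<open>U\<close> of minimal length. The image of an endomorphism of \<open>U\<close> over \<open>S\<close> has the same property, so by
  minimality every such endomorphism is an isomorphism. Hence every epimorphism onto \<open>U\<close> splits: lift
  \<open>U \<rightarrow> S\<close> through it and compose.\<close>

lemma projective_cover_exists:
  assumes bound: "\<And>A. A \<in> Ob C \<Longrightarrow> loewy_le l A" and S: "S \<in> Ob C"
  obtains e where "epi e" "tgt e = S" "projective_object C (src e)"
proof -
  let ?W = "\<lambda>e. epi e \<and> tgt e = S \<and> (\<forall>f. epi f \<longrightarrow> tgt f = S \<longrightarrow> factors_through e f)"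
  let ?L = "\<lambda>k. \<exists>e. ?W e \<and> length_le k (src e)"
  obtain e0 where e0: "epi e0" "tgt e0 = S" and lift0:
    "\<And>f i. epi f \<Longrightarrow> tgt f = S \<Longrightarrow> kernel f i \<Longrightarrow> loewy_le l (src i) \<Longrightarrow> factors_through e0 f"
    using loewy_cover[OF S, of l] by blast
  have "factors_through e0 f" if f: "epi f" "tgt f = S" for f
  proof -
    obtain i where i: "kernel f i" using kernel_exists[OF epi_arrow[OF f(1)]] by blast
    have "src i \<in> Ob C" using kernelD(3)[OF i] by simp
    then show ?thesis using lift0[OF f i] bound by blast
  qed
  then have "?W e0" using e0 by blast
  moreover obtain k0 where "length_le k0 (src e0)" using length_le_exists[of "src e0"] e0 by auto
  ultimately have "?L k0" by blast
  define k where "k = (LEAST k. ?L k)"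
  have k: "?L k" unfolding k_def using \<open>?L k0\<close> by (rule LeastI)
  have min: "k \<le> k'" if "?L k'" for k' unfolding k_def using that by (rule Least_le)
  obtain e where e: "epi e" "tgt e = S" and e_lift: "\<And>f. epi f \<Longrightarrow> tgt f = S \<Longrightarrow> factors_through e f"
    and lk: "length_le k (src e)" using k by blast
  let ?U = "src e"
  have ea: "arrow e" using e by simp
  have endo_iso: "iso g" if g: "arrow g" "src g = ?U" "tgt g = ?U" "e \<bullet> g = e" for g
  proof -
    obtain q m where qm: "epi q" "mon m" "src q = src g" "tgt q = src m" "tgt m = tgt g" "m \<bullet> q = g"
      using image_factorization[OF g(1)] by blast
    have em: "arrow (e \<bullet> m)" "src (e \<bullet> m) = src m" "tgt (e \<bullet> m) = S" using qm g ea e by simp_all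
    have "(e \<bullet> m) \<bullet> q = e" using qm g ea by simp
    then have "epi (e \<bullet> m)" using epi_if_comp_epi[of "e \<bullet> m" q] e em qm by simp
    moreover have "factors_through (e \<bullet> m) f" if f: "epi f" "tgt f = S" for f
    proof -
      obtain h where h: "arrow h" "src h = src e" "tgt h = src f" "f \<bullet> h = e"
        using e_lift[OF f] factors_throughE by blast
      have "f \<bullet> (h \<bullet> m) = e \<bullet> m" by (rule comp_reduce[OF h(4)]) (use h qm g f in simp_all)
      then show ?thesis by - (rule factors_throughI[of "h \<bullet> m"], use h qm g em in simp_all)
    qed
    ultimately have W: "?W (e \<bullet> m)" using em by blast
    have kmin: "k \<le> k'" if "length_le k' (src m)" for k'
      by (rule min, rule exI[of _ "e \<bullet> m"]) (use W that em(2) in simp)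
    have "\<exists>k'\<le>k. length_le k' (tgt q) \<and> (mon q \<or> k' < k)"
      using length_le_quotient[OF qm(1), of k] lk qm g by simp
    then have "mon q" using kmin qm by (metis not_le)
    moreover have "\<exists>k'\<le>k. length_le k' (src m) \<and> (iso m \<or> k' < k)"
      using length_le_subobject[OF qm(2), of k] lk qm g by simp
    then have "iso m" using kmin by (metis not_le)
    ultimately have "mon (m \<bullet> q)" "epi (m \<bullet> q)"
      using mon_comp[of q m] epi_comp[of q m] iso_mon_epi[of m] qm by simp_all
    then show ?thesis using iso_if_mon_epi qm by simp
  qed
  have "projective_object C ?U"
    unfolding projective_object_def
  proof (intro conjI ballI allI impI)
    show U: "?U \<in> Ob C" using ea by simp
    fix T Y p f assume T: "T \<in> Ob C" and Y: "Y \<in> Ob C" and pf: "epic C T Y p \<and> f \<in> mor C ?U Y"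
    then have p: "epi p" "src p = T" "tgt p = Y" and f: "arrow f" "src f = ?U" "tgt f = Y"
      using epic_iff[OF T Y] U by (simp_all add: mor_iff)
    obtain q r where pb: "pullback p f q r" and r': "epi p \<Longrightarrow> epi r"
      using pullback_exists[of p f] p f epi_arrow by metis
    note ps = pullbackD[OF pb] and er = r'[OF p(1)]
    have "epi (e \<bullet> r)" "tgt (e \<bullet> r) = S" "src (e \<bullet> r) = src r"
      using epi_comp[OF er e(1)] ps f ea e by simp_all
    then obtain g where g: "arrow g" "src g = ?U" "tgt g = src r" "(e \<bullet> r) \<bullet> g = e"
      using e_lift[of "e \<bullet> r"] factors_throughE by metis
    have "iso (r \<bullet> g)" by (rule endo_iso) (use g ps f ea in simp_all)
    then obtain s where s: "arrow s" "src s = ?U" "tgt s = ?U" "(r \<bullet> g) \<bullet> s = ident C ?U"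
      using isoD[of "r \<bullet> g"] g ps f by (metis arrow_comp(2,3))
    have "p \<bullet> (q \<bullet> (g \<bullet> s)) = f \<bullet> (r \<bullet> (g \<bullet> s))"
      by (rule comp_reduce2[OF ps(9)]) (use ps g s in simp_all)
    also have "r \<bullet> (g \<bullet> s) = ident C ?U" using s g ps by simp
    finally have "p \<bullet> (q \<bullet> (g \<bullet> s)) = f" using f by simp
    moreover have "q \<bullet> (g \<bullet> s) \<in> mor C ?U T" using ps g s p U T by (simp add: mor_iff)
    ultimately show "\<exists>g\<in>mor C ?U T. p \<bullet> g = f" by blast
  qed
  then show ?thesis using that e by blast
qed

text \<open>A projective object \<open>U\<close> with an epimorphism onto the direct sum of representatives of the simple
  objects maps nontrivially to every simple object, hence to the image of every nonzero morphism,
  which contains a simple object.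
  By projectivity the map to the image lifts to the source of the morphism, so that morphisms are
  distinguished by composition with morphisms from \<open>U\<close>.\<close>

lemma projective_generator_if_loewy_bounded:
  assumes bound: "\<And>A. A \<in> Ob C \<Longrightarrow> loewy_le l A"
  obtains P where "projective_generator C P"
proof -
  obtain \<R> where \<R>: "finite \<R>" "\<And>T. T \<in> \<R> \<Longrightarrow> simple_object C T"
    "\<And>T. simple_object C T \<Longrightarrow> \<exists>T' \<in> \<R>. \<exists>g. iso g \<and> src g = T' \<and> tgt g = T"
    using simple_representatives by blast
  obtain T and m :: nat where T: "bij_betw T {..<m} \<R>"
    using ex_bij_betw_nat_finite[OF \<R>(1)] unfolding atLeast0LessThan by blast
  have "\<exists>S \<iota> \<pi>. is_direct_sum C m T S \<iota> \<pi>"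
    by (rule direct_sums) (use T \<R>(2) in \<open>auto simp: bij_betw_def\<close>)
  then obtain S \<iota> \<pi> where ds: "is_direct_sum C m T S \<iota> \<pi>" by blast
  note d = direct_sumD[OF ds]
  obtain e where e: "epi e" "tgt e = S" and proj: "projective_object C (src e)"
    using projective_cover_exists[OF bound d(1)] by blast
  have ea: "arrow e" using e by simp
  let ?U = "src e"
  have U: "?U \<in> Ob C" using ea by simp
  have "generator C ?U" unfolding generator_def
  proof (intro conjI ballI impI U)
    fix A B f g assume A: "A \<in> Ob C" and B: "B \<in> Ob C" and fg: "f \<in> mor C A B" "g \<in> mor C A B"
      and eq: "\<forall>h\<in>mor C ?U A. f \<bullet> h = g \<bullet> h"
    have f: "arrow f" "src f = A" "tgt f = B" and g: "arrow g" "src g = A" "tgt g = B"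
      using fg A B by (simp_all add: mor_iff)
    let ?d = "f \<^bold>- g"
    have da: "arrow ?d" "src ?d = A" "tgt ?d = B" using f g by simp_all
    have dz: "?d = zero_mor C A B \<longleftrightarrow> f = g" using minus_eq_zero_iff[of f g] f g by simp
    obtain q n where qn: "epi q" "mon n" "src q = A" "tgt q = src n" "tgt n = B" "n \<bullet> q = ?d"
      using image_factorization[OF da(1)] da by metis
    show "f = g"
    proof (rule ccontr)
      assume "f \<noteq> g"
      then have dn: "?d \<noteq> zero_mor C A B" using dz by blast
      have "\<not> zero_object C (src n)"
      proof
        assume z: "zero_object C (src n)"
        have "q = zero_mor C A (src n)" using zero_objectD(2)[OF z, of q] qn by simp
        then have "n \<bullet> q = zero_mor C A B" using qn A by simp
        then show False using dn qn by simp
      qed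
      moreover obtain k where "length_le k (src n)" using length_le_exists[of "src n"] qn by auto
      ultimately obtain x where x: "arrow x" "simple_object C (src x)" "tgt x = src n"
        "x \<noteq> zero_mor C (src x) (src n)" using simple_subobject_exists by metis
      obtain T' s where "T' \<in> \<R>" and s: "iso s" "src s = T'" "tgt s = src x" using \<R>(3)[OF x(2)] by blast
      then obtain j where j: "j < m" "T' = T j" using T unfolding bij_betw_def by auto
      have \<pi>: "arrow (\<pi> j)" "src (\<pi> j) = S" "tgt (\<pi> j) = T j"
        and \<iota>: "arrow (\<iota> j)" "src (\<iota> j) = T j" "tgt (\<iota> j) = S" using d(2)[OF j(1)] by auto
      have ep: "epi (\<pi> j)" using epi_if_right_inverse[OF \<pi>(1) \<iota>(1)] d(3)[OF j(1)] \<pi> \<iota> by simp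
      note ss = iso_mon_epi[OF s(1)]
      have "epi (\<pi> j \<bullet> e)" using epi_comp[OF e(1) ep] \<pi> e by simp
      then have es: "epi (s \<bullet> (\<pi> j \<bullet> e))" using epi_comp[OF _ ss(3), of "\<pi> j \<bullet> e"] \<pi> e ea s j by simp
      let ?y = "x \<bullet> (s \<bullet> (\<pi> j \<bullet> e))"
      have yt: "src (s \<bullet> (\<pi> j \<bullet> e)) = ?U" "tgt (s \<bullet> (\<pi> j \<bullet> e)) = src x"
        using ss s \<pi> e ea j by simp_all
      have y: "arrow ?y" "src ?y = ?U" "tgt ?y = src n" using x yt es by simp_all
      have yn: "?y \<noteq> zero_mor C ?U (src n)" using epiD[OF es x(1)] x yt by auto
      obtain z where z: "z \<in> mor C ?U A" "q \<bullet> z = ?y"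
      proof -
        have n: "src n \<in> Ob C" using qn by simp
        have "epic C A (src n) q" using epic_iff[OF A n] qn by simp
        moreover have "?y \<in> mor C ?U (src n)" using y U n by (simp add: mor_iff)
        ultimately show ?thesis using proj that A n unfolding projective_object_def by blast
      qed
      have za: "arrow z" "src z = ?U" "tgt z = A" using z U A by (simp_all add: mor_iff)
      have "n \<bullet> ?y = ?d \<bullet> z"
        using comp_reduce[OF qn(6), of z] z(2) qn za by simp
      also have "\<dots> = f \<bullet> z \<^bold>- g \<bullet> z" by (rule comp_minus_right) (use f g za in simp_all)
      also have "\<dots> = zero_mor C ?U B"
        using minus_eq_zero_iff[of "f \<bullet> z" "g \<bullet> z"] eq z(1) f g za by simp
      finally have "?y = zero_mor C ?U (src n)" using monD[OF qn(2), of ?y] y qn by simp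
      then show False using yn by blast
    qed
  qed
  then show ?thesis using that proj unfolding projective_generator_def by blast
qed

end

section \<open>Generators\<close>

context linear_category
begin

lemma lin_span_comp_zero_left:
  assumes o: "A \<in> Ob C" "B \<in> Ob C" and S: "S \<subseteq> mor C A B" and x: "arrow x" "src x = B"
    and z: "\<And>g. g \<in> S \<Longrightarrow> x \<bullet> g = zero_mor C A (tgt x)"
    and g: "g \<in> lin_span (Hom C A B) S"
  shows "x \<bullet> g = zero_mor C A (tgt x)"
proof -
  let ?D = "tgt x"
  have D: "?D \<in> Ob C" and xm: "x \<in> mor C B ?D" using x arrow_src_tgt[OF x(1)] by auto
  interpret AB: module "ring_of_type_algebra :: 'k ring" "Hom C A B" by (rule Hom_module[OF o])
  interpret AD: module "ring_of_type_algebra :: 'k ring" "Hom C A ?D" by (rule Hom_module[OF o(1) D])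
  have k: "a \<in> carrier (ring_of_type_algebra :: 'k ring)" for a
    by (simp add: ring_of_type_algebra_def)
  have "g \<in> mor C A B \<and> x \<bullet> g = zero_mor C A ?D"
    using g
  proof (induction rule: lin_span.induct)
    case (base g)
    then show ?case using S z by blast
  next
    case zero
    then show ?case using comp_zero(2)[OF x(1) o(1)] x by simp
  next
    case (add g h)
    then show ?case using comp_add_right[OF o D _ _ xm, of g h] by simp
  next
    case (smult g a)
    then show ?case using comp_smult_right[OF o D _ xm, of g a] k by simp
  qed
  then show ?thesis by blast
qed

lemma lin_span_comp_zero_right:
  assumes o: "A \<in> Ob C" "B \<in> Ob C" and S: "S \<subseteq> mor C A B" and x: "arrow x" "tgt x = A"
    and z: "\<And>g. g \<in> S \<Longrightarrow> g \<bullet> x = zero_mor C (src x) B"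
    and g: "g \<in> lin_span (Hom C A B) S"
  shows "g \<bullet> x = zero_mor C (src x) B"
proof -
  let ?D = "src x"
  have D: "?D \<in> Ob C" and xm: "x \<in> mor C ?D A" using x arrow_src_tgt[OF x(1)] by auto
  interpret AB: module "ring_of_type_algebra :: 'k ring" "Hom C A B" by (rule Hom_module[OF o])
  interpret DB: module "ring_of_type_algebra :: 'k ring" "Hom C ?D B" by (rule Hom_module[OF D o(2)])
  have k: "a \<in> carrier (ring_of_type_algebra :: 'k ring)" for a
    by (simp add: ring_of_type_algebra_def)
  have "g \<in> mor C A B \<and> g \<bullet> x = zero_mor C ?D B"
    using g
  proof (induction rule: lin_span.induct)
    case (base g)
    then show ?case using S z by blast
  next
    case zero
    then show ?case using comp_zero(1)[OF x(1) o(2)] x by simp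
  next
    case (add g h)
    then show ?case using comp_add_left[OF D o xm, of g h] by simp
  next
    case (smult g a)
    then show ?case using comp_smult_left[OF D o xm, of g a] k by simp
  qed
  then show ?thesis by blast
qed

end

context finite_length_category
begin

text \<open>A spanning family of \<open>Hom(P, A)\<close> is an epimorphism from a power of \<open>P\<close> onto \<open>A\<close>.\<close>

lemma loewy_bounded_if_generator:
  assumes P: "generator C P" and l: "loewy_le l P" and A: "A \<in> Ob C"
  shows "loewy_le l A"
proof -
  have PO: "P \<in> Ob C" using P unfolding generator_def by blast
  obtain S where S: "finite S" "S \<subseteq> mor C P A" "mor C P A \<subseteq> lin_span (Hom C P A) S"
    using Hom_finite[OF PO A] unfolding finite_dimensional_def by blast
  obtain h and m :: nat where h: "bij_betw h {..<m} S"
    using ex_bij_betw_nat_finite[OF S(1)] unfolding atLeast0LessThan by blast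
  have "\<exists>D \<iota> \<pi>. is_direct_sum C m (\<lambda>_. P) D \<iota> \<pi>" by (rule direct_sums) (rule PO)
  then obtain D \<iota> \<pi> where D: "is_direct_sum C m (\<lambda>_. P) D \<iota> \<pi>" by blast
  note d = direct_sumD[OF D]
  have hm: "arr (h j) P A" if "j < m" for j
    using h that S(2) PO A by (intro arrI) (auto simp: bij_betw_def)
  obtain u where u: "arrow u" "src u = D" "tgt u = A" "\<And>j. j < m \<Longrightarrow> u \<bullet> \<iota> j = h j"
    by (rule direct_sum_copairing[OF D A, of h]) (use hm in blast)+
  have "epi u" unfolding epi_def
  proof (intro conjI allI impI u(1))
    fix x assume x: "arrow x" "src x = tgt u" "x \<bullet> u = zero_mor C (src u) (tgt x)"
    have xA: "src x = A" and T: "tgt x \<in> Ob C" using x u by simp_all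
    have xS: "x \<bullet> g = zero_mor C P (tgt x)" if "g \<in> S" for g
    proof -
      have "g \<in> h ` {..<m}" using h that by (simp add: bij_betw_def)
      then obtain j where j: "j < m" "g = h j" by blast
      have \<iota>: "arrow (\<iota> j)" "src (\<iota> j) = P" "tgt (\<iota> j) = D" using d(2)[OF j(1)] by auto
      have "x \<bullet> (u \<bullet> \<iota> j) = zero_mor C (src u) (tgt x) \<bullet> \<iota> j"
        by (rule comp_reduce[OF x(3)]) (use x u \<iota> in simp_all)
      then show ?thesis using u j \<iota> T by simp
    qed
    have "x \<bullet> g = zero_mor C A (tgt x) \<bullet> g" if g: "g \<in> mor C P A" for g
    proof -
      have ga: "arrow g" "src g = P" "tgt g = A" using g PO A by (simp_all add: mor_iff)
      have "x \<bullet> g = zero_mor C P (tgt x)"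
        using lin_span_comp_zero_left[OF PO A S(2) x(1) xA xS] S(3) g by blast
      then show ?thesis using ga T by simp
    qed
    moreover have "x \<in> mor C A (tgt x)" "zero_mor C A (tgt x) \<in> mor C A (tgt x)"
      using x(1) xA A T by (simp_all add: mor_iff)
    ultimately have "x = zero_mor C A (tgt x)"
      using P A T unfolding generator_def by blast
    then show "x = zero_mor C (tgt u) (tgt x)" using u by simp
  qed
  moreover have "loewy_le l D"
  proof (rule loewy_le_jointly_monic[OF _ d(1) _ direct_sum_jointly_monic[OF D]])
    show "arrow p \<and> src p = D \<and> loewy_le l (tgt p)" if "p \<in> \<pi> ` {..<m}" for p
      using that d(2) l by auto
  qed simp
  ultimately show ?thesis using loewy_le_quotient[of u l] u by simp
qed

section \<open>Maximal semi-simple quotients\<close>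

lemma simple_semisimple:
  assumes T: "simple_object C T"
  shows "semisimple_object C T"
proof -
  have "to_simples T {ident C T}" unfolding to_simples_def using T by simp
  moreover have "jointly_monic T {ident C T}" unfolding jointly_monic_def using T by auto
  ultimately show ?thesis unfolding semisimple_iff_jointly_monic by blast
qed

text \<open>The family consists of spanning sets of the spaces \<open>Hom(A, T)\<close> for representatives \<open>T\<close> of the
  simple objects; a linear combination of morphisms that vanish on \<open>k\<close> vanishes on \<open>k\<close>.\<close>

lemma radical_family:
  assumes A: "A \<in> Ob C"
  obtains \<Phi> where "to_simples A \<Phi>"
    "\<And>k \<phi>. joint_kernel A \<Phi> k \<Longrightarrow> arrow \<phi> \<Longrightarrow> src \<phi> = A \<Longrightarrow> simple_object C (tgt \<phi>) \<Longrightarrow>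
      \<phi> \<bullet> k = zero_mor C (src k) (tgt \<phi>)"
proof -
  obtain \<R> where \<R>: "finite \<R>" "\<And>T. T \<in> \<R> \<Longrightarrow> simple_object C T"
    "\<And>T. simple_object C T \<Longrightarrow> \<exists>T' \<in> \<R>. \<exists>g. iso g \<and> src g = T' \<and> tgt g = T"
    using simple_representatives by blast
  have "\<forall>T\<in>\<R>. \<exists>S. finite S \<and> S \<subseteq> mor C A T \<and> mor C A T \<subseteq> lin_span (Hom C A T) S"
    using Hom_finite[OF A] \<R>(2) simple_Ob unfolding finite_dimensional_def by blast
  then obtain S where S: "\<forall>T\<in>\<R>. finite (S T) \<and> S T \<subseteq> mor C A T \<and> mor C A T \<subseteq> lin_span (Hom C A T) (S T)"
    by (rule bchoice[THEN exE])
  have arS: "arrow \<phi> \<and> src \<phi> = A \<and> tgt \<phi> = T" if "\<phi> \<in> S T" "T \<in> \<R>" for \<phi> T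
    using S that \<R>(2)[OF that(2)] A mor_iff[of A T \<phi>] by auto
  have "to_simples A (\<Union>T\<in>\<R>. S T)"
    unfolding to_simples_def using A \<R>(1,2) S arS by auto
  moreover have "\<phi> \<bullet> k = zero_mor C (src k) (tgt \<phi>)"
    if k: "joint_kernel A (\<Union>T\<in>\<R>. S T) k" and \<phi>: "arrow \<phi>" "src \<phi> = A" "simple_object C (tgt \<phi>)" for k \<phi>
  proof -
    note ks = joint_kernelD[OF k]
    obtain T g where T: "T \<in> \<R>" "iso g" "src g = T" "tgt g = tgt \<phi>" using \<R>(3)[OF \<phi>(3)] by blast
    have TO: "T \<in> Ob C" using \<R>(2)[OF T(1)] by simp
    obtain g' where g': "arrow g'" "src g' = tgt g" "tgt g' = src g" "g \<bullet> g' = ident C (tgt g)"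
      using isoD[OF T(2)] by metis
    note ga = iso_mon_epi(1)[OF T(2)]
    have "g' \<bullet> \<phi> \<in> mor C A T" using g' \<phi> T TO A by (simp add: mor_iff)
    then have sp: "g' \<bullet> \<phi> \<in> lin_span (Hom C A T) (S T)" using S T(1) by blast
    have ST: "S T \<subseteq> mor C A T" using S T(1) by blast
    have "(g' \<bullet> \<phi>) \<bullet> k = zero_mor C (src k) T"
    proof (rule lin_span_comp_zero_right[OF A TO ST ks(2,3) _ sp])
      fix \<psi> assume \<psi>: "\<psi> \<in> S T"
      then have "tgt \<psi> = T" using arS T(1) by blast
      then show "\<psi> \<bullet> k = zero_mor C (src k) T" using ks(4)[of \<psi>] \<psi> T(1) by auto
    qed
    then have z: "g' \<bullet> (\<phi> \<bullet> k) = zero_mor C (src k) T" using g' \<phi> ks T by simp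
    have "g \<bullet> (g' \<bullet> (\<phi> \<bullet> k)) = ident C (tgt g) \<bullet> (\<phi> \<bullet> k)"
      by (rule comp_reduce[OF g'(4)]) (use g' ga \<phi> ks T in simp_all)
    then show ?thesis unfolding z using g' ga \<phi> ks T by simp
  qed
  ultimately show ?thesis using that by blast
qed

text \<open>The quotient by this common kernel is the maximal semi-simple one: a morphism to a semi-simple
  object kills the common kernel, because its components are morphisms to simple objects.\<close>

lemma maximal_semisimple_quotient:
  assumes A: "A \<in> Ob C"
  obtains c where "epi c" "src c = A" "semisimple_object C (tgt c)"
    "\<And>f. arrow f \<Longrightarrow> src f = A \<Longrightarrow> semisimple_object C (tgt f) \<Longrightarrow> \<exists>u. arr u (tgt c) (tgt f) \<and> u \<bullet> c = f"
proof -
  obtain \<Phi> where \<Phi>: "to_simples A \<Phi>" and rad: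
    "\<And>k \<phi>. joint_kernel A \<Phi> k \<Longrightarrow> arrow \<phi> \<Longrightarrow> src \<phi> = A \<Longrightarrow> simple_object C (tgt \<phi>) \<Longrightarrow>
      \<phi> \<bullet> k = zero_mor C (src k) (tgt \<phi>)"
    using radical_family[OF A] by blast
  obtain k where k: "joint_kernel A \<Phi> k"
    using joint_kernel_exists[of \<Phi> A] \<Phi> unfolding to_simples_def by blast
  note ks = joint_kernelD[OF k]
  obtain c where c: "cokernel k c" using cokernel_exists[OF ks(2)] by blast
  note cs = cokernelD[OF c]
  have "\<exists>u. arr u (tgt c) (tgt f) \<and> u \<bullet> c = f"
    if f: "arrow f" "src f = A" "semisimple_object C (tgt f)" for f
  proof -
    obtain \<Psi> where \<Psi>: "to_simples (tgt f) \<Psi>" "jointly_monic (tgt f) \<Psi>"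
      using f(3) unfolding semisimple_iff_jointly_monic by blast
    have fk: "arrow (f \<bullet> k)" "src (f \<bullet> k) = src k" "tgt (f \<bullet> k) = tgt f" using f ks by simp_all
    have "f \<bullet> k = zero_mor C (src (f \<bullet> k)) (tgt f)"
    proof (rule jointly_monicD[OF \<Psi>(2) fk(1,3)])
      fix \<psi> assume \<psi>: "\<psi> \<in> \<Psi>"
      note s = to_simplesD[OF \<Psi>(1) \<psi>]
      have "(\<psi> \<bullet> f) \<bullet> k = zero_mor C (src k) (tgt (\<psi> \<bullet> f))"
        by (rule rad[OF k]) (use s f in simp_all)
      then show "\<psi> \<bullet> (f \<bullet> k) = zero_mor C (src (f \<bullet> k)) (tgt \<psi>)" using s f ks by simp
    qed
    then obtain u where "arrow u" "src u = tgt c" "tgt u = tgt f" "u \<bullet> c = f"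
      using cokernel_lift[OF c f(1)] f ks fk by metis
    then show ?thesis using f(1) cs(3) by (intro exI[of _ u]) simp
  qed
  then show ?thesis using that[of c] cs ks coimage_semisimple[OF \<Phi> k c] by simp
qed

end

section \<open>Left adjoint and radical\<close>

text \<open>The two closure properties of the category of modules that make the left adjoint a functor to it.\<close>

lemma mod_kn_ident:
  "ident (mod_kn n) M \<in> mor (mod_kn n) M M" if "M \<in> Ob (mod_kn n)"
proof -
  interpret module "kn_ring n" M using that unfolding mod_kn_def by simp
  show ?thesis unfolding mod_kn_def kn_linear_maps_def by auto
qed

lemma mod_kn_comp:
  assumes "M \<in> Ob (mod_kn n)" "f \<in> mor (mod_kn n) M N" "g \<in> mor (mod_kn n) N L"
  shows "g \<bullet>\<^bsub>mod_kn n\<^esub> f \<in> mor (mod_kn n) M L"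
proof -
  interpret module "kn_ring n" M using assms(1) unfolding mod_kn_def by simp
  obtain f' g' where f': "f = (M, N, f')" "f' \<in> kn_linear_maps n M N"
    and g': "g = (N, L, g')" "g' \<in> kn_linear_maps n N L"
    using assms unfolding mod_kn_def by auto
  have fN: "f' x \<in> carrier N" if "x \<in> carrier M" for x
    using f'(2) that unfolding kn_linear_maps_def by auto
  have "compose (carrier M) g' f' \<in> kn_linear_maps n M L"
    using f'(2) g'(2) fN unfolding kn_linear_maps_def
    by (auto simp: compose_def PiE_iff)
  then show ?thesis unfolding mod_kn_def f' g' by auto
qed

locale semisimple_embedding = finite_length_category C
  for C :: "('o, 'm, 'k::field) lcat" (structure) +
  fixes n :: nat and Q :: "('o, 'm, 'k) kn_functor"
  assumes Q_linear: "is_linear_functor (mod_kn n) C Q"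
    and Q_fully_faithful: "fully_faithful (mod_kn n) C Q"
    and Q_image: "essential_image (mod_kn n) C Q = {S. semisimple_object C S}"
begin

abbreviation \<M> where "\<M> \<equiv> mod_kn n :: ('k kn_module, 'k kn_mor, 'k) lcat"

lemma Q_functor: "is_functor \<M> C Q"
  using Q_linear unfolding is_linear_functor_def by blast

lemma Q_Ob: "M \<in> Ob \<M> \<Longrightarrow> fob Q M \<in> Ob C"
  using Q_functor unfolding is_functor_def by blast

lemma Q_ident: "M \<in> Ob \<M> \<Longrightarrow> fmor Q (ident \<M> M) = ident C (fob Q M)"
  using Q_functor unfolding is_functor_def by blast

lemma Q_mor:
  "M \<in> Ob \<M> \<Longrightarrow> N \<in> Ob \<M> \<Longrightarrow> g \<in> mor \<M> M N \<Longrightarrow> arr (fmor Q g) (fob Q M) (fob Q N)"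
  using Q_functor Q_Ob unfolding is_functor_def by (intro arrI) blast+

lemma Q_comp:
  "M \<in> Ob \<M> \<Longrightarrow> N \<in> Ob \<M> \<Longrightarrow> L \<in> Ob \<M> \<Longrightarrow> f \<in> mor \<M> M N \<Longrightarrow> g \<in> mor \<M> N L \<Longrightarrow>
    fmor Q (g \<bullet>\<^bsub>\<M>\<^esub> f) = fmor Q g \<bullet> fmor Q f"
  using Q_functor unfolding is_functor_def by blast

lemma Q_semisimple: "semisimple_object C (fob Q M)" if M: "M \<in> Ob \<M>"
proof -
  have o: "fob Q M \<in> Ob C" using Q_Ob[OF M] .
  have "isomorphic C (fob Q M) (fob Q M)"
    unfolding isomorphic_def using isomorphism_iff[OF o o, of "ident C (fob Q M)"] iso_ident o by auto
  then have "fob Q M \<in> essential_image \<M> C Q" unfolding essential_image_def using M by blast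
  then show ?thesis using Q_image by blast
qed

lemma semisimple_in_image:
  assumes S: "semisimple_object C S"
  obtains M g where "M \<in> Ob \<M>" "iso g" "src g = S" "tgt g = fob Q M"
proof -
  have "S \<in> essential_image \<M> C Q" using S Q_image by blast
  then obtain M h where M: "M \<in> Ob \<M>" and o: "fob Q M \<in> Ob C" "S \<in> Ob C" and h: "isomorphism C (fob Q M) S h"
    unfolding essential_image_def isomorphic_def by blast
  have h': "iso h" "src h = fob Q M" "tgt h = S" using h isomorphism_iff[OF o] by auto
  obtain g where "iso g" "src g = tgt h" "tgt g = src h" using isoD[OF h'(1)] by metis
  then show ?thesis using that M h' by simp
qed

lemma Q_full:
  assumes "M \<in> Ob \<M>" "N \<in> Ob \<M>" "arr f (fob Q M) (fob Q N)"
  obtains g where "g \<in> mor \<M> M N" "fmor Q g = f"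
proof -
  have "bij_betw (fmor Q) (mor \<M> M N) (mor C (fob Q M) (fob Q N))"
    using Q_fully_faithful assms unfolding fully_faithful_def by blast
  then have "f \<in> fmor Q ` mor \<M> M N"
    using arr_mor[OF assms(3)] by (simp add: bij_betw_imp_surj_on)
  then show ?thesis using that by blast
qed

lemma Q_faithful:
  assumes "M \<in> Ob \<M>" "N \<in> Ob \<M>" "g \<in> mor \<M> M N" "h \<in> mor \<M> M N" "fmor Q g = fmor Q h"
  shows "g = h"
proof -
  have "bij_betw (fmor Q) (mor \<M> M N) (mor C (fob Q M) (fob Q N))"
    using Q_fully_faithful assms unfolding fully_faithful_def by blast
  then show ?thesis using assms(3-5) bij_betw_imp_inj_on inj_onD by metis
qed

text \<open>The quotient map to the maximal semi-simple quotient, the latter being in the essential image.\<close>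

lemma universal_arrow:
  assumes A: "A \<in> Ob C"
  shows "\<exists>M \<eta>. M \<in> Ob \<M> \<and> arr \<eta> A (fob Q M) \<and>
    (\<forall>N \<in> Ob \<M>. \<forall>f \<in> mor C A (fob Q N). \<exists>!g. g \<in> mor \<M> M N \<and> fmor Q g \<bullet> \<eta> = f)"
proof -
  obtain c where c: "epi c" "src c = A" "semisimple_object C (tgt c)" and
    c_lift: "\<And>f. arrow f \<Longrightarrow> src f = A \<Longrightarrow> semisimple_object C (tgt f) \<Longrightarrow> \<exists>u. arr u (tgt c) (tgt f) \<and> u \<bullet> c = f"
    using maximal_semisimple_quotient[OF A] by blast
  obtain M s where M: "M \<in> Ob \<M>" and s: "iso s" "src s = tgt c" "tgt s = fob Q M"
    using semisimple_in_image[OF c(3)] by blast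
  obtain s' where s': "arrow s'" "src s' = tgt s" "tgt s' = src s" "s' \<bullet> s = ident C (src s)"
    using isoD[OF s(1)] by metis
  note ss = iso_mon_epi[OF s(1)]
  have ca: "arrow c" using c by simp
  let ?\<eta> = "s \<bullet> c"
  have e: "epi ?\<eta>" using epi_comp[OF c(1) ss(3)] s by simp
  have \<eta>: "arrow ?\<eta>" "src ?\<eta> = A" "tgt ?\<eta> = fob Q M" using ss s ca c by simp_all
  have "\<exists>!g. g \<in> mor \<M> M N \<and> fmor Q g \<bullet> ?\<eta> = f"
    if N: "N \<in> Ob \<M>" and f: "f \<in> mor C A (fob Q N)" for N f
  proof -
    have fa: "arrow f" "src f = A" "tgt f = fob Q N" using f A Q_Ob[OF N] by (simp_all add: mor_iff)
    obtain u where u: "arrow u" "src u = tgt c" "tgt u = fob Q N" "u \<bullet> c = f"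
      using c_lift[OF fa(1,2)] Q_semisimple[OF N] fa by auto
    have us: "arr (u \<bullet> s') (fob Q M) (fob Q N)" using u s' s Q_Ob M N by simp
    obtain g where g: "g \<in> mor \<M> M N" "fmor Q g = u \<bullet> s'" using Q_full[OF M N us] by blast
    have "s' \<bullet> (s \<bullet> c) = ident C (src s) \<bullet> c"
      by (rule comp_reduce[OF s'(4)]) (use s' ss s ca in simp_all)
    then have "fmor Q g \<bullet> ?\<eta> = f" unfolding g(2) using u s' ss s ca by simp
    moreover have "g1 = g" if g1: "g1 \<in> mor \<M> M N" "fmor Q g1 \<bullet> ?\<eta> = f" for g1
    proof (rule Q_faithful[OF M N g1(1) g(1)], rule epi_cancel[OF e])
      show "fmor Q g1 \<bullet> ?\<eta> = fmor Q g \<bullet> ?\<eta>" using g1 calculation by simp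
    qed (use Q_mor[OF M N g1(1)] Q_mor[OF M N g(1)] \<eta> in simp_all)
    ultimately show ?thesis using g(1) by blast
  qed
  then show ?thesis using M \<eta> A Q_Ob[OF M] by (intro exI[of _ M] exI[of _ ?\<eta>]) simp
qed

text \<open>Radicals are defined through a left adjoint of \<open>Q\<close>; it is assembled from universal arrows.\<close>

lemma left_adjoint_exists:
  obtains L \<eta> where "left_adjoint_with_unit \<M> C Q L \<eta>"
proof -
  have "\<forall>A\<in>Ob C. \<exists>M\<eta>. fst M\<eta> \<in> Ob \<M> \<and> arr (snd M\<eta>) A (fob Q (fst M\<eta>)) \<and>
    (\<forall>N \<in> Ob \<M>. \<forall>f \<in> mor C A (fob Q N). \<exists>!g. g \<in> mor \<M> (fst M\<eta>) N \<and> fmor Q g \<bullet> snd M\<eta> = f)"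
    using universal_arrow by simp
  then obtain M\<eta> where M\<eta>: "\<forall>A\<in>Ob C. fst (M\<eta> A) \<in> Ob \<M> \<and> arr (snd (M\<eta> A)) A (fob Q (fst (M\<eta> A))) \<and>
    (\<forall>N \<in> Ob \<M>. \<forall>f \<in> mor C A (fob Q N). \<exists>!g. g \<in> mor \<M> (fst (M\<eta> A)) N \<and> fmor Q g \<bullet> snd (M\<eta> A) = f)"
    by (rule bchoice[THEN exE])
  define l where "l = (\<lambda>A. fst (M\<eta> A))"
  define \<eta> where "\<eta> = (\<lambda>A. snd (M\<eta> A))"
  have l: "l A \<in> Ob \<M>" and \<eta>: "arrow (\<eta> A)" "src (\<eta> A) = A" "tgt (\<eta> A) = fob Q (l A)"
    if "A \<in> Ob C" for A using M\<eta> that unfolding l_def \<eta>_def by auto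
  have univ: "\<exists>!g. g \<in> mor \<M> (l A) N \<and> fmor Q g \<bullet> \<eta> A = f"
    if "A \<in> Ob C" "N \<in> Ob \<M>" "f \<in> mor C A (fob Q N)" for A N f
    using M\<eta> that unfolding l_def \<eta>_def by blast
  define lm where "lm = (\<lambda>h. THE g. g \<in> mor \<M> (l (src h)) (l (tgt h)) \<and> fmor Q g \<bullet> \<eta> (src h) = \<eta> (tgt h) \<bullet> h)"
  have uni: "\<exists>!g. g \<in> mor \<M> (l A) (l B) \<and> fmor Q g \<bullet> \<eta> A = \<eta> B \<bullet> h"
    if o: "A \<in> Ob C" "B \<in> Ob C" and h: "h \<in> mor C A B" for A B h
  proof (rule univ[OF o(1) l[OF o(2)]])
    show "\<eta> B \<bullet> h \<in> mor C A (fob Q (l B))"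
      using h o \<eta>[OF o(2)] Q_Ob[OF l[OF o(2)]] by (simp add: mor_iff)
  qed
  have lm: "lm h \<in> mor \<M> (l A) (l B)" "fmor Q (lm h) \<bullet> \<eta> A = \<eta> B \<bullet> h"
    if o: "A \<in> Ob C" "B \<in> Ob C" and h: "h \<in> mor C A B" for A B h
  proof -
    have "src h = A" "tgt h = B" using h o by (simp_all add: mor_iff)
    then show "lm h \<in> mor \<M> (l A) (l B)" "fmor Q (lm h) \<bullet> \<eta> A = \<eta> B \<bullet> h"
      using theI'[OF uni[OF o h]] unfolding lm_def by simp_all
  qed
  have lm_unique: "lm h = g"
    if o: "A \<in> Ob C" "B \<in> Ob C" and h: "h \<in> mor C A B"
      and g: "g \<in> mor \<M> (l A) (l B)" "fmor Q g \<bullet> \<eta> A = \<eta> B \<bullet> h" for A B h g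
    using uni[OF o h] lm[OF o h] g by blast
  let ?L = "\<lparr>fob = l, fmor = lm\<rparr>"
  have "is_functor C \<M> ?L" unfolding is_functor_def
  proof (intro conjI ballI)
    fix A assume A: "A \<in> Ob C"
    show "fob ?L A \<in> Ob \<M>" using l[OF A] by simp
    have "lm (ident C A) = ident \<M> (l A)"
    proof (rule lm_unique[OF A A ident_closed[OF A] mod_kn_ident[OF l[OF A]]])
      show "fmor Q (ident \<M> (l A)) \<bullet> \<eta> A = \<eta> A \<bullet> ident C A"
        using Q_ident[OF l[OF A]] \<eta>[OF A] by simp
    qed
    then show "fmor ?L (ident C A) = ident \<M> (fob ?L A)" by simp
  next
    fix A B f assume "A \<in> Ob C" "B \<in> Ob C" "f \<in> mor C A B"
    then show "fmor ?L f \<in> mor \<M> (fob ?L A) (fob ?L B)" using lm(1) by simp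
  next
    fix A B D f g assume o: "A \<in> Ob C" "B \<in> Ob C" "D \<in> Ob C"
      and f: "f \<in> mor C A B" and g: "g \<in> mor C B D"
    have fa: "arrow f" "src f = A" "tgt f = B" "arrow g" "src g = B" "tgt g = D"
      using f g o by (simp_all add: mor_iff)
    note lf = lm[OF o(1,2) f] and lg = lm[OF o(2,3) g]
    have Qf: "arrow (fmor Q (lm f))" "src (fmor Q (lm f)) = fob Q (l A)" "tgt (fmor Q (lm f)) = fob Q (l B)"
      using Q_mor[OF l[OF o(1)] l[OF o(2)] lf(1)] by simp_all
    have Qg: "arrow (fmor Q (lm g))" "src (fmor Q (lm g)) = fob Q (l B)" "tgt (fmor Q (lm g)) = fob Q (l D)"
      using Q_mor[OF l[OF o(2)] l[OF o(3)] lg(1)] by simp_all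
    have "lm (g \<bullet> f) = lm g \<bullet>\<^bsub>\<M>\<^esub> lm f"
    proof (rule lm_unique[OF o(1,3) comp_closed[OF o f g] mod_kn_comp[OF l[OF o(1)] lf(1) lg(1)]])
      have "fmor Q (lm g \<bullet>\<^bsub>\<M>\<^esub> lm f) \<bullet> \<eta> A = fmor Q (lm g) \<bullet> (fmor Q (lm f) \<bullet> \<eta> A)"
        unfolding Q_comp[OF l[OF o(1)] l[OF o(2)] l[OF o(3)] lf(1) lg(1)]
        by (rule assoc) (use Qf Qg \<eta>[OF o(1)] in simp_all)
      also have "\<dots> = fmor Q (lm g) \<bullet> (\<eta> B \<bullet> f)" using lf(2) by simp
      also have "\<dots> = (\<eta> D \<bullet> g) \<bullet> f"
        by (rule comp_reduce[OF lg(2)]) (use Qg \<eta>[OF o(2)] fa in simp_all)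
      also have "\<dots> = \<eta> D \<bullet> (g \<bullet> f)" using \<eta>[OF o(3)] fa by simp
      finally show "fmor Q (lm g \<bullet>\<^bsub>\<M>\<^esub> lm f) \<bullet> \<eta> A = \<eta> D \<bullet> (g \<bullet> f)" .
    qed
    then show "fmor ?L (g \<bullet> f) = fmor ?L g \<bullet>\<^bsub>\<M>\<^esub> fmor ?L f" by simp
  qed
  moreover have "natural_transformation C C functor_id (functor_comp Q ?L) \<eta>"
    unfolding natural_transformation_def functor_id_def functor_comp_def
  proof (intro conjI ballI)
    fix A assume A: "A \<in> Ob C"
    show "\<eta> A \<in> mor C (fob \<lparr>fob = \<lambda>A. A, fmor = \<lambda>f. f\<rparr> A) (fob \<lparr>fob = fob Q \<circ> fob ?L, fmor = fmor Q \<circ> fmor ?L\<rparr> A)"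
      using \<eta>[OF A] A Q_Ob[OF l[OF A]] by (simp add: mor_iff)
  next
    fix A B f assume o: "A \<in> Ob C" "B \<in> Ob C" "f \<in> mor C A B"
    then show "\<eta> B \<bullet> fmor \<lparr>fob = \<lambda>A. A, fmor = \<lambda>f. f\<rparr> f = fmor \<lparr>fob = fob Q \<circ> fob ?L, fmor = fmor Q \<circ> fmor ?L\<rparr> f \<bullet> \<eta> A"
      using lm(2)[OF o] by simp
  qed
  ultimately have "left_adjoint_with_unit \<M> C Q ?L \<eta>"
    unfolding left_adjoint_with_unit_def using univ by simp
  then show ?thesis using that by blast
qed

lemma left_adjointD:
  assumes "left_adjoint_with_unit \<M> C Q L \<eta>" "A \<in> Ob C"
  shows "fob L A \<in> Ob \<M>" "arr (\<eta> A) A (fob Q (fob L A))"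
proof -
  show l: "fob L A \<in> Ob \<M>" using assms unfolding left_adjoint_with_unit_def is_functor_def by blast
  have "\<eta> A \<in> mor C A (fob Q (fob L A))"
    using assms unfolding left_adjoint_with_unit_def natural_transformation_def functor_id_def functor_comp_def
    by simp
  then show "arr (\<eta> A) A (fob Q (fob L A))" using arrI assms(2) Q_Ob[OF l] by blast
qed

lemma is_radical_power_Suc:
  "is_radical n C Q A B \<Longrightarrow> is_radical_power n C Q l B R \<Longrightarrow> is_radical_power n C Q (Suc l) A R"
  by (induction l arbitrary: R) (simp, metis is_radical_power.simps(2))

text \<open>Every morphism to a simple object factors through the adjunction unit, so it vanishes on the radical.
  Hence the radical is contained in the first step of any Loewy filtration, and iterated radicals
  reach zero at least as fast.\<close>

lemma is_radical_power_if_loewy_le: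
  assumes "loewy_le j A"
  shows "\<exists>R. is_radical_power n C Q j A R \<and> zero_object C R"
  using assms
proof (induction j arbitrary: A)
  case 0
  then show ?case by simp
next
  case (Suc j)
  have A: "A \<in> Ob C" using loewy_le_Ob[OF Suc.prems] .
  obtain \<Phi> k where \<Phi>: "to_simples A \<Phi>" and k: "joint_kernel A \<Phi> k" and lk: "loewy_le j (src k)"
    using Suc.prems by auto
  note ks = joint_kernelD[OF k]
  obtain L \<eta> where L: "left_adjoint_with_unit \<M> C Q L \<eta>" using left_adjoint_exists by blast
  note ad = left_adjointD[OF L A]
  have \<eta>: "arrow (\<eta> A)" "src (\<eta> A) = A" "tgt (\<eta> A) = fob Q (fob L A)" using ad(2) by auto
  obtain i where i: "kernel (\<eta> A) i" using kernel_exists[OF \<eta>(1)] by blast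
  note ki = kernelD[OF i]
  have "is_kernel C A (fob Q (fob L A)) (\<eta> A) (src i) i"
    using is_kernel_iff[OF A Q_Ob[OF ad(1)]] i \<eta> by blast
  then have rad: "is_radical n C Q A (src i)" unfolding is_radical_def using L by blast
  have "\<phi> \<bullet> i = zero_mor C (src i) (tgt \<phi>)" if \<phi>: "\<phi> \<in> \<Phi>" for \<phi>
  proof -
    note s = to_simplesD[OF \<Phi> \<phi>]
    obtain N g where N: "N \<in> Ob \<M>" and g: "iso g" "src g = tgt \<phi>" "tgt g = fob Q N"
      using semisimple_in_image[OF simple_semisimple[OF s(3)]] by blast
    note gs = iso_mon_epi[OF g(1)]
    have "g \<bullet> \<phi> \<in> mor C A (fob Q N)" using gs g s A Q_Ob[OF N] by (simp add: mor_iff)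
    then obtain h where h: "h \<in> mor \<M> (fob L A) N" "fmor Q h \<bullet> \<eta> A = g \<bullet> \<phi>"
      using L A N unfolding left_adjoint_with_unit_def by blast
    have Qh: "arrow (fmor Q h)" "src (fmor Q h) = fob Q (fob L A)" "tgt (fmor Q h) = fob Q N"
      using Q_mor[OF ad(1) N h(1)] by simp_all
    have "g \<bullet> (\<phi> \<bullet> i) = fmor Q h \<bullet> (\<eta> A \<bullet> i)"
      by (rule comp_reduce2[OF h(2)[symmetric]]) (use gs g s ki \<eta> Qh in simp_all)
    also have "\<dots> = zero_mor C (src (\<phi> \<bullet> i)) (tgt g)" using ki \<eta> Qh g s by simp
    finally have "\<phi> \<bullet> i = zero_mor C (src (\<phi> \<bullet> i)) (src g)"
      using monD[OF gs(2), of "\<phi> \<bullet> i"] s ki \<eta> g by simp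
    then show ?thesis using s ki \<eta> g by simp
  qed
  then obtain u where u: "arrow u" "src u = src i" "tgt u = src k" "k \<bullet> u = i"
    using joint_kernel_lift[OF k ki(3)] ki \<eta> by auto
  have "mon u" using mon_if_comp_mon[of k u] u ki ks by simp
  then have "loewy_le j (src i)" using loewy_le_subobject[of u j] u lk by simp
  then obtain R where "is_radical_power n C Q j (src i) R" "zero_object C R" using Suc.IH by blast
  then show ?case using is_radical_power_Suc[OF rad] by blast
qed

lemma is_radical_power_Ob:
  "A \<in> Ob C \<Longrightarrow> is_radical_power n C Q l A R \<Longrightarrow> R \<in> Ob C"
  by (induction l arbitrary: R) (auto simp: is_radical_def is_kernel_def)

text \<open>Conversely the iterated radicals are a Loewy filtration, a radical being the kernel of a morphism
  to a semi-simple object.\<close>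

lemma loewy_le_if_is_radical_power:
  assumes "A \<in> Ob C" "is_radical_power n C Q l A R" "loewy_le j R"
  shows "loewy_le (j + l) A"
  using assms(2,3)
proof (induction l arbitrary: R j)
  case 0
  then show ?case by simp
next
  case (Suc l)
  then obtain B where B: "is_radical_power n C Q l A B" "is_radical n C Q B R" by auto
  then obtain L \<eta> i where L: "left_adjoint_with_unit \<M> C Q L \<eta>"
    and i: "is_kernel C B (fob Q (fob L B)) (\<eta> B) R i" unfolding is_radical_def by blast
  have BO: "B \<in> Ob C" using is_radical_power_Ob[OF assms(1) B(1)] .
  note ad = left_adjointD[OF L BO]
  have k: "kernel (\<eta> B) i" "src (\<eta> B) = B" "tgt (\<eta> B) = fob Q (fob L B)" "src i = R"
    using is_kernel_iff[OF BO Q_Ob[OF ad(1)]] i by auto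
  have "loewy_le (Suc j) B"
    using loewy_le_kernel[OF k(1), of j] k Q_semisimple[OF ad(1)] Suc.prems by simp
  then show ?case using Suc.IH[OF B(1)] by fastforce
qed

text \<open>The subcategory then contains all objects, so that its inclusion is the identity functor.\<close>

lemma Loewy_subcategory_equivalent_if_bounded:
  assumes "\<And>A. A \<in> Ob C \<Longrightarrow> loewy_le (Suc l) A"
  shows "is_equivalence (Loewy_subcategory n C Q l) C functor_id"
proof -
  have "Ob C \<subseteq> {A. \<exists>R. is_radical_power n C Q (l + 1) A R \<and> zero_object C R}"
    using is_radical_power_if_loewy_le[OF assms] by auto
  then have "Ob C \<inter> {A. \<exists>R. is_radical_power n C Q (l + 1) A R \<and> zero_object C R} = Ob C" by blast
  then have "Loewy_subcategory n C Q l = C\<lparr>Ob := Ob C\<rparr>"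
    unfolding Loewy_subcategory_def full_subcategory_def by (rule arg_cong)
  then have eq: "Loewy_subcategory n C Q l = C" by (cases C) simp
  have F: "is_functor C C functor_id" unfolding is_functor_def functor_id_def by simp
  have id: "functor_comp functor_id functor_id = functor_id"
    unfolding functor_comp_def functor_id_def by (simp add: fun_eq_iff)
  have "natural_isomorphism C C functor_id functor_id (ident C)"
    unfolding natural_isomorphism_def natural_transformation_def functor_id_def
    using ident_closed isomorphism_iff iso_ident by (simp add: comp_ident_left comp_ident_right)
  then show ?thesis unfolding eq is_equivalence_def using F id by metis
qed

lemma bounded_if_Loewy_subcategory_equivalent:
  assumes eq: "is_equivalence (Loewy_subcategory n C Q l) C functor_id" and A: "A \<in> Ob C"
  shows "loewy_le (Suc l) A"
proof -
  let ?D = "Loewy_subcategory n C Q l"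
  obtain G \<epsilon> where G: "is_functor C ?D G"
    and \<epsilon>: "natural_isomorphism C C (functor_comp functor_id G) functor_id \<epsilon>"
    using eq unfolding is_equivalence_def by blast
  let ?B = "fob G A"
  have "?B \<in> Ob ?D" using G A unfolding is_functor_def by blast
  then obtain R where B: "?B \<in> Ob C" and R: "is_radical_power n C Q (l + 1) ?B R" "zero_object C R"
    unfolding Loewy_subcategory_def full_subcategory_def by auto
  have "isomorphism C ?B A (\<epsilon> A)"
    using \<epsilon> A unfolding natural_isomorphism_def functor_comp_def functor_id_def by simp
  then have e: "iso (\<epsilon> A)" "src (\<epsilon> A) = ?B" "tgt (\<epsilon> A) = A" using isomorphism_iff[OF B A] by auto
  obtain g where g: "iso g" "src g = A" "tgt g = ?B" using isoD[OF e(1)] e by metis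
  have "loewy_le (0 + (l + 1)) ?B" by (rule loewy_le_if_is_radical_power[OF B R(1)]) (use R in simp)
  then show ?thesis using loewy_le_subobject[OF iso_mon_epi(2)[OF g(1)], of "Suc l"] g by simp
qed

end

theorem theorem4p6:
  fixes \<A> :: "('o, 'm, 'k::alg_closed_field) lcat"
    and Q :: "('o, 'm, 'k) kn_functor"
    and n :: nat
  assumes "(\<A>, Q) \<in> Df_tilde n"
  shows "(\<A>, Q) \<in> Df n \<longleftrightarrow>
    (\<exists>l. is_equivalence (Loewy_subcategory n \<A> Q l) \<A> functor_id)"
proof -
  have "finite_length_category \<A>" "semisimple_embedding_axioms \<A> n Q"
    using assms unfolding Df_tilde_def semisimple_embedding_axioms_def by auto
  then interpret semisimple_embedding \<A> n Q by (rule semisimple_embedding.intro)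
  show ?thesis
  proof
    assume "(\<A>, Q) \<in> Df n"
    then obtain P where P: "projective_generator \<A> P" unfolding Df_def by blast
    then have gen: "generator \<A> P" and "P \<in> Ob \<A>"
      unfolding projective_generator_def generator_def by auto
    then obtain l where "loewy_le l P"
      using semisimple_filtration_loewy_le[OF semisimple_filtrations] by blast
    \<comment> \<open>The subcategory of index \<open>l\<close> is defined by the vanishing of the \<open>(l + 1)\<close>-st radical power.\<close>
    then have "loewy_le (Suc l) A" if "A \<in> Ob \<A>" for A
      using loewy_bounded_if_generator[OF gen loewy_le_Suc that] by blast
    then show "\<exists>l. is_equivalence (Loewy_subcategory n \<A> Q l) \<A> functor_id"
      using Loewy_subcategory_equivalent_if_bounded by blast
  next
    assume "\<exists>l. is_equivalence (Loewy_subcategory n \<A> Q l) \<A> functor_id"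
    then obtain l where "is_equivalence (Loewy_subcategory n \<A> Q l) \<A> functor_id" by blast
    then obtain P where "projective_generator \<A> P"
      using projective_generator_if_loewy_bounded[of "Suc l"] bounded_if_Loewy_subcategory_equivalent
      by blast
    then show "(\<A>, Q) \<in> Df n" unfolding Df_def using assms by blast
  qed
qed

end
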